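(* Let $q$ be a power of a prime $p$, and let $\ell,n$ be positive integers, not both equal to $1$, with $\gcd(p,\ell)=1$. Let $e:=\gcd(\ell(q-1),q^n-1)$, $N:=q^{n-1}(e+1)$ and $g:=(q^{n-1}-1)(\ell-1)/2$; these are respectively such that $N$ is the number of $\mathbb{F}_{q^n}$-rational points of the affine curve $A_{n,q,\ell}: y^{q^{n-1}}+y^{q^{n-2}}+\cdots+y=x^{\ell}$ and $g$ is its genus. Let $m$ be a nonnegative integer with $2g-2<m<N$ and $$2(m+1)\le (q^{n-1}-1)(\ell-1)+q^{n-1}(\mu\cdot e+1),$$ where $\mu:=1$ if $p$ divides $e+1$ and $\mu:=0$ otherwise. Then there exists (obtained from the AG code $C(D,mP_\infty)$ over $\mathbb{F}_{q^n}$ of this curve) a quantum code with parameters $$[[N,\,N-2m+2g-2,\,\ge m-2g+2]]_{q^n}.$$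
   Context: The curve $A_{n,q,\ell}$ over $\mathbb{F}_{q^n}$ is smooth, geometrically irreducible and has exactly one place at infinity: the normalization of its projective closure in $\mathbb{P}^2$ is $A_{n,q,\ell}$ together with a single further $\mathbb{F}_{q^n}$-rational point $P_\infty$. $D=P_1+\cdots+P_N$ is the sum of all $\mathbb{F}_{q^n}$-rational points of the affine curve, and $C(D,mP_\infty)$ is the image of $\mathcal{L}(mP_\infty)$ (functions over $\mathbb{F}_{q^n}$) under $h\mapsto(h(P_1),\dots,h(P_N))$. For a prime power $Q$, an $[[N,K,\ge d]]_{Q}$ quantum code here is a stabilizer quantum code: a $Q^K$-dimensional subspace of $(\mathbb{C}^{Q})^{\otimes N}$ that is the joint $+1$-eigenspace of an abelian subgroup of the generalized Pauli (error) group, with minimum distance at least $d$. It is a standard known fact that a linear $[N,k]$ code $\mathcal C$ over $\mathbb{F}_Q$ with $\mathcal C\subseteq\mathcal C^\perp$ (Euclidean dual) yields an $[[N,N-2k,\ge d^\perp]]_Q$ stabilizer code, where $d^\perp$ is the minimum distance of $\mathcal C^\perp$. *)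

theory Defs
  imports
    "HOL-Algebra.Algebraic_Closure_Type"
    "HOL-Computational_Algebra.Computational_Algebra"
    "HOL-Library.Cardinality"
    "HOL-Library.Function_Algebras"
    "Jordan_Normal_Form.Matrix"
    Complex_Main
begin

section \<open>The curve and its function field\<close>

text \<open>
  The ground field with \<open>q ^ n\<close> elements is the type \<open>'a\<close>.  The function field of the curve is
  realised as the subfield generated by \<open>x\<close> and \<open>y\<close> of an algebraic closure of the rational
  function field in \<open>x\<close>, where \<open>y\<close> is a root of the curve equation.  As the curve is
  irreducible, all roots \<open>y\<close> are conjugate over the rational function field.
\<close>

definition on_curve :: "nat \<Rightarrow> nat \<Rightarrow> nat \<Rightarrow> 'k::comm_ring_1 \<Rightarrow> 'k \<Rightarrow> bool" where
  "on_curve n q l a b \<longleftrightarrow> (\<Sum>i<n. b ^ (q ^ i)) = a ^ l"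

definition rational_points :: "nat \<Rightarrow> nat \<Rightarrow> nat \<Rightarrow> ('a::field \<times> 'a) set" where
  "rational_points n q l = {(a, b). on_curve n q l a b}"

type_synonym 'a ratfun_closure = "'a poly fract alg_closure"

definition const_fun :: "'a::field \<Rightarrow> 'a ratfun_closure" where
  "const_fun c = to_ac (to_fract [:c:])"

definition x_fun :: "'a::field ratfun_closure" where
  "x_fun = to_ac (to_fract [:0, 1:])"

text \<open>
  Bivariate polynomials are polynomials in \<open>y\<close> (outer) with coefficients in \<open>'a[x]\<close> (inner).
\<close>

definition eval_point :: "'a::field poly poly \<Rightarrow> 'a \<times> 'a \<Rightarrow> 'a" where
  "eval_point A P = poly (map_poly (\<lambda>r. poly r (fst P)) A) (snd P)"

definition eval_fun :: "'a::field poly poly \<Rightarrow> 'a ratfun_closure \<Rightarrow> 'a ratfun_closure" where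
  "eval_fun A y = poly (map_poly (\<lambda>r. poly (map_poly const_fun r) x_fun) A) y"

definition function_field :: "'a::field ratfun_closure \<Rightarrow> 'a ratfun_closure set" where
  "function_field y = {eval_fun A y / eval_fun B y | A B. eval_fun B y \<noteq> 0}"

text \<open>
  A place of the function field is given by its normalised discrete valuation, trivial on the
  constants.  The value of \<open>v\<close> at \<open>0\<close> (mathematically infinite) and outside the function field
  is irrelevant.
\<close>

definition place :: "'a::field ratfun_closure \<Rightarrow> ('a ratfun_closure \<Rightarrow> int) \<Rightarrow> bool" where
  "place y v \<longleftrightarrow>
     (\<forall>f\<in>function_field y - {0}. \<forall>h\<in>function_field y - {0}. v (f * h) = v f + v h) \<and>
     (\<forall>f\<in>function_field y - {0}. \<forall>h\<in>function_field y - {0}.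
        f + h \<noteq> 0 \<longrightarrow> min (v f) (v h) \<le> v (f + h)) \<and>
     (\<forall>c. c \<noteq> 0 \<longrightarrow> v (const_fun c) = 0) \<and>
     (\<exists>t\<in>function_field y - {0}. v t = 1)"

text \<open>
  The places at infinity are those at which \<open>x\<close> or \<open>y\<close> has a pole.  The curve has exactly one of
  them, so no choice is involved in referring to it through this predicate.  (Neither \<open>x\<close> nor
  \<open>y\<close> is zero in the function field.)
\<close>

definition at_infinity_place :: "'a::field ratfun_closure \<Rightarrow> ('a ratfun_closure \<Rightarrow> int) \<Rightarrow> bool" where
  "at_infinity_place y v \<longleftrightarrow> place y v \<and> (v x_fun < 0 \<or> v y < 0)"

text \<open>The Riemann-Roch space of \<open>m\<close> times the place at infinity.\<close>

definition RR_space :: "'a::field ratfun_closure \<Rightarrow> nat \<Rightarrow> 'a ratfun_closure set" where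
  "RR_space y m = {h \<in> function_field y. h \<noteq> 0 \<longrightarrow>
     (\<forall>v. place y v \<longrightarrow> (if at_infinity_place y v then - int m else 0) \<le> v h)}"

text \<open>The value of a function which is regular at an affine rational point.\<close>

definition value_at :: "'a::field ratfun_closure \<Rightarrow> 'a ratfun_closure \<Rightarrow> 'a \<times> 'a \<Rightarrow> 'a" where
  "value_at y h P = (THE c. \<exists>A B. eval_point B P \<noteq> 0 \<and> h = eval_fun A y / eval_fun B y \<and>
     c = eval_point A P / eval_point B P)"

definition AG_code :: "'a::field ratfun_closure \<Rightarrow> ('a \<times> 'a) list \<Rightarrow> nat \<Rightarrow> 'a vec set" where
  "AG_code y Ps m = (\<lambda>h. vec_of_list (map (value_at y h) Ps)) ` RR_space y m"

lemma ex_on_curve_x_fun: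
  assumes "n \<ge> 1" and "q \<ge> 2"
  shows "\<exists>y :: 'a::field ratfun_closure. on_curve n q l x_fun y"
proof -
  define p :: "'a ratfun_closure poly"
    where "p = (\<Sum>i<n. monom 1 (q ^ i)) - [:x_fun ^ l:]"
  have inj: "q ^ i = q ^ (n - 1) \<longleftrightarrow> i = n - 1" for i
    using assms by (intro power_inject_exp) auto
  have "coeff p (q ^ (n - 1)) = (\<Sum>i<n. if i = n - 1 then 1 else 0)"
    using assms by (simp add: p_def coeff_sum inj coeff_pCons split: nat.splits)
  also have "\<dots> = 1"
    using assms by simp
  finally have "q ^ (n - 1) \<le> degree p"
    by (intro le_degree) auto
  moreover have "q ^ (n - 1) > 0"
    using assms by simp
  ultimately have "degree p > 0"
    by linarith
  then obtain y where "poly p y = 0"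
    using alg_closed_imp_poly_has_root by blast
  then show ?thesis
    by (auto simp: p_def on_curve_def poly_sum poly_monom)
qed


section \<open>Linear codes\<close>

definition linear_code :: "nat \<Rightarrow> 'a::field vec set \<Rightarrow> bool" where
  "linear_code N C \<longleftrightarrow> C \<subseteq> carrier_vec N \<and> 0\<^sub>v N \<in> C \<and>
     (\<forall>u\<in>C. \<forall>w\<in>C. u + w \<in> C) \<and> (\<forall>c. \<forall>u\<in>C. c \<cdot>\<^sub>v u \<in> C)"

definition dual_code :: "nat \<Rightarrow> 'a::field vec set \<Rightarrow> 'a vec set" where
  "dual_code N C = {w \<in> carrier_vec N. \<forall>u\<in>C. u \<bullet> w = 0}"


section \<open>Stabilizer codes over an alphabet with \<open>CARD('a)\<close> symbols\<close>

text \<open>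
  The \<open>N\<close>-fold tensor power of the complex space with orthonormal basis indexed by \<open>'a\<close> has the
  orthonormal basis indexed by \<open>carrier_vec N\<close>; a state is its coordinate function.
\<close>

definition states :: "nat \<Rightarrow> ('a vec \<Rightarrow> complex) set" where
  "states N = {\<psi>. \<forall>u. u \<notin> carrier_vec N \<longrightarrow> \<psi> u = 0}"

definition cinner :: "nat \<Rightarrow> ('a vec \<Rightarrow> complex) \<Rightarrow> ('a vec \<Rightarrow> complex) \<Rightarrow> complex" where
  "cinner N \<phi> \<psi> = (\<Sum>u\<in>carrier_vec N. cnj (\<phi> u) * \<psi> u)"

lemma vector_space_complex_fun:
  "vector_space (\<lambda>(c::complex) (\<psi> :: 'b \<Rightarrow> complex) u. c * \<psi> u)"
  by unfold_locales (auto simp: fun_eq_iff algebra_simps)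

definition cdim :: "('b \<Rightarrow> complex) set \<Rightarrow> nat" where
  "cdim = vector_space.dim (\<lambda>(c::complex) \<psi> u. c * \<psi> u)"

text \<open>
  The trace to the prime field, and the additive character sending \<open>x\<close> to \<open>\<omega> ^ tr x\<close> where \<open>\<omega>\<close> is
  the standard primitive \<open>p\<close>-th root of unity and \<open>p\<close> is the characteristic.
\<close>

definition abs_trace :: "'a::{finite,field} \<Rightarrow> 'a" where
  "abs_trace x = (\<Sum>i<(THE r. CARD('a) = CHAR('a) ^ r). x ^ (CHAR('a) ^ i))"

definition omega :: "'a::{finite,field} itself \<Rightarrow> complex" where
  "omega _ = cis (2 * pi / real CHAR('a))"

definition add_char :: "'a::{finite,field} \<Rightarrow> complex" where
  "add_char x = omega TYPE('a) ^ (LEAST k. of_nat k = abs_trace x)"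

text \<open>
  \<open>pauli N c a b\<close> is the operator \<open>\<omega>\<^sup>c X(a) Z(b)\<close>, where \<open>X(a)\<close> maps the basis state \<open>|u>\<close> to
  \<open>|u + a>\<close> and \<open>Z(b)\<close> maps \<open>|u>\<close> to \<open>\<omega>\<close> to the power \<open>tr (b \<bullet> u)\<close> times \<open>|u>\<close>.  Outside
  \<open>carrier_vec N\<close> the result is set to \<open>0\<close>, so that distinct functions are distinct operators on
  \<open>states N\<close> and \<open>pauli N 0 (0\<^sub>v N) (0\<^sub>v N)\<close>, the identity on \<open>states N\<close>, is a neutral element for
  composition.
\<close>

definition pauli ::
    "nat \<Rightarrow> nat \<Rightarrow> 'a::{finite,field} vec \<Rightarrow> 'a vec \<Rightarrow> ('a vec \<Rightarrow> complex) \<Rightarrow> ('a vec \<Rightarrow> complex)" where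
  "pauli N c a b \<psi> = (\<lambda>u. if u \<in> carrier_vec N
     then omega TYPE('a) ^ c * add_char (b \<bullet> (u - a)) * \<psi> (u - a) else 0)"

definition pauli_group ::
    "nat \<Rightarrow> (('a::{finite,field} vec \<Rightarrow> complex) \<Rightarrow> ('a vec \<Rightarrow> complex)) monoid" where
  "pauli_group N = \<lparr>
     carrier = {pauli N c a b | c a b. a \<in> carrier_vec N \<and> b \<in> carrier_vec N},
     monoid.mult = (\<circ>),
     one = pauli N 0 (0\<^sub>v N) (0\<^sub>v N)\<rparr>"

definition pauli_weight :: "nat \<Rightarrow> 'a::zero vec \<Rightarrow> 'a vec \<Rightarrow> nat" where
  "pauli_weight N a b = card {i. i < N \<and> (a $ i \<noteq> 0 \<or> b $ i \<noteq> 0)}"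

definition joint_eigenspace ::
    "nat \<Rightarrow> (('a vec \<Rightarrow> complex) \<Rightarrow> ('a vec \<Rightarrow> complex)) set \<Rightarrow> ('a vec \<Rightarrow> complex) set" where
  "joint_eigenspace N S = {\<psi> \<in> states N. \<forall>E\<in>S. E \<psi> = \<psi>}"

text \<open>
  Minimum distance at least \<open>d\<close>: every error \<open>E\<close> of weight less than \<open>d\<close> is detectable, i.e.
  \<open><\<phi>|E|\<psi>> = t <\<phi>|\<psi>>\<close> on the code with \<open>t\<close> depending on \<open>E\<close> only.  On a one-dimensional code this
  holds for all \<open>E\<close>; there the usual convention is that the code must be pure to \<open>d\<close>.
  The scalar factor of \<open>E\<close> does not matter.
\<close>

definition min_distance_ge ::
    "nat \<Rightarrow> ('a::{finite,field} vec \<Rightarrow> complex) set \<Rightarrow> int \<Rightarrow> bool" where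
  "min_distance_ge N V d \<longleftrightarrow>
     (\<forall>a\<in>carrier_vec N. \<forall>b\<in>carrier_vec N. int (pauli_weight N a b) < d \<longrightarrow>
        (\<exists>t. \<forall>\<phi>\<in>V. \<forall>\<psi>\<in>V. cinner N \<phi> (pauli N 0 a b \<psi>) = t * cinner N \<phi> \<psi>)) \<and>
     (cdim V = 1 \<longrightarrow>
        (\<forall>a\<in>carrier_vec N. \<forall>b\<in>carrier_vec N.
           0 < pauli_weight N a b \<and> int (pauli_weight N a b) < d \<longrightarrow>
           (\<forall>\<phi>\<in>V. \<forall>\<psi>\<in>V. cinner N \<phi> (pauli N 0 a b \<psi>) = 0)))"

definition stabilizer_code ::
    "nat \<Rightarrow> int \<Rightarrow> int \<Rightarrow> ('a::{finite,field} vec \<Rightarrow> complex) set \<Rightarrow> bool" where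
  "stabilizer_code N K d V \<longleftrightarrow>
     (\<exists>S. subgroup S (pauli_group N) \<and> (\<forall>E\<in>S. \<forall>F\<in>S. E \<circ> F = F \<circ> E) \<and>
          V = joint_eigenspace N S) \<and>
     0 \<le> K \<and> cdim V = CARD('a) ^ nat K \<and> min_distance_ge N V d"

text \<open>
  The stabilizer code obtained from a Euclidean self-orthogonal linear code \<open>C\<close>: its stabilizer
  consists of the operators \<open>X(a) Z(b)\<close> with \<open>a, b \<in> C\<close>.
\<close>

definition obtained_from ::
    "nat \<Rightarrow> 'a::{finite,field} vec set \<Rightarrow> ('a vec \<Rightarrow> complex) set \<Rightarrow> bool" where
  "obtained_from N C V \<longleftrightarrow> linear_code N C \<and> C \<subseteq> dual_code N C \<and>
     V = joint_eigenspace N {pauli N 0 a b | a b. a \<in> C \<and> b \<in> C}"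

end

theory Submission
  imports Defs "HOL-Number_Theory.Residues" "Jordan_Normal_Form.Char_Poly"
begin

text \<open>
  Write \<open>u = q^(n-1)\<close>, so that the curve is \<open>tr(y) = x^l\<close> with the trace polynomial
  \<open>tr(Y) = Y^u + \<dots> + Y^q + Y\<close> of the ground field over its subfield of \<open>q\<close> elements.  Modulo the
  curve equation every polynomial is congruent to a unique \<^emph>\<open>reduced\<close> one, of degree less than \<open>u\<close>
  in \<open>y\<close>.  Three properties of \<open>tr\<close> carry the proof: it is additive, all its \<open>u\<close> roots lie in the
  ground field, and its derivative is \<open>1\<close>.

  \<^bold>\<open>Stabilizer codes.\<close>  Let \<open>C\<close> be a self-orthogonal code with dual \<open>D\<close>.  The states fixed by all
  \<open>X(a) Z(b)\<close> with \<open>a, b \<in> C\<close> are those supported on \<open>D\<close> and constant on the cosets of \<open>C\<close>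
  (\<open>V_iff\<close>), so the code space has dimension \<open>|D| / |C|\<close>, and \<open>|C| |D|\<close> is known from character
  orthogonality.  An error with a part outside \<open>D\<close> sends this space to an orthogonal one, so the
  distance is at least that of \<open>D\<close>.

  \<^bold>\<open>The Riemann-Roch space.\<close>  The function \<open>x^i y^j\<close> has pole order \<open>ui + lj\<close> at infinity, its
  weight.  Since \<open>u\<close> and \<open>l\<close> are coprime, the monomials with \<open>j < u\<close> have distinct weights, so the
  pole order of a reduced polynomial is its largest weight (\<open>valuation_eq_weight\<close>).  A place at
  infinity exists because the curve has a point with coordinates in Laurent series there; the same
  point shows that the coordinate ring is an integral domain.  At an affine point \<open>(a, b)\<close> over the
  algebraic closure, \<open>y\<close> is a power series in \<open>x - a\<close>, as the derivative of \<open>tr\<close> is \<open>1\<close>; this gives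
  a place.  If \<open>A / f(x)\<close> with \<open>A\<close> reduced is regular at the points over a root \<open>a\<close> of \<open>f\<close>, then
  \<open>A(a, Y)\<close> has \<open>u\<close> zeros, because the kernel of \<open>tr\<close> permutes these points.  So \<open>A(a, Y) = 0\<close>, and
  a factor can be cancelled.  Hence the functions regular on the affine curve are the polynomials,
  and the Riemann-Roch space consists of the reduced polynomials of weight at most \<open>m\<close>
  (\<open>RR_space_eq\<close>).

  \<^bold>\<open>The code.\<close>  Counting monomials gives the dimension \<open>m + 1 - g\<close> (\<open>card_monomials_le\<close>);
  evaluation is injective because a reduced polynomial that vanishes at all points has coefficients
  with \<open>e + 1\<close> zeros.  For self-orthogonality, Lagrange interpolation at the roots of \<open>tr - c\<close> shows
  that only monomials \<open>x^i y^(u-1)\<close> contribute to a sum over all rational points (\<open>sum_fiber\<close>).  The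
  numerical hypothesis restricts those that occur in products to \<open>i < e\<close>, with none at all if \<open>p\<close>
  does not divide \<open>e + 1\<close>.  The sum of \<open>a^i\<close> over the \<open>x\<close>-coordinates, which are \<open>0\<close> and the
  \<open>e\<close>-th roots of unity, is then \<open>0\<close>.  The distance of the dual code is bounded below by an order
  argument on pole numbers, without Riemann-Roch (\<open>dual_support_bound\<close>).
\<close>


section \<open>Finite fields and their additive characters\<close>

lemma prime_CHAR_finite_field: "prime CHAR('a::{finite,field})"
  by (intro prime_CHAR_semidom finite_imp_CHAR_pos) auto

lemma finite_field_power_card: "x ^ CARD('a) = (x :: 'a::{finite,field})"
proof (cases "x = 0")
  case False
  have "x ^ (CARD('a) - 1) * \<Prod>(UNIV - {0}) = (\<Prod>z\<in>UNIV - {0}. x * z)"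
    by (simp add: prod.distrib card_Diff_singleton)
  also have "\<dots> = \<Prod>(UNIV - {0})"
    by (rule prod.reindex_bij_witness[of _ "\<lambda>z. z / x" "\<lambda>z. x * z"]) (use False in auto)
  finally have "x ^ (CARD('a) - 1) = 1"
    by simp
  then have "x ^ Suc (CARD('a) - 1) = x"
    by (simp only: power_Suc mult_1_right)
  then show ?thesis
    using zero_less_card_finite[where 'a = 'a] by simp
qed simp

text \<open>
  The prime field consists of the roots of \<open>X^p - X\<close>: the \<open>p\<close> multiples of \<open>1\<close> are such roots,
  and there is no room for more.
\<close>

lemma prime_field_iff:
  "x ^ CHAR('a) = x \<longleftrightarrow> (\<exists>k. x = (of_nat k :: 'a::{finite,field}))"
proof -
  let ?p = "CHAR('a)"
  define P :: "'a poly" where "P = monom 1 ?p - [:0, 1:]"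
  have p: "prime ?p" "?p > 1"
    using prime_CHAR_finite_field[where 'a = 'a] prime_gt_1_nat by auto
  have coeffP: "coeff P ?p = 1"
    using p(2) by (auto simp: P_def coeff_pCons split: nat.splits)
  then have "P \<noteq> 0"
    by auto
  have "degree P \<le> ?p"
    unfolding P_def using p(2) by (intro degree_diff_le) (auto simp: degree_monom_le)
  then have card_le: "card {x. poly P x = 0} \<le> ?p"
    using card_poly_roots_bound[OF \<open>P \<noteq> 0\<close>] by linarith
  have pow: "(of_nat k :: 'a) ^ ?p = of_nat k" for k
  proof (induction k)
    case (Suc k)
    then show ?case
      using freshmans_dream[OF p(1) refl, of 1 "of_nat k"] by simp
  qed (use p(2) in simp)
  have inj: "inj_on (of_nat :: nat \<Rightarrow> 'a) {..<?p}"
    by (auto intro!: inj_onI simp: of_nat_eq_iff_cong_CHAR cong_def)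
  have sub: "of_nat ` {..<?p} \<subseteq> {x. poly P x = 0}"
    by (auto simp: P_def poly_monom pow)
  have "card (of_nat ` {..<?p} :: 'a set) = ?p"
    using card_image[OF inj] by simp
  then have "of_nat ` {..<?p} = {x. poly P x = 0}"
    using card_le poly_roots_finite[OF \<open>P \<noteq> 0\<close>] by (intro card_seteq[OF _ sub]) auto
  moreover have "x ^ ?p = x \<longleftrightarrow> x \<in> {x. poly P x = 0}"
    by (simp add: P_def poly_monom)
  ultimately show ?thesis
    using pow by auto
qed

lemma omega_power_eq_iff:
  "omega TYPE('a::{finite,field}) ^ i = omega TYPE('a) ^ j \<longleftrightarrow> [i = j] (mod CHAR('a))"
proof -
  let ?p = "CHAR('a)"
  have p: "?p > 0"
    using prime_CHAR_finite_field[where 'a = 'a] prime_gt_0_nat by blast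
  have pow: "omega TYPE('a) ^ k = cis (2 * pi * real k / real ?p)" for k
    by (simp add: omega_def DeMoivre mult_ac)
  have "omega TYPE('a) ^ ?p = 1"
    using p by (simp add: pow)
  then have red: "omega TYPE('a) ^ k = omega TYPE('a) ^ (k mod ?p)" for k
    by (metis mult_div_mod_eq power_add power_mult power_one mult_1)
  have "inj_on (\<lambda>k. cis (2 * pi * real k / real ?p)) {..<?p}"
    using bij_betw_roots_unity[OF p] by (rule bij_betw_imp_inj_on)
  then have "omega TYPE('a) ^ (i mod ?p) = omega TYPE('a) ^ (j mod ?p) \<longleftrightarrow> i mod ?p = j mod ?p"
    unfolding pow using p by (subst inj_on_eq_iff) auto
  then show ?thesis
    using red[of i] red[of j] by (simp add: cong_def)
qed

locale char_power_card =
  fixes r :: nat and alphabet :: "'a::{finite,field} itself"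
  assumes CARD_eq: "CARD('a) = CHAR('a) ^ r"
begin

lemma CHAR_gt_1: "CHAR('a) > 1"
  using prime_CHAR_finite_field prime_gt_1_nat by blast

lemma r_pos: "r > 0"
proof (rule ccontr)
  assume "\<not> r > 0"
  then have "CARD('a) = 1"
    by (simp add: CARD_eq)
  then show False
    using card_1_singletonE[of "UNIV :: 'a set"] by (metis UNIV_I singletonD zero_neq_one)
qed

lemma abs_trace_eq: "abs_trace (x::'a) = (\<Sum>i<r. x ^ (CHAR('a) ^ i))"
proof -
  have "(THE r. CARD('a) = CHAR('a) ^ r) = r"
    using CHAR_gt_1 CARD_eq by (intro the_equality) auto
  then show ?thesis
    by (simp add: abs_trace_def)
qed

lemma abs_trace_add: "abs_trace (x + y :: 'a) = abs_trace x + abs_trace y"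
  by (simp add: abs_trace_eq freshmans_dream'[OF prime_CHAR_finite_field refl] sum.distrib)

lemma abs_trace_of_nat: "\<exists>k. abs_trace (x::'a) = of_nat k"
proof -
  have "abs_trace x ^ CHAR('a) = (\<Sum>i<r. x ^ (CHAR('a) ^ Suc i))"
    by (simp only: abs_trace_eq freshmans_dream_sum[OF prime_CHAR_finite_field refl]
        power_Suc2 power_mult)
  also have "\<dots> = abs_trace x"
  proof -
    have xr: "x ^ (CHAR('a) ^ r) = x"
      using finite_field_power_card[of x] by (simp add: CARD_eq)
    have "(\<Sum>i<r. x ^ (CHAR('a) ^ Suc i)) + x ^ (CHAR('a) ^ 0) =
        (\<Sum>i<r. x ^ (CHAR('a) ^ i)) + x ^ (CHAR('a) ^ r)"
      using sum.lessThan_Suc[of "\<lambda>i. x ^ (CHAR('a) ^ i)" r]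
        sum.lessThan_Suc_shift[of "\<lambda>i. x ^ (CHAR('a) ^ i)" r]
      by (simp only: add.commute)
    then have "(\<Sum>i<r. x ^ (CHAR('a) ^ Suc i)) + x = (\<Sum>i<r. x ^ (CHAR('a) ^ i)) + x"
      by (simp only: xr power_0 power_one_right)
    then show ?thesis
      by (simp only: add_right_cancel abs_trace_eq)
  qed
  finally show ?thesis
    by (simp add: prime_field_iff)
qed

lemma add_char_eqI:
  assumes "of_nat k = abs_trace (x::'a)"
  shows "add_char x = omega TYPE('a) ^ k"
proof -
  have "of_nat (LEAST k. of_nat k = abs_trace x) = abs_trace x"
    using assms by (rule LeastI)
  then show ?thesis
    using assms by (simp add: add_char_def omega_power_eq_iff flip: of_nat_eq_iff_cong_CHAR)
qed

lemma add_char_add: "add_char (x + y :: 'a) = add_char x * add_char y"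
proof -
  obtain i j where "abs_trace x = of_nat i" "abs_trace y = of_nat j"
    using abs_trace_of_nat by blast
  then show ?thesis
    using add_char_eqI[of i x] add_char_eqI[of j y] add_char_eqI[of "i + j" "x + y"]
    by (simp add: abs_trace_add power_add)
qed

lemma add_char_0 [simp]: "add_char (0::'a) = 1"
  using add_char_eqI[of 0 0] CHAR_gt_1 by (simp add: abs_trace_eq power_0_left)

text \<open>
  The trace is a polynomial of degree \<open>p^(r-1)\<close>, too small to vanish on the whole field.
\<close>

lemma add_char_nontrivial: "\<exists>x::'a. add_char x \<noteq> 1"
proof -
  define P :: "'a poly" where "P = (\<Sum>i<r. monom 1 (CHAR('a) ^ i))"
  have "coeff P (CHAR('a) ^ (r - 1)) = (\<Sum>i<r. if i = r - 1 then 1 else 0)"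
    using CHAR_gt_1 by (simp add: P_def coeff_sum)
  then have "coeff P (CHAR('a) ^ (r - 1)) = 1"
    using r_pos by simp
  then have "P \<noteq> 0"
    by auto
  have "degree P \<le> CHAR('a) ^ (r - 1)"
    unfolding P_def using CHAR_gt_1
    by (intro degree_sum_le order.trans[OF degree_monom_le] power_increasing) auto
  also have "\<dots> < CARD('a)"
    using CHAR_gt_1 r_pos by (simp add: CARD_eq)
  finally have "card {x. poly P x = 0} < CARD('a)"
    using card_poly_roots_bound[OF \<open>P \<noteq> 0\<close>] by linarith
  then obtain x where "poly P x \<noteq> 0"
    by (metis (mono_tags, lifting) UNIV_eq_I less_irrefl mem_Collect_eq)
  then have x: "abs_trace x \<noteq> 0"
    by (simp add: P_def abs_trace_eq poly_sum poly_monom)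
  obtain k where k: "abs_trace x = of_nat k"
    using abs_trace_of_nat by blast
  have "add_char x \<noteq> 1"
  proof
    assume "add_char x = 1"
    then have "omega TYPE('a) ^ k = omega TYPE('a) ^ 0"
      using add_char_eqI[of k x] k by simp
    then show False
      using x k of_nat_eq_iff_cong_CHAR[of k 0, where 'a = 'a] omega_power_eq_iff[of k 0, where 'a = 'a]
      by fastforce
  qed
  then show ?thesis ..
qed

end


section \<open>Stabilizer codes from self-orthogonal codes\<close>

lemma card_carrier_vec: "card (carrier_vec N :: 'a::finite vec set) = CARD('a) ^ N"
proof -
  let ?L = "{xs. set xs \<subseteq> (UNIV :: 'a set) \<and> length xs = N}"
  have "bij_betw vec_of_list ?L (carrier_vec N)"
  proof (rule bij_betwI[where g = list_of_vec])
    show "vec_of_list \<in> ?L \<rightarrow> carrier_vec N"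
      by (rule Pi_I) (simp only: mem_Collect_eq carrier_vec_def dim_vec_of_list)
    show "list_of_vec \<in> carrier_vec N \<rightarrow> ?L"
      by (rule Pi_I) (simp only: mem_Collect_eq carrier_vec_def length_list_of_vec subset_UNIV)
  qed (simp_all only: list_vec vec_list)
  then have "card (carrier_vec N :: 'a vec set) = card ?L"
    by (rule bij_betw_same_card[symmetric])
  also have "card ?L = CARD('a) ^ N"
    by (rule card_lists_length_eq) simp
  finally show ?thesis .
qed

lemma finite_carrier_vec: "finite (carrier_vec N :: 'a::finite vec set)"
  by (rule card_ge_0_finite) (simp add: card_carrier_vec)

lemma vec_cancel:
  fixes u a :: "'a::ring_1 vec"
  assumes "u \<in> carrier_vec N" "a \<in> carrier_vec N"
  shows "u + a - a = u" "u - a + a = u" "a + u - a = u" "a + (u - a) = u" "u - (u - a) = a"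
  using assms by (auto intro!: eq_vecI)

lemma linear_codeD:
  assumes "linear_code N C"
  shows "C \<subseteq> carrier_vec N" "0\<^sub>v N \<in> C" "u \<in> C \<Longrightarrow> w \<in> C \<Longrightarrow> u + w \<in> C"
    "u \<in> C \<Longrightarrow> c \<cdot>\<^sub>v u \<in> C" "u \<in> C \<Longrightarrow> - u \<in> C" "u \<in> C \<Longrightarrow> w \<in> C \<Longrightarrow> w - u \<in> C"
proof -
  have C: "C \<subseteq> carrier_vec N" "\<And>u w. u \<in> C \<Longrightarrow> w \<in> C \<Longrightarrow> u + w \<in> C" "\<And>c u. u \<in> C \<Longrightarrow> c \<cdot>\<^sub>v u \<in> C"
    using assms by (auto simp: linear_code_def)
  show "C \<subseteq> carrier_vec N" "0\<^sub>v N \<in> C" "u \<in> C \<Longrightarrow> w \<in> C \<Longrightarrow> u + w \<in> C" "u \<in> C \<Longrightarrow> c \<cdot>\<^sub>v u \<in> C"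
    using assms by (auto simp: linear_code_def)
  have neg: "- u \<in> C" if "u \<in> C" for u
  proof -
    have "(-1) \<cdot>\<^sub>v u = - u"
      by auto
    then show ?thesis
      using C(3)[OF that, of "-1"] by simp
  qed
  then show "u \<in> C \<Longrightarrow> - u \<in> C" .
  show "w - u \<in> C" if "u \<in> C" "w \<in> C"
  proof -
    have "w + - u = w - u"
      using that C(1) by (intro eq_vecI) auto
    then show ?thesis
      using C(2)[OF that(2) neg[OF that(1)]] by simp
  qed
qed

lemma linear_code_dual: 
  assumes "C \<subseteq> carrier_vec N"
  shows "linear_code N (dual_code N C)"
  using assms by (auto simp: linear_code_def dual_code_def scalar_prod_add_distrib[of _ N] subset_iff)

context char_power_card
begin

text \<open>
  As \<open>C\<close> is closed under scalar multiplication, the products \<open>u \<bullet> w\<close> take all values once they take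
  a non-zero one, hence also one where the character is not \<open>1\<close>.
\<close>

lemma not_dual_imp_add_char_neq_1:
  assumes C: "linear_code N (C :: 'a vec set)" and w: "w \<in> carrier_vec N" "w \<notin> dual_code N C"
  shows "\<exists>u\<in>C. add_char (u \<bullet> w) \<noteq> 1"
proof -
  obtain u where u: "u \<in> C" "u \<bullet> w \<noteq> 0"
    using w by (auto simp: dual_code_def)
  obtain z :: 'a where z: "add_char z \<noteq> 1"
    using add_char_nontrivial by blast
  have "((z / (u \<bullet> w)) \<cdot>\<^sub>v u) \<bullet> w = z"
    using u w linear_codeD(1)[OF C] by (subst smult_scalar_prod_distrib[of _ N]) auto
  then show ?thesis
    using z linear_codeD(4)[OF C u(1)] by metis
qed

text \<open>
  Orthogonality of characters: translating by an element of \<open>C\<close> at which the character is not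
  \<open>1\<close> multiplies the sum by that value.
\<close>

lemma sum_add_char_code:
  assumes C: "linear_code N (C :: 'a vec set)" and w: "w \<in> carrier_vec N"
  shows "(\<Sum>u\<in>C. add_char (u \<bullet> w)) = (if w \<in> dual_code N C then of_nat (card C) else 0)"
proof (cases "w \<in> dual_code N C")
  case False
  then obtain u0 where u0: "u0 \<in> C" "add_char (u0 \<bullet> w) \<noteq> 1"
    using not_dual_imp_add_char_neq_1[OF C w] by blast
  have sub: "u \<in> carrier_vec N" if "u \<in> C" for u
    using that linear_codeD(1)[OF C] by auto
  have cancel: "u0 + (u - u0) = u" "u0 + u - u0 = u" if "u \<in> carrier_vec N" for u
    using that sub[OF u0(1)] by (auto intro!: eq_vecI)
  have "(\<Sum>u\<in>C. add_char (u \<bullet> w)) = (\<Sum>u\<in>C. add_char ((u0 + u) \<bullet> w))"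
    by (rule sum.reindex_bij_witness[of _ "\<lambda>u. u0 + u" "\<lambda>u. u - u0"])
       (use u0(1) linear_codeD(3,6)[OF C] in \<open>simp_all add: cancel sub\<close>)
  also have "\<dots> = add_char (u0 \<bullet> w) * (\<Sum>u\<in>C. add_char (u \<bullet> w))"
    unfolding sum_distrib_left using u0 sub w
    by (intro sum.cong refl) (simp add: add_scalar_prod_distrib[of _ N] add_char_add)
  finally show ?thesis
    using u0(2) False by simp
qed (auto simp: dual_code_def)

text \<open>
  Both sides count the sum of \<open>add_char (u \<bullet> w)\<close> over \<open>u \<in> C\<close> and all \<open>w\<close>: summing over \<open>u\<close>
  first leaves the \<open>w\<close> in the dual code, and summing over \<open>w\<close> first leaves \<open>u = 0\<close>.
\<close>

lemma card_dual_code: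
  assumes C: "linear_code N (C :: 'a vec set)"
  shows "card C * card (dual_code N C) = CARD('a) ^ N"
proof -
  let ?U = "carrier_vec N :: 'a vec set"
  have U: "linear_code N ?U"
    by (simp add: linear_code_def)
  have fin: "finite ?U" "finite C" and sub: "C \<subseteq> ?U" "dual_code N C \<subseteq> ?U"
    using finite_carrier_vec finite_subset linear_codeD(1)[OF C] by (auto simp: dual_code_def)
  have zero: "u \<in> dual_code N ?U \<longleftrightarrow> u = 0\<^sub>v N" if "u \<in> ?U" for u
  proof
    assume "u \<in> dual_code N ?U"
    then have "unit_vec N i \<bullet> u = 0" for i
      by (simp add: dual_code_def)
    then show "u = 0\<^sub>v N"
      using that by (intro eq_vecI) (metis scalar_prod_left_unit index_zero_vec(1) carrier_vecD
          index_zero_vec(2), auto)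
  qed (auto simp: dual_code_def)
  have "of_nat (card C * card (dual_code N C)) = (\<Sum>w\<in>?U. \<Sum>u\<in>C. add_char (u \<bullet> w))"
    using fin sub by (simp add: sum_add_char_code[OF C] sum.If_cases Int_absorb1 mult_ac)
  also have "\<dots> = (\<Sum>u\<in>C. \<Sum>w\<in>?U. add_char (w \<bullet> u))"
    using sub by (subst sum.swap) (intro sum.cong refl arg_cong[of _ _ add_char] comm_scalar_prod, auto)
  also have "\<dots> = (\<Sum>u\<in>C. if u = 0\<^sub>v N then of_nat (card ?U) else 0)"
    using sub by (intro sum.cong refl) (subst sum_add_char_code[OF U], auto simp: zero subset_iff)
  also have "\<dots> = of_nat (CARD('a) ^ N)"
    using fin linear_codeD(2)[OF C] by (simp add: card_carrier_vec)
  finally show ?thesis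
    using of_nat_eq_iff by blast
qed

end

subsection \<open>The stabilizer group\<close>

context char_power_card
begin

lemma pauli_apply:
  "pauli N c a b \<psi> u = (if u \<in> carrier_vec N
     then omega TYPE('a) ^ c * add_char (b \<bullet> (u - a)) * \<psi> (u - a) else 0)"
  for a b :: "'a vec"
  by (simp add: pauli_def)

lemma pauli_in_carrier:
  fixes a b :: "'a vec"
  assumes "a \<in> carrier_vec N" "b \<in> carrier_vec N"
  shows "pauli N c a b \<in> carrier (pauli_group N)"
  using assms by (auto simp: pauli_group_def)

text \<open>
  In general composing two of these operators produces the phase \<open>add_char (b \<bullet> a')\<close>; it is
  trivial for vectors from a self-orthogonal code.
\<close>

lemma pauli_comp:
  fixes a b a' b' :: "'a vec"
  assumes car: "a \<in> carrier_vec N" "b \<in> carrier_vec N" "a' \<in> carrier_vec N" "b' \<in> carrier_vec N"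
    and orth: "b \<bullet> a' = 0"
  shows "pauli N 0 a b \<circ> pauli N 0 a' b' = pauli N 0 (a + a') (b + b')"
proof (intro ext)
  fix \<psi> :: "'a vec \<Rightarrow> complex" and u :: "'a vec"
  show "(pauli N 0 a b \<circ> pauli N 0 a' b') \<psi> u = pauli N 0 (a + a') (b + b') \<psi> u"
  proof (cases "u \<in> carrier_vec N")
    case True
    define w where "w = u - a - a'"
    have w: "w \<in> carrier_vec N" "u - a \<in> carrier_vec N" "u - a = w + a'" "u - (a + a') = w"
        "w + a' - a' = w"
      using True car by (auto simp: w_def intro!: eq_vecI)
    have "b \<bullet> (u - a) = b \<bullet> w"
      unfolding w(3) using car w(1) orth by (simp add: scalar_prod_add_distrib[of _ N])
    moreover have "(b + b') \<bullet> w = b \<bullet> w + b' \<bullet> w"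
      using car w(1) by (simp add: add_scalar_prod_distrib[of _ N])
    ultimately show ?thesis
      using True w by (simp add: pauli_apply add_char_add flip: w_def)
  qed (simp add: pauli_apply)
qed

lemma pauli_one_comp:
  assumes "E \<in> carrier (pauli_group N :: (('a vec \<Rightarrow> complex) \<Rightarrow> _) monoid)"
  shows "pauli N 0 (0\<^sub>v N) (0\<^sub>v N) \<circ> E = E" "E \<circ> pauli N 0 (0\<^sub>v N) (0\<^sub>v N) = E"
proof -
  obtain c a b where E: "E = pauli N c a b" "a \<in> carrier_vec N" "b \<in> carrier_vec N"
    using assms by (auto simp: pauli_group_def)
  have id: "pauli N 0 (0\<^sub>v N) (0\<^sub>v N) \<psi> u = (if u \<in> carrier_vec N then \<psi> u else 0)"
    for u :: "'a vec" and \<psi>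
  proof -
    have "u - 0\<^sub>v N = u" if "u \<in> carrier_vec N"
      using that by (intro eq_vecI) auto
    then show ?thesis
      by (simp add: pauli_apply)
  qed
  show "pauli N 0 (0\<^sub>v N) (0\<^sub>v N) \<circ> E = E" "E \<circ> pauli N 0 (0\<^sub>v N) (0\<^sub>v N) = E"
    using E(2) by (intro ext; simp add: id; simp add: E(1) pauli_apply id)+
qed

end

locale self_orthogonal_code = char_power_card r alphabet
  for r and alphabet :: "'a::{finite,field} itself" +
  fixes N :: nat and C :: "'a vec set"
  assumes linear: "linear_code N C" and self_orthogonal: "C \<subseteq> dual_code N C"
begin

abbreviation "D \<equiv> dual_code N C"
abbreviation "S \<equiv> {pauli N 0 a b | a b. a \<in> C \<and> b \<in> C}"
abbreviation "V \<equiv> joint_eigenspace N S"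

lemma C_carrier: "a \<in> C \<Longrightarrow> a \<in> carrier_vec N"
  using linear_codeD(1)[OF linear] by auto

lemma linear_D: "linear_code N D"
  using linear_code_dual linear_codeD(1)[OF linear] .

lemma D_carrier: "a \<in> D \<Longrightarrow> a \<in> carrier_vec N"
  by (simp add: dual_code_def)

lemma C_orth: "a \<in> C \<Longrightarrow> b \<in> C \<Longrightarrow> a \<bullet> b = 0"
  using self_orthogonal by (auto simp: dual_code_def)

lemma finite_D: "finite D"
  using D_carrier by (auto intro: finite_subset[OF _ finite_carrier_vec[of N]])

lemma S_comp:
  assumes "a \<in> C" "b \<in> C" "a' \<in> C" "b' \<in> C"
  shows "pauli N 0 a b \<circ> pauli N 0 a' b' = pauli N 0 (a + a') (b + b')"
  using assms by (intro pauli_comp C_carrier C_orth)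

lemma S_commute: "E \<in> S \<Longrightarrow> F \<in> S \<Longrightarrow> E \<circ> F = F \<circ> E"
proof -
  assume "E \<in> S" "F \<in> S"
  then obtain a b a' b' where *: "E = pauli N 0 a b" "a \<in> C" "b \<in> C"
      "F = pauli N 0 a' b'" "a' \<in> C" "b' \<in> C"
    by blast
  have "a + a' = a' + a" "b + b' = b' + b"
    using * C_carrier by (auto intro: comm_add_vec)
  then show ?thesis
    using * by (simp only: S_comp)
qed

lemma subgroup_S: "subgroup S (pauli_group N)"
proof
  show sub: "S \<subseteq> carrier (pauli_group N)"
    using C_carrier pauli_in_carrier by blast
  show one: "\<one>\<^bsub>pauli_group N\<^esub> \<in> S"
    using linear_codeD(2)[OF linear] by (auto simp: pauli_group_def)
  show "E \<otimes>\<^bsub>pauli_group N\<^esub> F \<in> S" if EF: "E \<in> S" "F \<in> S" for E F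
  proof -
    obtain a b a' b' where *: "E = pauli N 0 a b" "a \<in> C" "b \<in> C"
        "F = pauli N 0 a' b'" "a' \<in> C" "b' \<in> C"
      using EF by blast
    have "a + a' \<in> C" "b + b' \<in> C"
      using * linear_codeD(3)[OF linear] by auto
    moreover have "E \<otimes>\<^bsub>pauli_group N\<^esub> F = pauli N 0 (a + a') (b + b')"
      using S_comp[of a b a' b'] * by (simp add: pauli_group_def)
    ultimately show ?thesis
      by blast
  qed
  show "inv\<^bsub>pauli_group N\<^esub> E \<in> S" if ES: "E \<in> S" for E
  proof -
    obtain a b where E: "E = pauli N 0 a b" "a \<in> C" "b \<in> C"
      using ES by blast
    define F where "F = pauli N 0 (- a) (- b)"
    have neg: "- a \<in> C" "- b \<in> C"
      using E linear_codeD(5)[OF linear] by auto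
    then have F: "F \<in> S"
      unfolding F_def by blast
    have "a + - a = 0\<^sub>v N" "b + - b = 0\<^sub>v N" "- a + a = 0\<^sub>v N" "- b + b = 0\<^sub>v N"
      using E C_carrier by (auto intro!: eq_vecI)
    then have EF: "E \<circ> F = pauli N 0 (0\<^sub>v N) (0\<^sub>v N)" "F \<circ> E = pauli N 0 (0\<^sub>v N) (0\<^sub>v N)"
      using E neg by (simp_all add: F_def S_comp)
    \<comment> \<open>The inverse is a definite description in a monoid, so its uniqueness is part of the claim.\<close>
    have "inv\<^bsub>pauli_group N\<^esub> E = F"
      unfolding m_inv_def
    proof (rule the_equality)
      show "F \<in> carrier (pauli_group N) \<and> E \<otimes>\<^bsub>pauli_group N\<^esub> F = \<one>\<^bsub>pauli_group N\<^esub> \<and>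
          F \<otimes>\<^bsub>pauli_group N\<^esub> E = \<one>\<^bsub>pauli_group N\<^esub>"
        using EF subsetD[OF sub F] by (simp add: pauli_group_def)
      fix G
      assume "G \<in> carrier (pauli_group N) \<and> E \<otimes>\<^bsub>pauli_group N\<^esub> G = \<one>\<^bsub>pauli_group N\<^esub> \<and>
          G \<otimes>\<^bsub>pauli_group N\<^esub> E = \<one>\<^bsub>pauli_group N\<^esub>"
      then have G: "G \<in> carrier (pauli_group N)" "G \<circ> E = pauli N 0 (0\<^sub>v N) (0\<^sub>v N)"
        by (auto simp: pauli_group_def)
      have "G = G \<circ> (E \<circ> F)"
        by (simp only: EF pauli_one_comp[OF G(1)])
      also have "\<dots> = (G \<circ> E) \<circ> F"
        by (simp only: comp_assoc)
      also have "\<dots> = F"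
        using sub F by (simp only: G(2) subset_iff pauli_one_comp)
      finally show "G = F" .
    qed
    then show ?thesis
      using F by simp
  qed
qed


subsection \<open>The code space\<close>

text \<open>
  The operators \<open>Z(b)\<close> force the support of an invariant state into the dual code, and the
  operators \<open>X(a)\<close> make it constant on the cosets of \<open>C\<close>.
\<close>

lemma V_iff:
  "\<psi> \<in> V \<longleftrightarrow> \<psi> \<in> states N \<and> (\<forall>u. \<psi> u \<noteq> 0 \<longrightarrow> u \<in> D) \<and>
     (\<forall>u\<in>carrier_vec N. \<forall>a\<in>C. \<psi> (u + a) = \<psi> u)" (is "_ \<longleftrightarrow> ?R")
proof
  assume "\<psi> \<in> V"
  then have st: "\<psi> \<in> states N" and inv: "pauli N 0 a b \<psi> = \<psi>" if "a \<in> C" "b \<in> C" for a b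
    using that by (auto simp: joint_eigenspace_def)
  have zero: "0\<^sub>v N \<in> C"
    by (rule linear_codeD(2)[OF linear])
  have supp: "u \<in> D" if "\<psi> u \<noteq> 0" for u
  proof (rule ccontr)
    assume u: "u \<notin> D"
    have uc: "u \<in> carrier_vec N"
      using that st[OF zero zero] by (auto simp: states_def)
    obtain b where b: "b \<in> C" "add_char (b \<bullet> u) \<noteq> 1"
      using not_dual_imp_add_char_neq_1[OF linear uc u] by blast
    have "u - 0\<^sub>v N = u"
      using uc by (intro eq_vecI) auto
    then have "\<psi> u = add_char (b \<bullet> u) * \<psi> u"
      using fun_cong[OF inv[OF zero b(1)], of u] uc by (simp add: pauli_apply)
    then show False
      using b(2) that by simp
  qed
  have "\<psi> (u + a) = \<psi> u" if "u \<in> carrier_vec N" "a \<in> C" for u a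
  proof -
    have "u + a - a = u"
      using that C_carrier vec_cancel by blast
    then show ?thesis
      using fun_cong[OF inv[OF that(2) zero], of "u + a"] that C_carrier by (simp add: pauli_apply)
  qed
  then show ?R
    using st[OF zero zero] supp by blast
next
  assume R: ?R
  have "pauli N 0 a b \<psi> = \<psi>" if ab: "a \<in> C" "b \<in> C" for a b
  proof
    fix u
    show "pauli N 0 a b \<psi> u = \<psi> u"
    proof (cases "u \<in> carrier_vec N")
      case True
      have car: "u - a \<in> carrier_vec N" "u - a + a = u"
        using True C_carrier[OF ab(1)] vec_cancel[of u N a] by simp_all
      then have eq: "\<psi> (u - a) = \<psi> u"
        using R ab by metis
      show ?thesis
      proof (cases "\<psi> (u - a) = 0")
        case False
        then have "b \<bullet> (u - a) = 0"
          using R ab by (auto simp: dual_code_def)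
        then show ?thesis
          using True eq by (simp add: pauli_apply)
      qed (use True eq in \<open>simp add: pauli_apply\<close>)
    qed (use R in \<open>simp add: pauli_apply states_def\<close>)
  qed
  then show "\<psi> \<in> V"
    using R by (auto simp: joint_eigenspace_def)
qed

definition coset :: "'a vec \<Rightarrow> 'a vec set" where
  "coset w = (\<lambda>a. w + a) ` C"

lemma coset_sub_D: "w \<in> D \<Longrightarrow> coset w \<subseteq> D"
  using linear_codeD(3)[OF linear_D] self_orthogonal by (auto simp: coset_def)

lemma self_in_coset: "w \<in> carrier_vec N \<Longrightarrow> w \<in> coset w"
  unfolding coset_def by (rule image_eqI[of _ _ "0\<^sub>v N"]) (auto simp: linear_codeD(2)[OF linear])

lemma coset_eq:
  assumes "w \<in> carrier_vec N" "z \<in> coset w"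
  shows "coset z = coset w"
proof -
  obtain a where a: "z = w + a" "a \<in> C"
    using assms by (auto simp: coset_def)
  have "z + b = w + (a + b)" "w + b = z + (b - a)" if "b \<in> C" for b
    using assms(1) C_carrier[OF a(2)] C_carrier[OF that] unfolding a(1) by (auto intro!: eq_vecI)
  then show ?thesis
    unfolding coset_def using linear_codeD(3,6)[OF linear] a(2)
    by (intro equalityI image_subsetI) (metis imageI)+
qed

lemma card_coset: 
  assumes "w \<in> carrier_vec N"
  shows "card (coset w) = card C"
  unfolding coset_def
proof (rule card_image, rule inj_onI)
  fix a b assume ab: "a \<in> C" "b \<in> C" "w + a = w + b"
  have "a = w + a - w" "b = w + b - w"
    using vec_cancel(3) ab(1,2) assms C_carrier by metis+
  then show "a = b"
    using ab(3) by simp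
qed

lemma card_cosets: "card (coset ` D) * card C = card D"
proof -
  have "card (\<Union>(coset ` D)) = (\<Sum>K\<in>coset ` D. card K)"
  proof (rule card_Union_disjoint)
    show "pairwise disjnt (coset ` D)"
    proof (rule pairwiseI)
      fix K L assume "K \<in> coset ` D" "L \<in> coset ` D" "K \<noteq> L"
      then show "disjnt K L"
        unfolding disjnt_def using coset_eq D_carrier by (metis disjoint_iff imageE)
    qed
  qed (use finite_D coset_sub_D finite_subset in blast)
  also have "\<dots> = (\<Sum>K\<in>coset ` D. card C)"
    using card_coset D_carrier by (intro sum.cong) auto
  also have "\<Union>(coset ` D) = D"
    using coset_sub_D self_in_coset D_carrier by blast
  finally show ?thesis
    by simp
qed

lemma sum_fun_apply: "(\<Sum>b\<in>B. F b) u = (\<Sum>b\<in>B. F b u)" for F :: "'b \<Rightarrow> 'c \<Rightarrow> complex"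
  by (induction B rule: infinite_finite_induct) auto

text \<open>
  The indicator functions of the cosets of \<open>C\<close> in \<open>D\<close> form a basis of the code space.
\<close>

lemma cdim_V: "cdim V = card (coset ` D)"
proof -
  interpret vs: vector_space "\<lambda>(c::complex) (\<psi> :: 'a vec \<Rightarrow> complex) u. c * \<psi> u"
    by (rule vector_space_complex_fun)
  define ind :: "'a vec set \<Rightarrow> 'a vec \<Rightarrow> complex" where "ind K = (\<lambda>u. if u \<in> K then 1 else 0)" for K
  define B where "B = ind ` coset ` D"
  have inj: "inj ind"
  proof (rule injI)
    fix K L assume "ind K = ind L"
    then have "ind K u = ind L u" for u
      by simp
    then show "K = L"
      unfolding ind_def by (metis (mono_tags) subsetI subset_antisym zero_neq_one)
  qed
  have finB: "finite (coset ` D)" "finite B"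
    using finite_D by (auto simp: B_def)
  have ind_coset: "ind K u = (if K = coset u then 1 else 0)" if "K \<in> coset ` D" "u \<in> D" for K u
    using that coset_eq self_in_coset D_carrier by (auto simp: ind_def)
  have ind_outside: "ind K u = 0" if "K \<in> coset ` D" "u \<notin> D" for K u
    using that coset_sub_D by (auto simp: ind_def)
  have shift: "u + a \<in> K \<longleftrightarrow> u \<in> K" if "K \<in> coset ` D" "u \<in> carrier_vec N" "a \<in> C" for K u a
  proof -
    obtain w where w: "w \<in> D" "K = coset w"
      using \<open>K \<in> coset ` D\<close> by blast
    have "u + a \<in> coset u" "u + a \<in> carrier_vec N"
      using that C_carrier by (auto simp: coset_def)
    then have "coset (u + a) = coset u"
      using coset_eq that by blast
    then show ?thesis
      unfolding w(2) using coset_eq[OF D_carrier[OF w(1)]] self_in_coset that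
        \<open>u + a \<in> carrier_vec N\<close> by metis
  qed
  have subV: "B \<subseteq> V"
  proof
    fix f assume "f \<in> B"
    then obtain K where K: "K \<in> coset ` D" "f = ind K"
      by (auto simp: B_def)
    have "f u = 0" if "u \<notin> D" for u
      using ind_outside K that by blast
    moreover have "f (u + a) = f u" if "u \<in> carrier_vec N" "a \<in> C" for u a
      unfolding K(2) ind_def using shift[OF K(1) that] by simp
    ultimately show "f \<in> V"
      unfolding V_iff states_def using D_carrier by blast
  qed
  have indep: "vs.independent B"
  proof (rule vs.independent_if_scalars_zero[OF finB(2)])
    fix c :: "('a vec \<Rightarrow> complex) \<Rightarrow> complex" and f
    assume sum: "(\<Sum>x\<in>B. (\<lambda>u. c x * x u)) = 0" and "f \<in> B"
    then obtain w where w: "w \<in> D" "f = ind (coset w)"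
      by (auto simp: B_def)
    have "(\<Sum>x\<in>B. c x * x w) = 0"
      using fun_cong[OF sum, of w] by (simp add: sum_fun_apply)
    also have "(\<Sum>x\<in>B. c x * x w) = (\<Sum>K\<in>coset ` D. c (ind K) * ind K w)"
      unfolding B_def by (rule sum.reindex_cong[OF inj_on_subset[OF inj subset_UNIV] refl refl])
    also have "\<dots> = (\<Sum>K\<in>coset ` D. if K = coset w then c (ind K) else 0)"
      using w by (intro sum.cong refl) (simp add: ind_coset)
    also have "\<dots> = c f"
      using finB w by simp
    finally show "c f = 0" .
  qed
  have spanV: "V \<subseteq> vs.span B"
  proof
    fix \<psi> assume "\<psi> \<in> V"
    then have \<psi>: "\<psi> u \<noteq> 0 \<Longrightarrow> u \<in> D" "u \<in> carrier_vec N \<Longrightarrow> a \<in> C \<Longrightarrow> \<psi> (u + a) = \<psi> u" for u a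
      by (auto simp: V_iff)
    have const: "\<psi> (SOME z. z \<in> coset u) = \<psi> u" if "u \<in> D" for u
    proof -
      have "(SOME z. z \<in> coset u) \<in> coset u"
        using self_in_coset D_carrier that by (metis someI)
      then obtain a where "(SOME z. z \<in> coset u) = u + a" "a \<in> C"
        unfolding coset_def by blast
      then show ?thesis
        using \<psi>(2) D_carrier that by simp
    qed
    have "\<psi> = (\<Sum>K\<in>coset ` D. (\<lambda>u. \<psi> (SOME z. z \<in> K) * ind K u))"
    proof
      fix u
      show "\<psi> u = (\<Sum>K\<in>coset ` D. (\<lambda>u. \<psi> (SOME z. z \<in> K) * ind K u)) u"
      proof (cases "u \<in> D")
        case True
        then have "(\<Sum>K\<in>coset ` D. \<psi> (SOME z. z \<in> K) * ind K u) =
            (\<Sum>K\<in>coset ` D. if K = coset u then \<psi> (SOME z. z \<in> K) else 0)"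
          by (intro sum.cong refl) (simp add: ind_coset)
        also have "\<dots> = \<psi> u"
          using True finB by (simp add: const)
        finally show ?thesis
          by (simp add: sum_fun_apply)
      next
        case False
        have "(\<Sum>K\<in>coset ` D. \<psi> (SOME z. z \<in> K) * ind K u) = 0"
          using ind_outside False by (intro sum.neutral) simp
        moreover have "\<psi> u = 0"
          using \<psi>(1) False by blast
        ultimately show ?thesis
          by (simp add: sum_fun_apply)
      qed
    qed
    also have "\<dots> \<in> vs.span B"
      by (intro vs.span_sum vs.span_scale vs.span_base) (auto simp: B_def)
    finally show "\<psi> \<in> vs.span B" .
  qed
  have "vs.dim V = card B"
    by (rule vs.dim_unique[OF subV spanV indep refl])
  also have "\<dots> = card (coset ` D)"
    unfolding B_def by (rule card_image) (rule inj_on_subset[OF inj subset_UNIV])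
  finally show ?thesis
    by (simp add: cdim_def)
qed


subsection \<open>Error detection\<close>

text \<open>
  The code space is supported on \<open>D\<close>, which \<open>X(a)\<close> moves to a disjoint coset unless \<open>a \<in> D\<close>.  If
  \<open>a \<in> D\<close> but \<open>b \<notin> D\<close>, some \<open>c \<in> C\<close> has \<open>add_char (c \<bullet> b) \<noteq> 1\<close>, and translating the summation
  variable by \<open>c\<close> multiplies the inner product by this factor.
\<close>

lemma cinner_pauli_eq_0:
  assumes ab: "a \<in> carrier_vec N" "b \<in> carrier_vec N" "a \<notin> D \<or> b \<notin> D"
    and V: "\<phi> \<in> V" "\<psi> \<in> V"
  shows "cinner N \<phi> (pauli N 0 a b \<psi>) = 0"
proof (cases "a \<in> D")
  case False
  have "\<phi> u = 0 \<or> \<psi> (u - a) = 0" if "u \<in> carrier_vec N" for u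
  proof (rule ccontr)
    assume "\<not> ?thesis"
    then have "u \<in> D" "u - a \<in> D"
      using V by (auto simp: V_iff)
    moreover have "u - (u - a) = a"
      using that ab(1) by (intro eq_vecI) auto
    ultimately show False
      using linear_codeD(6)[OF linear_D, of "u - a" u] False by simp
  qed
  then show ?thesis
    unfolding cinner_def by (intro sum.neutral) (auto simp: pauli_apply)
next
  case True
  then have "b \<notin> D"
    using ab by blast
  then obtain c where c: "c \<in> C" "add_char (c \<bullet> b) \<noteq> 1"
    using not_dual_imp_add_char_neq_1[OF linear ab(2)] by blast
  note cc = C_carrier[OF c(1)]
  let ?f = "\<lambda>u. cnj (\<phi> u) * pauli N 0 a b \<psi> u"
  have shift: "?f (u + c) = add_char (c \<bullet> b) * ?f u" if u: "u \<in> carrier_vec N" for u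
  proof -
    have w: "u - a \<in> carrier_vec N" "u + c - a = (u - a) + c"
      using u ab(1) cc by (auto intro!: eq_vecI)
    have "\<phi> (u + c) = \<phi> u" "\<psi> (u + c - a) = \<psi> (u - a)"
      using V u w c(1) by (auto simp: V_iff)
    moreover have "b \<bullet> (u + c - a) = b \<bullet> (u - a) + c \<bullet> b"
      unfolding w(2) using w(1) ab(2) cc
      by (simp add: scalar_prod_add_distrib[of _ N] comm_scalar_prod[of b N c])
    ultimately show ?thesis
      using u cc by (simp add: pauli_apply add_char_add)
  qed
  have "cinner N \<phi> (pauli N 0 a b \<psi>) = (\<Sum>u\<in>carrier_vec N. ?f (u + c))"
    unfolding cinner_def
  proof (rule sum.reindex_bij_witness[of _ "\<lambda>u. u + c" "\<lambda>u. u - c"])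
    fix u :: "'a vec" assume "u \<in> carrier_vec N"
    then show "u - c + c = u" "u + c - c = u" "u - c \<in> carrier_vec N" "u + c \<in> carrier_vec N"
      using cc by (auto intro!: eq_vecI)
    then show "?f (u - c + c) = ?f u"
      by simp
  qed
  also have "\<dots> = add_char (c \<bullet> b) * cinner N \<phi> (pauli N 0 a b \<psi>)"
    unfolding cinner_def sum_distrib_left by (intro sum.cong refl shift)
  finally show ?thesis
    using c(2) by simp
qed

text \<open>
  If both parts of an error lie in the dual code, they vanish once the weight is below its minimum
  distance.  Every other error maps the code space to an orthogonal space, so the code is even pure.
\<close>

lemma min_distance_V:
  assumes dist: "\<And>w. w \<in> D \<Longrightarrow> w \<noteq> 0\<^sub>v N \<Longrightarrow> d \<le> int (card {i. i < N \<and> vec_index w i \<noteq> 0})"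
  shows "min_distance_ge N V d"
proof -
  have small: "w = 0\<^sub>v N" if "w \<in> D" "int (card {i. i < N \<and> vec_index w i \<noteq> 0}) < d" for w
    using dist[OF that(1)] that(2) by force
  have le: "card {i. i < N \<and> vec_index a i \<noteq> 0} \<le> pauli_weight N a b"
      "card {i. i < N \<and> vec_index b i \<noteq> 0} \<le> pauli_weight N a b" for a b :: "'a vec"
    unfolding pauli_weight_def by (intro card_mono; auto)+
  have orth: "cinner N \<phi> (pauli N 0 a b \<psi>) = 0"
    if "a \<in> carrier_vec N" "b \<in> carrier_vec N" "int (pauli_weight N a b) < d"
      "a \<noteq> 0\<^sub>v N \<or> b \<noteq> 0\<^sub>v N" "\<phi> \<in> V" "\<psi> \<in> V" for a b \<phi> \<psi>
  proof -
    have "a \<notin> D \<or> b \<notin> D"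
      using small[of a] small[of b] le(1)[of a b] le(2)[of b a] that(3,4) by linarith
    then show ?thesis
      using cinner_pauli_eq_0 that by blast
  qed
  have id: "cinner N \<phi> (pauli N 0 (0\<^sub>v N) (0\<^sub>v N) \<psi>) = 1 * cinner N \<phi> \<psi>" if "\<psi> \<in> V" for \<phi> \<psi>
  proof -
    have "0\<^sub>v N \<in> C"
      by (rule linear_codeD(2)[OF linear])
    then have "pauli N 0 (0\<^sub>v N) (0\<^sub>v N) \<psi> = \<psi>"
      using that unfolding joint_eigenspace_def by blast
    then show ?thesis
      by simp
  qed
  have "\<exists>t. \<forall>\<phi>\<in>V. \<forall>\<psi>\<in>V. cinner N \<phi> (pauli N 0 a b \<psi>) = t * cinner N \<phi> \<psi>"
    if "a \<in> carrier_vec N" "b \<in> carrier_vec N" "int (pauli_weight N a b) < d" for a b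
  proof (cases "a = 0\<^sub>v N \<and> b = 0\<^sub>v N")
    case True
    then show ?thesis
      using id by blast
  next
    case False
    then have "\<forall>\<phi>\<in>V. \<forall>\<psi>\<in>V. cinner N \<phi> (pauli N 0 a b \<psi>) = 0 * cinner N \<phi> \<psi>"
      using orth[OF that] by simp
    then show ?thesis
      by blast
  qed
  moreover have "cinner N \<phi> (pauli N 0 a b \<psi>) = 0"
    if "a \<in> carrier_vec N" "b \<in> carrier_vec N" "0 < pauli_weight N a b"
      "int (pauli_weight N a b) < d" "\<phi> \<in> V" "\<psi> \<in> V" for a b \<phi> \<psi>
  proof (rule orth[OF that(1,2,4) _ that(5,6)])
    show "a \<noteq> 0\<^sub>v N \<or> b \<noteq> 0\<^sub>v N"
    proof (rule ccontr)
      assume "\<not> ?thesis"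
      then have "{i. i < N \<and> (vec_index a i \<noteq> 0 \<or> vec_index b i \<noteq> 0)} = {}"
        by auto
      then show False
        using that(3) unfolding pauli_weight_def by (simp only: card.empty)
    qed
  qed
  ultimately show ?thesis
    unfolding min_distance_ge_def by blast
qed

theorem stabilizer_code_V:
  assumes card: "card C = CARD('a) ^ k"
    and dist: "\<And>w. w \<in> D \<Longrightarrow> w \<noteq> 0\<^sub>v N \<Longrightarrow> d \<le> int (card {i. i < N \<and> vec_index w i \<noteq> 0})"
  shows "stabilizer_code N (int N - 2 * int k) d V"
proof -
  have Q: "CARD('a) > 1"
    using one_less_power[OF CHAR_gt_1 r_pos] by (simp add: CARD_eq)
  have prod: "CARD('a) ^ k * card D = CARD('a) ^ N"
    using card_dual_code[OF linear] card by simp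
  have "card C \<le> card D"
    by (rule card_mono[OF finite_D self_orthogonal])
  then have "CARD('a) ^ k * CARD('a) ^ k \<le> CARD('a) ^ N"
    using prod card by (metis mult_le_mono2)
  then have le: "2 * k \<le> N"
    using Q by (simp add: mult_2 flip: power_add)
  have "card (coset ` D) * CARD('a) ^ (2 * k) = CARD('a) ^ k * card D"
    unfolding card_cosets[symmetric] card by (simp only: mult_2 power_add) (simp only: mult_ac)
  also have "\<dots> = CARD('a) ^ (N - 2 * k) * CARD('a) ^ (2 * k)"
    using le by (simp add: prod flip: power_add)
  finally have "cdim V = CARD('a) ^ (N - 2 * k)"
    using Q by (simp add: cdim_V)
  moreover have "nat (int N - 2 * int k) = N - 2 * k" "0 \<le> int N - 2 * int k"
    using le by auto
  moreover have "\<exists>S'. subgroup S' (pauli_group N) \<and> (\<forall>E\<in>S'. \<forall>F\<in>S'. E \<circ> F = F \<circ> E) \<and>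
      V = joint_eigenspace N S'"
    using subgroup_S S_commute by blast
  ultimately show ?thesis
    unfolding stabilizer_code_def using min_distance_V[OF dist] by simp
qed

end


section \<open>Valuations\<close>

text \<open>
  A discrete valuation on a subfield \<open>F\<close> of a larger field, not necessarily surjective onto the
  integers.  Its values at \<open>0\<close> and outside \<open>F\<close> are arbitrary.
\<close>

locale valued_field =
  fixes F :: "'f::field set" and v :: "'f \<Rightarrow> int"
  assumes one_closed: "1 \<in> F"
    and add_closed: "f \<in> F \<Longrightarrow> h \<in> F \<Longrightarrow> f + h \<in> F"
    and uminus_closed: "f \<in> F \<Longrightarrow> - f \<in> F"
    and mult_closed: "f \<in> F \<Longrightarrow> h \<in> F \<Longrightarrow> f * h \<in> F"
    and inverse_closed: "f \<in> F \<Longrightarrow> inverse f \<in> F"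
    and v_mult: "f \<in> F \<Longrightarrow> h \<in> F \<Longrightarrow> f \<noteq> 0 \<Longrightarrow> h \<noteq> 0 \<Longrightarrow> v (f * h) = v f + v h"
    and v_add: "f \<in> F \<Longrightarrow> h \<in> F \<Longrightarrow> f \<noteq> 0 \<Longrightarrow> h \<noteq> 0 \<Longrightarrow> f + h \<noteq> 0 \<Longrightarrow>
      min (v f) (v h) \<le> v (f + h)"
begin

lemma zero_closed: "0 \<in> F"
  using add_closed[OF one_closed uminus_closed[OF one_closed]] by simp

lemma power_closed: "f \<in> F \<Longrightarrow> f ^ k \<in> F"
  by (induction k) (auto intro: one_closed mult_closed)

lemma sum_closed: "(\<And>a. a \<in> A \<Longrightarrow> f a \<in> F) \<Longrightarrow> sum f A \<in> F"
  by (induction A rule: infinite_finite_induct) (auto intro: zero_closed add_closed)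

lemma v_one: "v 1 = 0"
  using v_mult[of 1 1] one_closed by simp

lemma v_uminus: 
  assumes "f \<in> F" "f \<noteq> 0"
  shows "v (- f) = v f"
proof -
  have "v (- 1) + v (- 1) = 0"
    using v_mult[of "- 1" "- 1"] uminus_closed[OF one_closed] v_one by simp
  then show ?thesis
    using v_mult[of "- 1" f] uminus_closed[OF one_closed] assms by simp
qed

lemma v_inverse: "f \<in> F \<Longrightarrow> f \<noteq> 0 \<Longrightarrow> v (inverse f) = - v f"
  using v_mult[of f "inverse f"] inverse_closed[of f] v_one by simp

lemma v_power: "f \<in> F \<Longrightarrow> f \<noteq> 0 \<Longrightarrow> v (f ^ k) = int k * v f"
  by (induction k) (auto simp: v_one v_mult power_closed algebra_simps)

lemma v_sum_gt:
  assumes "\<And>a. a \<in> A \<Longrightarrow> f a \<in> F" "\<And>a. a \<in> A \<Longrightarrow> f a \<noteq> 0 \<Longrightarrow> b < v (f a)" "sum f A \<noteq> 0"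
  shows "b < v (sum f A)"
  using assms
proof (induction A rule: infinite_finite_induct)
  case (insert a A)
  have cl: "f a \<in> F" "sum f A \<in> F"
    using insert by (auto intro: sum_closed)
  show ?case
  proof (cases "f a = 0 \<or> sum f A = 0")
    case False
    then have "min (v (f a)) (v (sum f A)) \<le> v (f a + sum f A)"
      using insert cl by (intro v_add) auto
    moreover have "b < v (f a)" "b < v (sum f A)"
      using False insert by auto
    ultimately show ?thesis
      using insert.hyps by simp
  qed (use insert in auto)
qed auto

lemma v_sum_dominant:
  assumes fin: "finite A" and a0: "a0 \<in> A" "f a0 \<noteq> 0" and F: "\<And>a. a \<in> A \<Longrightarrow> f a \<in> F"
    and gt: "\<And>a. a \<in> A \<Longrightarrow> a \<noteq> a0 \<Longrightarrow> f a \<noteq> 0 \<Longrightarrow> v (f a0) < v (f a)"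
  shows "sum f A \<noteq> 0" "v (sum f A) = v (f a0)"
proof -
  define h where "h = sum f (A - {a0})"
  have sum: "sum f A = f a0 + h"
    unfolding h_def using fin a0 by (simp add: sum.remove)
  have hF: "h \<in> F"
    unfolding h_def using F by (intro sum_closed) auto
  have "sum f A \<noteq> 0 \<and> v (sum f A) = v (f a0)"
  proof (cases "h = 0")
    case False
    have less: "v (f a0) < v h"
      using False unfolding h_def by (intro v_sum_gt) (use F gt in auto)
    have ne: "f a0 + h \<noteq> 0"
    proof
      assume "f a0 + h = 0"
      then have "h = - f a0"
        by (simp add: eq_neg_iff_add_eq_0 add.commute)
      then show False
        using less v_uminus[OF F[OF a0(1)] a0(2)] by simp
    qed
    have "min (v (f a0)) (v h) \<le> v (f a0 + h)"
      using False ne a0 F hF by (intro v_add) auto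
    moreover have "min (v (f a0 + h)) (v (- h)) \<le> v (f a0 + h + - h)"
      using False ne a0 F hF by (intro v_add) (auto intro: add_closed uminus_closed)
    ultimately show ?thesis
      using less ne v_uminus[OF hF False] by (simp add: sum)
  qed (use a0 sum in simp)
  then show "sum f A \<noteq> 0" "v (sum f A) = v (f a0)"
    by auto
qed

text \<open>
  The values form a subgroup of the integers, hence the multiples of the least positive value.
\<close>

lemma ex_normalised:
  assumes "\<exists>f\<in>F. f \<noteq> 0 \<and> v f \<noteq> 0"
  shows "\<exists>d>0. \<exists>w. (\<forall>f\<in>F. f \<noteq> 0 \<longrightarrow> v f = d * w f) \<and> (\<exists>f\<in>F. f \<noteq> 0 \<and> w f = 1)"
proof -
  define pos where "pos k \<longleftrightarrow> k > 0 \<and> (\<exists>f\<in>F. f \<noteq> 0 \<and> v f = int k)" for k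
  obtain f0 where f0: "f0 \<in> F" "f0 \<noteq> 0" "v f0 \<noteq> 0"
    using assms by blast
  have "\<exists>k. pos k"
  proof (cases "v f0 > 0")
    case True
    then show ?thesis
      using f0 by (auto simp: pos_def intro!: exI[of _ "nat (v f0)"] bexI[of _ f0])
  next
    case False
    then show ?thesis
      using f0 v_inverse[of f0] inverse_closed
      by (auto simp: pos_def intro!: exI[of _ "nat (- v f0)"] bexI[of _ "inverse f0"])
  qed
  then have d: "pos (LEAST k. pos k)"
    by (rule LeastI_ex)
  define d where "d = (LEAST k. pos k)"
  obtain t where t: "t \<in> F" "t \<noteq> 0" "v t = int d" and d_pos: "d > 0"
    using d unfolding d_def pos_def by blast
  have mult: "v f = int d * (v f div int d)" if f: "f \<in> F" "f \<noteq> 0" for f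
  proof -
    define k where "k = v f div int d"
    have ex: "\<exists>g\<in>F. g \<noteq> 0 \<and> v g = - (k * int d)"
    proof (cases "k \<ge> 0")
      case True
      have "v (inverse t ^ nat k) = - (k * int d)"
        using t True v_inverse[OF t(1,2)] inverse_closed[OF t(1)] by (subst v_power) auto
      then show ?thesis
        using t by (intro bexI[of _ "inverse t ^ nat k"]) (auto intro: power_closed inverse_closed)
    next
      case False
      have "v (t ^ nat (- k)) = - (k * int d)"
        using t False by (subst v_power) auto
      then show ?thesis
        using t by (intro bexI[of _ "t ^ nat (- k)"]) (auto intro: power_closed)
    qed
    then obtain g where g: "g \<in> F" "g \<noteq> 0" "v g = - (k * int d)"
      by blast
    have val: "v (f * g) = v f mod int d"
      using f g by (simp add: v_mult k_def minus_div_mult_eq_mod)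
    have "v f mod int d = 0"
    proof (rule ccontr)
      assume "v f mod int d \<noteq> 0"
      moreover have "0 \<le> v f mod int d" "v f mod int d < int d"
        using d_pos by auto
      ultimately have "pos (nat (v (f * g)))" "nat (v (f * g)) < d"
        unfolding pos_def val[symmetric] using f g
        by (auto intro!: bexI[of _ "f * g"] mult_closed)
      then show False
        unfolding d_def using not_less_Least by blast
    qed
    then show ?thesis
      by (metis add_0_right mult_div_mod_eq)
  qed
  show ?thesis
  proof (intro exI conjI)
    show "int d > 0"
      using d_pos by simp
    show "\<forall>f\<in>F. f \<noteq> 0 \<longrightarrow> v f = int d * (v f div int d)"
      using mult by blast
    show "\<exists>f\<in>F. f \<noteq> 0 \<and> v f div int d = 1"
      using t d_pos by (intro bexI[of _ t]) auto
  qed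
qed

end

lemma valued_field_fls: "valued_field UNIV (fls_subdegree :: 'b::field fls \<Rightarrow> int)"
  by unfold_locales (auto intro: fls_plus_subdegree)


section \<open>Evaluating bivariate polynomials\<close>

text \<open>
  The polynomials are polynomials in \<open>y\<close> with coefficients in \<open>'a[x]\<close>.  The coordinates \<open>\<xi>\<close> and \<open>\<eta>\<close>
  may lie in any ring to which \<open>c\<close> maps the constants: the ground field, the function field, or a
  ring of power or Laurent series.
\<close>

definition ev :: "('a::field \<Rightarrow> 'm) \<Rightarrow> 'm \<Rightarrow> 'm \<Rightarrow> 'a poly poly \<Rightarrow> 'm::comm_ring_1" where
  "ev c \<xi> \<eta> A = poly (map_poly (\<lambda>r. poly (map_poly c r) \<xi>) A) \<eta>"

lemma eval_fun_eq_ev: "eval_fun A y = ev const_fun x_fun y A"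
  by (simp add: eval_fun_def ev_def)

lemma eval_point_eq_ev: "eval_point A P = ev (\<lambda>a. a) (fst P) (snd P) A"
  by (simp add: eval_point_def ev_def)

lemma comm_ring_hom_ev1:
  assumes "comm_ring_hom c"
  shows "comm_ring_hom (\<lambda>r. poly (map_poly c r) \<xi>)"
proof -
  interpret c: comm_ring_hom c by fact
  interpret m: map_poly_comm_ring_hom c ..
  show ?thesis
    by unfold_locales (auto simp: hom_distribs)
qed

lemma comm_ring_hom_ev:
  assumes "comm_ring_hom c"
  shows "comm_ring_hom (ev c \<xi> \<eta>)"
  using comm_ring_hom_ev1[OF comm_ring_hom_ev1[OF assms]] unfolding ev_def .

lemma ev_const:
  assumes "comm_ring_hom c"
  shows "ev c \<xi> \<eta> [:r:] = poly (map_poly c r) \<xi>"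
proof -
  interpret h: comm_ring_hom "\<lambda>r. poly (map_poly c r) \<xi>"
    by (rule comm_ring_hom_ev1[OF assms])
  show ?thesis
    by (simp add: ev_def h.map_poly_pCons_hom)
qed

lemma ev_natural:
  assumes "comm_ring_hom c" "comm_ring_hom h"
  shows "h (ev c \<xi> \<eta> A) = ev (\<lambda>a. h (c a)) (h \<xi>) (h \<eta>) A"
proof -
  interpret c: comm_ring_hom c by fact
  interpret h: comm_ring_hom h by fact
  interpret e: comm_ring_hom "\<lambda>r. poly (map_poly c r) \<xi>"
    by (rule comm_ring_hom_ev1) fact
  have 1: "h (poly (map_poly c r) \<xi>) = poly (map_poly (\<lambda>a. h (c a)) r) (h \<xi>)" for r
    by (simp add: map_poly_map_poly o_def flip: h.poly_map_poly)
  have "h (ev c \<xi> \<eta> A) =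
      poly (map_poly h (map_poly (\<lambda>r. poly (map_poly c r) \<xi>) A)) (h \<eta>)"
    unfolding ev_def by (rule h.poly_map_poly[symmetric])
  also have "map_poly h (map_poly (\<lambda>r. poly (map_poly c r) \<xi>) A) =
      map_poly (\<lambda>r. poly (map_poly (\<lambda>a. h (c a)) r) (h \<xi>)) A"
    by (subst map_poly_map_poly) (auto simp: o_def 1)
  finally show ?thesis
    by (simp add: ev_def)
qed

text \<open>
  The pair \<open>(i, j)\<close> stands for \<open>x^i y^j\<close>; the indices appear in reverse order below because \<open>x\<close> is the
  inner variable.
\<close>

definition monomials :: "'a::zero poly poly \<Rightarrow> (nat \<times> nat) set" where
  "monomials A = {(i, j). coeff (coeff A j) i \<noteq> 0}"

lemma finite_monomials: "finite (monomials A)"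
proof (rule finite_subset)
  show "monomials A \<subseteq> (\<Union>j\<le>degree A. {..degree (coeff A j)} \<times> {j})"
  proof
    fix a assume "a \<in> monomials A"
    then obtain i j where a: "a = (i, j)" "coeff (coeff A j) i \<noteq> 0"
      by (auto simp: monomials_def)
    then have "coeff A j \<noteq> 0"
      by auto
    then show "a \<in> (\<Union>j\<le>degree A. {..degree (coeff A j)} \<times> {j})"
      using a(1) le_degree[OF a(2)] le_degree[of A j] by auto
  qed
qed auto

lemma monomials_eq_empty_iff: "monomials A = {} \<longleftrightarrow> A = 0"
  by (auto simp: monomials_def poly_eq_iff)

lemma monomials_degree: "(i, j) \<in> monomials A \<Longrightarrow> j \<le> degree A"
  by (auto simp: monomials_def) (metis coeff_0 le_degree)

lemma poly_map_poly_sum: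
  assumes "comm_ring_hom c"
  shows "poly (map_poly c f) z = (\<Sum>i | coeff f i \<noteq> 0. c (coeff f i) * z ^ i)"
proof -
  interpret c: comm_ring_hom c by fact
  have "poly (map_poly c f) z = (\<Sum>i\<le>degree f. coeff (map_poly c f) i * z ^ i)"
    by (rule poly_as_sum_of_monoms' [THEN arg_cong, of _ _ "\<lambda>f. poly f z", symmetric, THEN trans])
       (auto simp: degree_map_poly_le poly_sum poly_monom)
  also have "\<dots> = (\<Sum>i | coeff f i \<noteq> 0. c (coeff f i) * z ^ i)"
    by (rule sum.mono_neutral_cong_right) (auto intro: le_degree)
  finally show ?thesis .
qed

lemma ev_eq_sum_monomials:
  assumes "comm_ring_hom c"
  shows "ev c \<xi> \<eta> A = (\<Sum>(i, j)\<in>monomials A. c (coeff (coeff A j) i) * \<xi> ^ i * \<eta> ^ j)"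
proof -
  have fin1: "finite {j. coeff A j \<noteq> 0}"
    by (rule finite_subset[of _ "{..degree A}"]) (auto intro: le_degree)
  have fin2: "finite {i. coeff f i \<noteq> 0}" for f :: "'a poly"
    by (rule finite_subset[of _ "{..degree f}"]) (auto intro: le_degree)
  have "ev c \<xi> \<eta> A = (\<Sum>j | coeff A j \<noteq> 0. \<Sum>i | coeff (coeff A j) i \<noteq> 0.
      c (coeff (coeff A j) i) * \<xi> ^ i * \<eta> ^ j)"
    unfolding ev_def poly_map_poly_sum[OF comm_ring_hom_ev1[OF assms]]
    by (simp only: poly_map_poly_sum[OF assms] sum_distrib_right)
  also have "\<dots> = (\<Sum>(j, i)\<in>(SIGMA j:{j. coeff A j \<noteq> 0}. {i. coeff (coeff A j) i \<noteq> 0}).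
      c (coeff (coeff A j) i) * \<xi> ^ i * \<eta> ^ j)"
    by (rule sum.Sigma) (auto simp: fin1 fin2)
  also have "\<dots> = (\<Sum>(i, j)\<in>monomials A. c (coeff (coeff A j) i) * \<xi> ^ i * \<eta> ^ j)"
    by (rule sum.reindex_bij_witness[of _ "\<lambda>(i, j). (j, i)" "\<lambda>(j, i). (i, j)"])
       (auto simp: monomials_def)
  finally show ?thesis .
qed


section \<open>The curve\<close>

locale trace_curve =
  fixes p s q l n :: nat and alphabet :: "'a::{finite,field} itself"
  assumes p: "prime p" and s: "s \<ge> 1" and q: "q = p ^ s" and l: "l \<ge> 1" and n: "n \<ge> 1"
    and gcd_pl: "gcd p l = 1" and CARD_eq: "CARD('a) = q ^ n"
begin

definition u :: nat where "u = q ^ (n - 1)"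

lemma q_gt_1: "q > 1"
  unfolding q using p s by (intro one_less_power prime_gt_1_nat) auto

lemma u_pos: "u > 0"
  using q_gt_1 by (simp add: u_def)

lemma q_power_le_u: "i < n \<Longrightarrow> q ^ i \<le> u"
  using q_gt_1 by (auto simp: u_def intro!: power_increasing)

lemma q_power_less_u: "i < n \<Longrightarrow> i \<noteq> n - 1 \<Longrightarrow> q ^ i < u"
  using q_gt_1 unfolding u_def by (intro power_strict_increasing) auto

lemma coprime_u_l: "coprime u l"
proof -
  have "coprime p l"
    using gcd_pl by (simp add: coprime_iff_gcd_eq_1)
  moreover have "u = p ^ (s * (n - 1))"
    by (simp add: u_def power_mult flip: q)
  ultimately show ?thesis
    by simp
qed

lemma CHAR_eq: "CHAR('a) = p"
proof -
  have "CHAR('a) dvd p ^ (s * n)"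
    using CHAR_dvd_CARD[where 'a = 'a] by (simp add: CARD_eq q power_mult)
  moreover have "prime CHAR('a)"
    by (intro prime_CHAR_semidom finite_imp_CHAR_pos) auto
  ultimately show ?thesis
    using p by (meson prime_dvd_power primes_dvd_imp_eq)
qed

definition curve_poly :: "'a poly poly" where
  "curve_poly = (\<Sum>i<n. monom 1 (q ^ i)) - [:monom 1 l:]"

lemma ev_curve_poly:
  assumes "comm_ring_hom (c :: 'a \<Rightarrow> 'm::comm_ring_1)"
  shows "ev c \<xi> \<eta> curve_poly = 0 \<longleftrightarrow> on_curve n q l \<xi> \<eta>"
proof -
  interpret c: comm_ring_hom c by fact
  interpret e1: comm_ring_hom "\<lambda>r. poly (map_poly c r) \<xi>"
    by (rule comm_ring_hom_ev1) fact
  interpret e: comm_ring_hom "ev c \<xi> \<eta>"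
    by (rule comm_ring_hom_ev) fact
  have "ev c \<xi> \<eta> (monom 1 j) = \<eta> ^ j" for j
    by (simp add: ev_def poly_monom)
  then have "ev c \<xi> \<eta> curve_poly = (\<Sum>i<n. \<eta> ^ (q ^ i)) - \<xi> ^ l"
    by (simp add: curve_poly_def hom_distribs ev_const[OF assms] poly_monom)
  then show ?thesis
    by (simp add: on_curve_def)
qed

lemma coeff_curve_poly_u: "coeff curve_poly u = 1"
proof -
  have "coeff curve_poly u = (\<Sum>i<n. if i = n - 1 then 1 else 0)"
    using q_gt_1 u_pos by (auto simp: curve_poly_def coeff_sum u_def coeff_pCons intro!: sum.cong split: nat.splits)
  then show ?thesis
    using n by simp
qed

lemma degree_curve_poly: "degree curve_poly = u"
proof (rule antisym)
  have "degree (\<Sum>i<n. monom (1 :: 'a poly) (q ^ i)) \<le> u"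
    by (intro degree_sum_le) (auto intro: order.trans[OF degree_monom_le] q_power_le_u)
  then show "degree curve_poly \<le> u"
    unfolding curve_poly_def by (intro degree_diff_le) auto
  show "u \<le> degree curve_poly"
    by (rule le_degree) (simp add: coeff_curve_poly_u)
qed

lemma curve_poly_nonzero: "curve_poly \<noteq> 0"
  using coeff_curve_poly_u by auto

lemma ex_reduced: "\<exists>B R. A = curve_poly * B + R \<and> degree R < u"
proof -
  obtain B R where BR: "pseudo_divmod A curve_poly = (B, R)"
    by fastforce
  have "A = curve_poly * B + R"
    using pseudo_divmod(1)[OF curve_poly_nonzero BR] by (simp add: degree_curve_poly coeff_curve_poly_u)
  moreover have "degree R < u"
    using pseudo_divmod(2)[OF curve_poly_nonzero BR] u_pos by (auto simp: degree_curve_poly)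
  ultimately show ?thesis
    by blast
qed


subsection \<open>The weight\<close>

text \<open>
  The pole order at infinity.  The weight of \<open>0\<close> is unspecified.
\<close>

definition weight :: "'a poly poly \<Rightarrow> nat" where
  "weight A = Max ((\<lambda>(i, j). u * i + l * j) ` monomials A)"

text \<open>
  Modulo \<open>u\<close> the weight is \<open>lj\<close>, and \<open>l\<close> is invertible modulo \<open>u\<close>.
\<close>

lemma weight_inj:
  assumes "u * i + l * j = u * i' + l * j'" "j < u" "j' < u"
  shows "i = i'" "j = j'"
proof -
  have "[l * j = l * j'] (mod u)"
    using arg_cong[OF assms(1), of "\<lambda>k. k mod u"] by (simp add: cong_def)
  then have "[j = j'] (mod u)"
    using coprime_u_l by (simp add: cong_mult_lcancel_nat coprime_commute)
  then show "j = j'"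
    using assms by (simp add: cong_def)
  then show "i = i'"
    using assms u_pos by simp
qed

lemma weight_le_iff: "A \<noteq> 0 \<Longrightarrow> weight A \<le> k \<longleftrightarrow> (\<forall>(i, j)\<in>monomials A. u * i + l * j \<le> k)"
  unfolding weight_def using finite_monomials[of A] monomials_eq_empty_iff[of A]
  by (subst Max_le_iff) auto

lemma ex_weight: 
  assumes "A \<noteq> 0"
  shows "\<exists>(i, j)\<in>monomials A. weight A = u * i + l * j"
proof -
  have "weight A \<in> (\<lambda>(i, j). u * i + l * j) ` monomials A"
    unfolding weight_def using assms finite_monomials[of A] monomials_eq_empty_iff[of A]
    by (intro Max_in) auto
  then show ?thesis
    by auto
qed

text \<open>
  If \<open>\<eta>\<close> had no pole, the curve equation would exclude a pole of \<open>\<xi>\<close> as well.  So \<open>\<eta>\<close> has a pole, and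
  \<open>\<eta>^u\<close> dominates the trace.  This gives \<open>u v(\<eta>) = l v(\<xi>)\<close>, where \<open>u\<close> and \<open>l\<close> are coprime.
\<close>

lemma pole_orders:
  assumes vf: "valued_field F v" and F: "\<xi> \<in> F" "\<eta> \<in> F" "\<xi> \<noteq> 0" "\<eta> \<noteq> 0"
    and curve: "on_curve n q l \<xi> \<eta>" and pole: "v \<xi> < 0 \<or> v \<eta> < 0"
  shows "\<exists>t>0. v \<xi> = - (int u * t) \<and> v \<eta> = - (int l * t)"
proof -
  interpret valued_field F v by fact
  have lx: "v (\<Sum>i<n. \<eta> ^ (q ^ i)) = int l * v \<xi>"
    using curve F by (simp add: on_curve_def v_power)
  have ne: "(\<Sum>i<n. \<eta> ^ (q ^ i)) \<noteq> 0"
    using curve F by (simp add: on_curve_def)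
  have neg: "v \<eta> < 0"
  proof (rule ccontr)
    assume "\<not> v \<eta> < 0"
    then have "- 1 < v (\<Sum>i<n. \<eta> ^ (q ^ i))"
      using ne F by (intro v_sum_gt) (auto intro: power_closed simp: v_power less_le_trans[of "- 1" 0])
    then have "0 \<le> int l * v \<xi>"
      using lx by simp
    then show False
      using pole l \<open>\<not> v \<eta> < 0\<close> by (simp add: zero_le_mult_iff)
  qed
  have "v (\<Sum>i<n. \<eta> ^ (q ^ i)) = v (\<eta> ^ (q ^ (n - 1)))"
  proof (rule v_sum_dominant(2))
    fix i assume "i \<in> {..<n}" "i \<noteq> n - 1"
    then have "int (q ^ i) < int u"
      using q_power_less_u by simp
    then show "v (\<eta> ^ (q ^ (n - 1))) < v (\<eta> ^ (q ^ i))"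
      using neg F by (simp add: v_power u_def del: of_nat_power)
  qed (use F n in \<open>auto intro: power_closed\<close>)
  then have eq: "int u * v \<eta> = int l * v \<xi>"
    using lx F by (simp add: v_power u_def)
  then have "int u dvd int l * v \<xi>"
    by (metis dvd_triv_left)
  then have "int u dvd v \<xi>"
    using coprime_u_l by (simp add: coprime_dvd_mult_right_iff)
  then obtain k where k: "v \<xi> = int u * k"
    by blast
  then have "v \<eta> = int l * k"
    using eq u_pos by (simp add: mult.left_commute)
  then show ?thesis
    using k neg l by (intro exI[of _ "- k"]) (auto simp: mult_less_0_iff)
qed

text \<open>
  The monomials of a reduced polynomial have distinct weights, so the one of largest weight
  dominates at every common pole of \<open>\<xi>\<close> and \<open>\<eta>\<close>.
\<close>

lemma valuation_eq_weight:
  assumes vf: "valued_field F v" and c: "comm_ring_hom c" "range c \<subseteq> F" "\<And>a. a \<noteq> 0 \<Longrightarrow> v (c a) = 0"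
      "\<And>a. a \<noteq> 0 \<Longrightarrow> c a \<noteq> 0"
    and F: "\<xi> \<in> F" "\<eta> \<in> F" "\<xi> \<noteq> 0" "\<eta> \<noteq> 0"
    and v: "v \<xi> = - (int u * t)" "v \<eta> = - (int l * t)" "t > 0"
    and A: "A \<noteq> 0" "degree A < u"
  shows "ev c \<xi> \<eta> A \<noteq> 0" "v (ev c \<xi> \<eta> A) = - (int (weight A) * t)"
proof -
  interpret valued_field F v by fact
  obtain i0 j0 where ij0: "(i0, j0) \<in> monomials A" "weight A = u * i0 + l * j0"
    using ex_weight[OF A(1)] by blast
  let ?f = "\<lambda>(i, j). c (coeff (coeff A j) i) * \<xi> ^ i * \<eta> ^ j"
  have mem: "?f (i, j) \<in> F" for i j
    using c(2) F by (auto intro!: mult_closed power_closed)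
  have val: "v (?f (i, j)) = - (int (u * i + l * j) * t)" "?f (i, j) \<noteq> 0"
    if "(i, j) \<in> monomials A" for i j
  proof -
    have nz: "coeff (coeff A j) i \<noteq> 0"
      using that by (simp add: monomials_def)
    have "c (coeff (coeff A j) i) \<in> F" "\<xi> ^ i \<in> F" "\<eta> ^ j \<in> F"
      using c(2) F by (auto intro: power_closed)
    then show "v (?f (i, j)) = - (int (u * i + l * j) * t)" "?f (i, j) \<noteq> 0"
      using nz c(3,4) F v by (auto simp: v_mult mult_closed v_power algebra_simps)
  qed
  have gt: "v (?f (i0, j0)) < v (?f a)"
    if a: "a \<in> monomials A" "a \<noteq> (i0, j0)" "?f a \<noteq> 0" for a
  proof -
    obtain i j where ij: "a = (i, j)"
      by fastforce
    have "u * i + l * j \<le> weight A"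
      using weight_le_iff[OF A(1), of "weight A"] a ij by auto
    moreover have "u * i + l * j \<noteq> weight A"
      using weight_inj[of i j i0 j0] a ij ij0 monomials_degree[of _ _ A] A(2)
      by (metis order.strict_trans1)
    ultimately have "int (u * i + l * j) < int (weight A)"
      by linarith
    then show ?thesis
      using val(1)[OF ij0(1)] val(1)[of i j] a v(3) ij ij0(2) by simp
  qed
  have memF: "?f a \<in> F" for a
    using mem by (cases a) simp
  have "sum ?f (monomials A) \<noteq> 0" "v (sum ?f (monomials A)) = v (?f (i0, j0))"
    using v_sum_dominant[of "monomials A" "(i0, j0)" ?f, OF finite_monomials ij0(1) val(2)[OF ij0(1)] memF gt]
    by blast+
  then show "ev c \<xi> \<eta> A \<noteq> 0" "v (ev c \<xi> \<eta> A) = - (int (weight A) * t)"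
    using val(1)[OF ij0(1)] ij0(2) by (auto simp: ev_eq_sum_monomials[OF c(1)])
qed

end


context trace_curve
begin

subsection \<open>The trace on the ground field\<close>

text \<open>
  The trace to the subfield with \<open>q\<close> elements.
\<close>

definition tr :: "'a \<Rightarrow> 'a" where
  "tr b = (\<Sum>i<n. b ^ (q ^ i))"

lemma prime_CHAR: "prime CHAR('a)"
  using CHAR_eq p by simp

lemma q_power_eq_CHAR_power: "q ^ i = CHAR('a) ^ (s * i)"
  by (simp add: q CHAR_eq power_mult)

lemma tr_add: "tr (a + b) = tr a + tr b"
  unfolding tr_def freshmans_dream'[OF prime_CHAR q_power_eq_CHAR_power] sum.distrib ..

lemma power_q_n: "b ^ (q ^ n) = (b :: 'a)"
  using finite_field_power_card[of b] by (simp add: CARD_eq)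

lemma tr_power_q: "tr b ^ q = tr b"
proof -
  have "tr b ^ q = (\<Sum>i<n. (b ^ (q ^ i)) ^ q)"
    unfolding tr_def using freshmans_dream_sum'[OF prime_CHAR, of q s] q_power_eq_CHAR_power[of 1] by simp
  also have "\<dots> = (\<Sum>i<n. b ^ (q ^ Suc i))"
    by (simp only: power_Suc2 power_mult)
  finally have "tr b ^ q + b ^ (q ^ 0) = tr b + b ^ (q ^ n)"
    using sum.lessThan_Suc[of "\<lambda>i. b ^ (q ^ i)" n] sum.lessThan_Suc_shift[of "\<lambda>i. b ^ (q ^ i)" n]
    unfolding tr_def by (simp only: add.commute)
  then show ?thesis
    by (simp only: power_q_n power_0 power_one_right add_right_cancel)
qed

definition tr_poly :: "'a poly" where
  "tr_poly = (\<Sum>i<n. monom 1 (q ^ i))"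

lemma coeff_tr_poly_u: "coeff tr_poly u = 1"
proof -
  have "coeff tr_poly u = (\<Sum>i<n. if i = n - 1 then 1 else 0)"
    using q_gt_1 by (auto simp: tr_poly_def coeff_sum u_def intro!: sum.cong)
  then show ?thesis
    using n by simp
qed

lemma poly_tr_poly: "poly tr_poly b = tr b"
  by (simp add: tr_poly_def tr_def poly_sum poly_monom)

lemma degree_tr_poly_diff: "degree (tr_poly - [:c:]) = u"
proof (rule antisym)
  show "degree (tr_poly - [:c:]) \<le> u"
    unfolding tr_poly_def
    by (intro degree_diff_le degree_sum_le) (auto intro: order.trans[OF degree_monom_le] q_power_le_u)
  show "u \<le> degree (tr_poly - [:c:])"
    using u_pos by (intro le_degree) (simp add: coeff_tr_poly_u coeff_pCons split: nat.splits)
qed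

lemma lead_coeff_tr_poly_diff: "coeff (tr_poly - [:c:]) u = 1"
  using u_pos by (simp add: coeff_tr_poly_u coeff_pCons split: nat.splits)

lemma card_fixed_le: "card {c :: 'a. c ^ q = c} \<le> q"
proof -
  define P :: "'a poly" where "P = monom 1 q - [:0, 1:]"
  have "coeff P q = 1"
    using q_gt_1 by (auto simp: P_def coeff_pCons split: nat.splits)
  then have "P \<noteq> 0"
    by auto
  moreover have "degree P \<le> q"
    unfolding P_def using q_gt_1 by (intro degree_diff_le) (auto simp: degree_monom_le)
  ultimately show ?thesis
    using card_poly_roots_bound[of P] by (simp add: P_def poly_monom)
qed

lemma card_fiber_le: "card {b. tr b = c} \<le> u"
proof -
  have "tr_poly - [:c:] \<noteq> 0"
    using lead_coeff_tr_poly_diff[of c] by auto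
  then have "card {b. poly (tr_poly - [:c:]) b = 0} \<le> u"
    using card_poly_roots_bound[of "tr_poly - [:c:]"] by (simp add: degree_tr_poly_diff)
  then show ?thesis
    by (simp add: poly_tr_poly)
qed

text \<open>
  The trace maps the \<open>q^n\<close> elements of the ground field to the at most \<open>q\<close> fixed points of
  \<open>c \<mapsto> c^q\<close>, with at most \<open>q^(n-1)\<close> elements in each fibre.  So both bounds are attained.
\<close>

lemma card_fiber:
  assumes "c ^ q = c"
  shows "card {b. tr b = c} = u"
proof -
  have "{c :: 'a. c ^ q = c} \<noteq> {}"
    using q_gt_1 by (auto intro!: exI[of _ 0])
  have qn: "q ^ n = q * u"
    using n by (simp add: u_def power_eq_if)
  have "CARD('a) = card (\<Union>c\<in>{c. c ^ q = c}. {b. tr b = c})"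
    using tr_power_q by (intro arg_cong[of _ _ card]) auto
  also have "\<dots> = (\<Sum>c | c ^ q = c. card {b. tr b = c})"
    by (rule card_UN_disjoint) auto
  finally have sum: "(\<Sum>c | c ^ q = c. card {b. tr b = c}) = q * u"
    using CARD_eq qn by simp
  show ?thesis
  proof (rule ccontr)
    assume "\<not> ?thesis"
    then have "card {b. tr b = c} < u"
      using card_fiber_le[of c] by simp
    then have "(\<Sum>c | c ^ q = c. card {b. tr b = c}) < (\<Sum>c :: 'a | c ^ q = c. u)"
      using assms card_fiber_le by (intro sum_strict_mono_ex1) auto
    also have "\<dots> \<le> q * u"
      using card_fixed_le by simp
    finally show False
      using sum by simp
  qed
qed

lemma card_kernel: "card {b. tr b = 0} = u"
  using card_fiber[of 0] q_gt_1 by simp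

end


section \<open>Points with coordinates in power series\<close>

text \<open>
  Substitute \<open>b\<close> into the compositional inverse of \<open>a\<close>.
\<close>

lemma fps_ex_solution:
  fixes a b :: "'b::field fps"
  assumes "fps_nth a 0 = 0" "fps_nth a 1 \<noteq> 0" "fps_nth b 0 = 0"
  shows "\<exists>z. fps_nth z 0 = 0 \<and> a oo z = b"
proof (intro exI conjI)
  have inv0: "fps_nth (fps_inv a) 0 = 0"
    by (simp add: fps_inv_def)
  show "fps_nth (fps_inv a oo b) 0 = 0"
    using inv0 by simp
  have "a oo (fps_inv a oo b) = (a oo fps_inv a) oo b"
    using assms inv0 by (simp add: fps_compose_assoc)
  also have "\<dots> = b"
    using assms by (simp add: fps_inv_right)
  finally show "a oo (fps_inv a oo b) = b" .
qed

text \<open>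
  The series \<open>(1 + X)^l - 1\<close> has linear coefficient \<open>l\<close>, which is invertible.
\<close>

lemma fps_ex_root:
  fixes b :: "'b::field fps"
  assumes "of_nat l \<noteq> (0 :: 'b)" "fps_nth b 0 = 1"
  shows "\<exists>w. fps_nth w 0 = 1 \<and> w ^ l = b"
proof -
  have "l > 0"
    using assms(1) by (cases l) auto
  let ?a = "(1 + fps_X) ^ l - 1 :: 'b fps"
  have "fps_nth ?a 0 = 0"
    by (simp add: fps_power_zeroth)
  moreover have "fps_nth ?a 1 = fps_nth (fps_deriv ?a) 0"
    by simp
  then have "fps_nth ?a 1 \<noteq> 0"
    using assms(1) by (simp add: fps_deriv_power fps_power_zeroth)
  ultimately obtain z where z: "fps_nth z 0 = 0" "?a oo z = b - 1"
    using fps_ex_solution[of ?a "b - 1"] assms(2) by auto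
  have "?a oo z = (1 + z) ^ l - 1"
    using z(1)
    by (simp add: fps_compose_sub_distrib fps_compose_add_distrib flip: fps_compose_power)
  then show ?thesis
    using z by (intro exI[of _ "1 + z"]) auto
qed

lemma comm_ring_hom_fls_const: "comm_ring_hom (fls_const :: 'b::comm_ring_1 \<Rightarrow> 'b fls)"
  by unfold_locales (auto simp: fls_plus_const)

lemma comm_ring_hom_fps_to_fls: "comm_ring_hom (fps_to_fls :: 'b::comm_ring_1 fps \<Rightarrow> 'b fls)"
  by unfold_locales (auto simp: fls_times_fps_to_fls)

context trace_curve
begin

text \<open>
  Around infinity take \<open>y = t^(-l)\<close>.  Then \<open>x\<close> must be an \<open>l\<close>-th root of \<open>t^(-lu)\<close> times a power
  series with constant coefficient \<open>1\<close>, which exists as \<open>l\<close> is invertible.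
\<close>

lemma ex_point_at_infinity:
  "\<exists>(\<xi> :: 'a fls) \<eta>. on_curve n q l \<xi> \<eta> \<and> \<xi> \<noteq> 0 \<and> \<eta> \<noteq> 0 \<and>
     fls_subdegree \<xi> = - int u \<and> fls_subdegree \<eta> = - int l"
proof -
  define b :: "'a fps" where "b = (\<Sum>i<n. fps_X ^ (l * (u - q ^ i)))"
  have "fps_nth b 0 = (\<Sum>i<n. if i = n - 1 then 1 else 0)"
    unfolding b_def fps_sum_nth
  proof (rule sum.cong[OF refl])
    fix i assume "i \<in> {..<n}"
    then show "fps_nth (fps_X ^ (l * (u - q ^ i)) :: 'a fps) 0 = (if i = n - 1 then 1 else 0)"
      using q_power_less_u[of i] l by (cases "i = n - 1") (simp_all add: u_def)
  qed
  then have b0: "fps_nth b 0 = 1"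
    using n by simp
  have "of_nat l \<noteq> (0 :: 'a)"
    using gcd_pl p by (auto simp: of_nat_eq_0_iff_char_dvd CHAR_eq gcd_nat.absorb1)
  then obtain w where w: "fps_nth w 0 = 1" "w ^ l = b"
    using fps_ex_root[OF _ b0] by blast
  define \<eta> :: "'a fls" where "\<eta> = fls_X_inv ^ l"
  define \<xi> :: "'a fls" where "\<xi> = fls_X_inv ^ u * fps_to_fls w"
  have w_nz: "w \<noteq> 0"
    using w(1) by auto
  have w_deg: "fls_subdegree (fps_to_fls w) = 0"
    using w(1) by (simp add: fls_subdegree_fls_to_fps)
  have canc: "fls_X_inv ^ (j + k) * fls_X ^ k = (fls_X_inv ^ j :: 'a fls)" for j k
    by (simp add: power_add mult.assoc flip: power_mult_distrib fls_inverse_X)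
  interpret h: comm_ring_hom "fps_to_fls :: 'a fps \<Rightarrow> 'a fls"
    by (rule comm_ring_hom_fps_to_fls)
  have "\<xi> ^ l = fls_X_inv ^ (u * l) * fps_to_fls b"
    by (simp only: \<xi>_def power_mult_distrib power_mult flip: w(2) fps_to_fls_power)
  also have "fps_to_fls b = (\<Sum>i<n. fls_X ^ (l * (u - q ^ i)))"
    by (simp add: b_def h.hom_sum fps_to_fls_power)
  also have "fls_X_inv ^ (u * l) * \<dots> = (\<Sum>i<n. \<eta> ^ (q ^ i))"
    unfolding sum_distrib_left
  proof (rule sum.cong[OF refl])
    fix i assume "i \<in> {..<n}"
    then have "u * l = l * q ^ i + l * (u - q ^ i)"
      using q_power_le_u[of i] by (simp add: algebra_simps diff_mult_distrib2)
    then show "fls_X_inv ^ (u * l) * fls_X ^ (l * (u - q ^ i)) = \<eta> ^ (q ^ i)"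
      by (simp only: canc \<eta>_def flip: power_mult)
  qed
  finally have "on_curve n q l \<xi> \<eta>"
    by (simp add: on_curve_def)
  moreover have "\<xi> \<noteq> 0" "\<eta> \<noteq> 0"
    using w_nz by (auto simp: \<xi>_def \<eta>_def)
  moreover have "fls_subdegree \<xi> = - int u" "fls_subdegree \<eta> = - int l"
    using w_nz w_deg by (auto simp: \<xi>_def \<eta>_def)
  ultimately show ?thesis
    by blast
qed

lemma ex_infinity:
  "\<exists>\<xi> \<eta>. (\<forall>A. A \<noteq> 0 \<longrightarrow> degree A < u \<longrightarrow> ev fls_const \<xi> \<eta> A \<noteq> 0 \<and>
     fls_subdegree (ev fls_const \<xi> \<eta> A) = - int (weight A)) \<and>
     on_curve n q l \<xi> \<eta> \<and> fls_subdegree \<xi> = - int u \<and> fls_subdegree \<eta> = - int l"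
proof -
  obtain \<xi> \<eta> :: "'a fls" where pt: "on_curve n q l \<xi> \<eta>" "\<xi> \<noteq> 0" "\<eta> \<noteq> 0"
      "fls_subdegree \<xi> = - int u" "fls_subdegree \<eta> = - int l"
    using ex_point_at_infinity by blast
  have "ev fls_const \<xi> \<eta> A \<noteq> 0" "fls_subdegree (ev fls_const \<xi> \<eta> A) = - int (weight A)"
    if "A \<noteq> 0" "degree A < u" for A
    using valuation_eq_weight[OF valued_field_fls comm_ring_hom_fls_const, of \<xi> \<eta> 1 A] pt that by auto
  then show ?thesis
    using pt by blast
qed

lemma ev_curve_poly_multiple:
  assumes "comm_ring_hom (c :: 'a \<Rightarrow> 'm::comm_ring_1)" "on_curve n q l \<xi> \<eta>" "curve_poly dvd A"
  shows "ev c \<xi> \<eta> A = 0"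
proof -
  interpret e: comm_ring_hom "ev c \<xi> \<eta>"
    by (rule comm_ring_hom_ev) fact
  obtain B where "A = curve_poly * B"
    using assms(3) by blast
  then show ?thesis
    using ev_curve_poly[OF assms(1), of \<xi> \<eta>] assms(2) by (simp add: e.hom_mult)
qed

lemma ev_eq_0_iff_of_reduced:
  assumes "\<And>A. A \<noteq> 0 \<Longrightarrow> degree A < u \<Longrightarrow> ev (c :: 'a \<Rightarrow> 'm::comm_ring_1) \<xi> \<eta> A \<noteq> 0"
    and "comm_ring_hom c" "on_curve n q l \<xi> \<eta>"
  shows "ev c \<xi> \<eta> A = 0 \<longleftrightarrow> curve_poly dvd A"
proof
  interpret e: comm_ring_hom "ev c \<xi> \<eta>"
    by (rule comm_ring_hom_ev) fact
  assume zero: "ev c \<xi> \<eta> A = 0"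
  obtain B R where BR: "A = curve_poly * B + R" "degree R < u"
    using ex_reduced by blast
  have "ev c \<xi> \<eta> R = 0"
    using zero ev_curve_poly_multiple[OF assms(2,3), of "curve_poly * B"] by (simp add: BR e.hom_add)
  then have "R = 0"
    using assms(1) BR(2) by blast
  then show "curve_poly dvd A"
    using BR by simp
qed (rule ev_curve_poly_multiple[OF assms(2,3)])

text \<open>
  No non-zero reduced polynomial vanishes at the point at infinity, so evaluation there embeds the
  coordinate ring in a field.
\<close>

lemma curve_poly_dvd_mult:
  assumes "curve_poly dvd A * B"
  shows "curve_poly dvd A \<or> curve_poly dvd B"
proof -
  obtain \<xi> \<eta> :: "'a fls" where pt: "\<And>A. A \<noteq> 0 \<Longrightarrow> degree A < u \<Longrightarrow> ev fls_const \<xi> \<eta> A \<noteq> 0" "on_curve n q l \<xi> \<eta>"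
    using ex_infinity by blast
  interpret e: comm_ring_hom "ev fls_const \<xi> \<eta>"
    by (rule comm_ring_hom_ev) (rule comm_ring_hom_fls_const)
  note iff = ev_eq_0_iff_of_reduced[OF pt(1) comm_ring_hom_fls_const pt(2)]
  have "ev fls_const \<xi> \<eta> (A * B) = 0"
    using iff assms by blast
  then have "ev fls_const \<xi> \<eta> A * ev fls_const \<xi> \<eta> B = 0"
    by (simp only: e.hom_mult)
  then show ?thesis
    using iff[of A] iff[of B] by auto
qed

text \<open>
  In the coordinate ring every non-zero element divides a non-zero polynomial in \<open>x\<close>: take an
  element of least \<open>y\<close>-degree in the ideal that it generates together with the curve polynomial.
  By pseudo-division it divides a multiple of the curve polynomial by a polynomial in \<open>x\<close>, and
  primality of the curve polynomial forces its \<open>y\<close>-degree to be \<open>0\<close>.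
\<close>

lemma ex_multiple_in_x:
  assumes A: "\<not> curve_poly dvd A"
  shows "\<exists>B b. b \<noteq> 0 \<and> curve_poly dvd A * B - [:b:]"
proof -
  define I where "I = {G. \<exists>B H. G = A * B + curve_poly * H}"
  define P where "P k \<longleftrightarrow> (\<exists>G\<in>I. G \<noteq> 0 \<and> degree G = k)" for k
  obtain B0 R0 where R0: "A = curve_poly * B0 + R0" "degree R0 < u"
    using ex_reduced by blast
  have "R0 = A * 1 + curve_poly * (- B0)"
    using R0(1) by simp
  then have R0I: "R0 \<in> I"
    unfolding I_def by blast
  have "R0 \<noteq> 0"
    using A R0(1) by auto
  then have P0: "P (degree R0)"
    unfolding P_def using R0I by blast
  define k where "k = (LEAST k. P k)"
  have "P k"
    unfolding k_def using P0 by (rule LeastI)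
  then obtain G where G: "G \<in> I" "G \<noteq> 0" "degree G = k"
    unfolding P_def by blast
  have "k \<le> degree R0"
    unfolding k_def using P0 by (rule Least_le)
  then have k_less: "k < u"
    using R0(2) by simp
  obtain B H where BH: "G = A * B + curve_poly * H"
    using G(1) by (auto simp: I_def)
  obtain Q R where QR: "pseudo_divmod curve_poly G = (Q, R)"
    by fastforce
  define c where "c = coeff G (degree G) ^ (Suc (degree curve_poly) - degree G)"
  have c: "c \<noteq> 0"
    using G(2) by (simp add: c_def)
  have div: "smult c curve_poly = G * Q + R" and R: "R = 0 \<or> degree R < k"
    using pseudo_divmod[OF G(2) QR] by (simp_all add: c_def G(3))
  have "R = A * (- (B * Q)) + curve_poly * ([:c:] - H * Q)"
    using div unfolding BH by (simp add: algebra_simps)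
  then have "R \<in> I"
    unfolding I_def by blast
  then have "R = 0"
    using R not_less_Least[of "degree R" P] unfolding P_def k_def by blast
  then have div': "smult c curve_poly = G * Q"
    using div by simp
  then have "curve_poly dvd G * Q"
    by (metis dvd_refl dvd_smult)
  moreover have "\<not> curve_poly dvd G"
  proof
    assume "curve_poly dvd G"
    then have "degree curve_poly \<le> degree G"
      using G(2) by (rule dvd_imp_degree_le)
    then show False
      using k_less G(3) degree_curve_poly by simp
  qed
  ultimately obtain Q' where Q': "Q = curve_poly * Q'"
    using curve_poly_dvd_mult by blast
  then have "curve_poly * [:c:] = curve_poly * (G * Q')"
    using div' by (simp add: algebra_simps)
  then have c_eq: "[:c:] = G * Q'"
    using curve_poly_nonzero by (simp only: mult_cancel_left)  simp
  then have "Q' \<noteq> 0"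
    using c by auto
  then have "degree G + degree Q' = 0"
    using c_eq G(2) degree_mult_eq[of G Q'] by (metis degree_pCons_0)
  then obtain b where b: "G = [:b:]"
    by (metis add_eq_0_iff_both_eq_0 degree_eq_zeroE)
  have "A * B - [:b:] = curve_poly * (- H)"
    using BH b by (simp add: algebra_simps)
  then have "curve_poly dvd A * B - [:b:]"
    by simp
  then show ?thesis
    using b G(2) by auto
qed

text \<open>
  A point with transcendental \<open>x\<close>-coordinate is generic: a polynomial outside the ideal of the curve
  has a multiple in \<open>x\<close> alone, which does not vanish there.
\<close>

lemma ev_eq_0_iff:
  fixes c :: "'a \<Rightarrow> 'm::idom"
  assumes c: "comm_ring_hom c" and curve: "on_curve n q l \<xi> \<eta>"
    and transc: "\<And>r. r \<noteq> 0 \<Longrightarrow> poly (map_poly c r) \<xi> \<noteq> 0"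
  shows "ev c \<xi> \<eta> A = 0 \<longleftrightarrow> curve_poly dvd A"
proof
  interpret e: comm_ring_hom "ev c \<xi> \<eta>"
    by (rule comm_ring_hom_ev) fact
  assume zero: "ev c \<xi> \<eta> A = 0"
  show "curve_poly dvd A"
  proof (rule ccontr)
    assume "\<not> ?thesis"
    then obtain B b where b: "b \<noteq> 0" "curve_poly dvd A * B - [:b:]"
      using ex_multiple_in_x by blast
    then have "ev c \<xi> \<eta> A * ev c \<xi> \<eta> B - ev c \<xi> \<eta> [:b:] = 0"
      using ev_curve_poly_multiple[OF c curve b(2)] by (simp only: e.hom_minus e.hom_mult)
    then show False
      using zero transc[OF b(1)] by (simp add: ev_const[OF c])
  qed
qed (rule ev_curve_poly_multiple[OF c curve])

end


section \<open>The function field\<close>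

lemma comm_ring_hom_const_fun: "comm_ring_hom (const_fun :: 'a::field \<Rightarrow> 'a ratfun_closure)"
proof
  fix a b :: 'a
  have "[:a * b:] = [:a:] * [:b:]" "[:a + b:] = [:a:] + [:b:]"
    by auto
  then show "const_fun (a * b) = const_fun a * const_fun b" "const_fun (a + b) = const_fun a + const_fun b"
    unfolding const_fun_def by (simp_all only: to_fract_mult to_fract_add to_ac_mult to_ac_add)
qed (simp_all add: const_fun_def flip: one_pCons)

lemma const_fun_eq_0_iff: "const_fun c = 0 \<longleftrightarrow> c = 0"
  by (simp add: const_fun_def)

lemma inj_const_fun: "inj const_fun"
proof (rule injI)
  fix a b :: 'a assume "const_fun a = const_fun b"
  interpret c: comm_ring_hom "const_fun :: 'a \<Rightarrow> 'a ratfun_closure"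
    by (rule comm_ring_hom_const_fun)
  have "const_fun (a - b) = 0"
    using \<open>const_fun a = const_fun b\<close> by (simp add: c.hom_minus)
  then show "a = b"
    by (simp add: const_fun_eq_0_iff)
qed

text \<open>
  So \<open>x\<close> is transcendental over the constants.
\<close>

lemma poly_const_fun_x_fun: "poly (map_poly const_fun r) x_fun = to_ac (to_fract r)"
proof (induction r)
  case (pCons a r)
  interpret c: comm_ring_hom "const_fun :: 'a \<Rightarrow> 'a ratfun_closure"
    by (rule comm_ring_hom_const_fun)
  have "pCons a r = [:a:] + [:0, 1:] * r"
    by simp
  then have "to_ac (to_fract (pCons a r)) = const_fun a + x_fun * to_ac (to_fract r)"
    unfolding const_fun_def x_fun_def by (simp only: to_fract_mult to_fract_add to_ac_mult to_ac_add)
  then show ?case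
    by (simp add: c.map_poly_pCons_hom pCons.IH)
qed simp

lemma x_fun_nonzero: "x_fun \<noteq> 0"
  by (simp add: x_fun_def)

locale trace_function_field = trace_curve p s q l n alphabet
  for p s q l n and alphabet :: "'a::{finite,field} itself" +
  fixes y :: "'a ratfun_closure"
  assumes y: "on_curve n q l x_fun y"
begin

abbreviation "FF \<equiv> function_field y"
abbreviation "E A \<equiv> ev const_fun x_fun y A"

sublocale E: comm_ring_hom "\<lambda>A. ev const_fun x_fun y A"
  by (rule comm_ring_hom_ev) (rule comm_ring_hom_const_fun)

lemma E_x_eq_0_iff: "E [:b:] = 0 \<longleftrightarrow> b = 0"
  by (simp add: ev_const[OF comm_ring_hom_const_fun] poly_const_fun_x_fun)

lemma E_eq_0_iff: "E A = 0 \<longleftrightarrow> curve_poly dvd A"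
  by (rule ev_eq_0_iff[OF comm_ring_hom_const_fun y]) (simp add: poly_const_fun_x_fun)

lemma reduced_eq_0: "curve_poly dvd A \<Longrightarrow> degree A < u \<Longrightarrow> A = 0"
  using dvd_imp_degree_le[of curve_poly A] by (auto simp: degree_curve_poly)

lemma E_reduced_eq_0_iff: "degree A < u \<Longrightarrow> E A = 0 \<longleftrightarrow> A = 0"
  using E_eq_0_iff reduced_eq_0 by auto

lemma FF_iff: "f \<in> FF \<longleftrightarrow> (\<exists>A B. E B \<noteq> 0 \<and> f = E A / E B)"
  by (auto simp: function_field_def eval_fun_eq_ev)

lemma FF_I: "E B \<noteq> 0 \<Longrightarrow> E A / E B \<in> FF"
  by (auto simp: FF_iff)

lemma E_in_FF: "E A \<in> FF"
  using FF_I[of 1 A] by simp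

lemma E_const: "E [:[:c:]:] = const_fun c"
proof -
  interpret c: comm_ring_hom "const_fun :: 'a \<Rightarrow> 'a ratfun_closure"
    by (rule comm_ring_hom_const_fun)
  show ?thesis
    by (simp add: ev_const[OF comm_ring_hom_const_fun] c.map_poly_pCons_hom)
qed

lemma E_x: "E [:[:0, 1:]:] = x_fun"
  by (simp only: ev_const[OF comm_ring_hom_const_fun] poly_const_fun_x_fun) (simp only: x_fun_def)

lemma E_y: "E [:0, 1:] = y"
proof -
  interpret e1: comm_ring_hom "\<lambda>r. poly (map_poly const_fun r) (x_fun :: 'a ratfun_closure)"
    by (rule comm_ring_hom_ev1) (rule comm_ring_hom_const_fun)
  show ?thesis
    by (simp add: ev_def e1.map_poly_pCons_hom del: e1.hom_one) simp
qed

lemma const_fun_in_FF: "const_fun c \<in> FF" and x_in_FF: "x_fun \<in> FF" and y_in_FF: "y \<in> FF"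
  using E_in_FF[of "[:[:c:]:]"] E_in_FF[of "[:[:0, 1:]:]"] E_in_FF[of "[:0, 1:]"]
  by (simp_all only: E_const E_x E_y)

lemma y_nonzero: "y \<noteq> 0"
proof
  assume "y = 0"
  then have "x_fun ^ l = (0 :: 'a ratfun_closure)"
    using y q_gt_1 by (simp add: on_curve_def power_0_left)
  then show False
    using x_fun_nonzero[where 'a = 'a] by simp
qed

lemma FF_closed:
  "1 \<in> FF" "f \<in> FF \<Longrightarrow> h \<in> FF \<Longrightarrow> f + h \<in> FF" "f \<in> FF \<Longrightarrow> - f \<in> FF"
  "f \<in> FF \<Longrightarrow> h \<in> FF \<Longrightarrow> f * h \<in> FF" "f \<in> FF \<Longrightarrow> inverse f \<in> FF"
proof -
  show "1 \<in> FF"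
    using E_in_FF[of 1] by simp
  show "f + h \<in> FF" "f * h \<in> FF" if fh: "f \<in> FF" "h \<in> FF"
  proof -
    obtain A B A' B' where AB: "E B \<noteq> 0" "f = E A / E B" "E B' \<noteq> 0" "h = E A' / E B'"
      using fh by (auto simp: FF_iff)
    have "f + h = E (A * B' + A' * B) / E (B * B')" "f * h = E (A * A') / E (B * B')"
      unfolding AB(2,4) using AB(1,3) by (simp_all add: E.hom_add E.hom_mult add_frac_eq)
    moreover have "E (B * B') \<noteq> 0"
      using AB by (simp add: E.hom_mult)
    ultimately show "f + h \<in> FF" "f * h \<in> FF"
      by (metis FF_I)+
  qed
  show "- f \<in> FF" if f: "f \<in> FF"
  proof -
    obtain A B where AB: "E B \<noteq> 0" "f = E A / E B"
      using f by (auto simp: FF_iff)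
    then have "- f = E (- A) / E B"
      by (simp add: E.hom_uminus)
    then show ?thesis
      using AB by (metis FF_I)
  qed
  show "inverse f \<in> FF" if f: "f \<in> FF"
  proof -
    obtain A B where AB: "E B \<noteq> 0" "f = E A / E B"
      using f by (auto simp: FF_iff)
    show ?thesis
    proof (cases "E A = 0")
      case True
      then show ?thesis
        using f AB by simp
    next
      case False
      then have "inverse f = E B / E A"
        using AB by simp
      then show ?thesis
        using False by (metis FF_I)
    qed
  qed
qed

text \<open>
  Expanding by \<open>ex_multiple_in_x\<close> turns the denominator into a polynomial in \<open>x\<close>.
\<close>

lemma FF_normal_form:
  assumes "f \<in> FF"
  shows "\<exists>A b. b \<noteq> 0 \<and> degree A < u \<and> f = E A / E [:b:]"
proof -
  obtain A B where AB: "E B \<noteq> 0" "f = E A / E B"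
    using assms by (auto simp: FF_iff)
  then obtain B' b where b: "b \<noteq> 0" "curve_poly dvd B * B' - [:b:]"
    using ex_multiple_in_x E_eq_0_iff by blast
  then have "E (B * B' - [:b:]) = 0"
    using E_eq_0_iff by blast
  then have eq: "E B * E B' = E [:b:]"
    by (simp only: E.hom_minus E.hom_mult right_minus_eq)
  obtain Q R where QR: "A * B' = curve_poly * Q + R" "degree R < u"
    using ex_reduced by blast
  have "E (curve_poly * Q) = 0"
    by (simp add: E_eq_0_iff)
  then have "E A * E B' = E R"
    unfolding E.hom_mult[symmetric] QR(1) E.hom_add by simp
  moreover have "E [:b:] \<noteq> 0"
    using b by (simp add: E_x_eq_0_iff)
  ultimately have "f = E R / E [:b:]"
    using AB eq by (metis mult_divide_mult_cancel_right mult_eq_0_iff)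
  then show ?thesis
    using b QR by blast
qed

lemma valued_field_place: 
  assumes "place y v"
  shows "valued_field FF v"
  using assms FF_closed by unfold_locales (auto simp: place_def)


subsection \<open>Places from points with coordinates in Laurent series\<close>

text \<open>
  Both \<open>(x, y)\<close> and \<open>(\<xi>, \<eta>)\<close> are generic, so evaluation at \<open>(\<xi>, \<eta>)\<close> is a well-defined embedding
  \<open>\<phi>\<close> of the function field, and the order of Laurent series can be pulled back along it.
\<close>

lemma ex_valuation_at_point:
  fixes c :: "'a \<Rightarrow> 'b::field fls"
  assumes c: "comm_ring_hom c" and curve: "on_curve n q l \<xi> \<eta>"
    and transc: "\<And>r. r \<noteq> 0 \<Longrightarrow> poly (map_poly c r) \<xi> \<noteq> 0"
  shows "\<exists>v. valued_field FF v \<and> (\<forall>A. E A \<noteq> 0 \<longrightarrow> v (E A) = fls_subdegree (ev c \<xi> \<eta> A))"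
proof -
  interpret e: comm_ring_hom "ev c \<xi> \<eta>"
    by (rule comm_ring_hom_ev) fact
  have zero_iff: "ev c \<xi> \<eta> A = 0 \<longleftrightarrow> E A = 0" for A
    using ev_eq_0_iff[OF assms] E_eq_0_iff by blast
  define \<phi> where "\<phi> f = (SOME z. \<exists>A B. E B \<noteq> 0 \<and> f = E A / E B \<and> z = ev c \<xi> \<eta> A / ev c \<xi> \<eta> B)" for f
  have \<phi>: "\<phi> (E A / E B) = ev c \<xi> \<eta> A / ev c \<xi> \<eta> B" if "E B \<noteq> 0" for A B
    unfolding \<phi>_def
  proof (rule some_equality)
    show "\<exists>A' B'. E B' \<noteq> 0 \<and> E A / E B = E A' / E B' \<and>
        ev c \<xi> \<eta> A / ev c \<xi> \<eta> B = ev c \<xi> \<eta> A' / ev c \<xi> \<eta> B'"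
      using that by blast
    fix z assume "\<exists>A' B'. E B' \<noteq> 0 \<and> E A / E B = E A' / E B' \<and> z = ev c \<xi> \<eta> A' / ev c \<xi> \<eta> B'"
    then obtain A' B' where AB: "E B' \<noteq> 0" "E A / E B = E A' / E B'" "z = ev c \<xi> \<eta> A' / ev c \<xi> \<eta> B'"
      by blast
    have "E A * E B' - E A' * E B = 0"
      using AB that by (simp add: frac_eq_eq)
    then have "E (A * B' - A' * B) = 0"
      by (simp only: E.hom_minus E.hom_mult)
    then have "ev c \<xi> \<eta> (A * B' - A' * B) = 0"
      using zero_iff by blast
    then have "ev c \<xi> \<eta> A * ev c \<xi> \<eta> B' = ev c \<xi> \<eta> A' * ev c \<xi> \<eta> B"
      by (simp only: e.hom_minus e.hom_mult right_minus_eq)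
    moreover have "ev c \<xi> \<eta> B \<noteq> 0" "ev c \<xi> \<eta> B' \<noteq> 0"
      using that AB(1) zero_iff by blast+
    ultimately show "z = ev c \<xi> \<eta> A / ev c \<xi> \<eta> B"
      using AB(3) by (simp add: frac_eq_eq)
  qed
  have \<phi>_ops: "\<phi> (f + h) = \<phi> f + \<phi> h" "\<phi> (f * h) = \<phi> f * \<phi> h" if fh: "f \<in> FF" "h \<in> FF" for f h
  proof -
    obtain A B A' B' where AB: "E B \<noteq> 0" "f = E A / E B" "E B' \<noteq> 0" "h = E A' / E B'"
      using fh by (auto simp: FF_iff)
    have nz: "ev c \<xi> \<eta> B \<noteq> 0" "ev c \<xi> \<eta> B' \<noteq> 0" "E (B * B') \<noteq> 0"
      using AB zero_iff by (auto simp: E.hom_mult)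
    have "f + h = E (A * B' + A' * B) / E (B * B')" "f * h = E (A * A') / E (B * B')"
      unfolding AB(2,4) using AB(1,3) by (simp_all add: E.hom_add E.hom_mult add_frac_eq)
    then have "\<phi> (f + h) = ev c \<xi> \<eta> (A * B' + A' * B) / ev c \<xi> \<eta> (B * B')"
      "\<phi> (f * h) = ev c \<xi> \<eta> (A * A') / ev c \<xi> \<eta> (B * B')"
      using \<phi>[OF nz(3)] by (simp_all only:)
    then show "\<phi> (f + h) = \<phi> f + \<phi> h" "\<phi> (f * h) = \<phi> f * \<phi> h"
      using \<phi>[OF AB(1), of A] \<phi>[OF AB(3), of A'] nz AB(2,4)
      by (simp_all add: e.hom_add e.hom_mult add_frac_eq mult.commute)
  qed
  have \<phi>_zero: "\<phi> f = 0 \<longleftrightarrow> f = 0" if f: "f \<in> FF" for f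
  proof -
    obtain A B where AB: "E B \<noteq> 0" "f = E A / E B"
      using f by (auto simp: FF_iff)
    then show ?thesis
      using \<phi>[of B A] zero_iff[of A] zero_iff[of B] by simp
  qed
  have "valued_field FF (\<lambda>f. fls_subdegree (\<phi> f))"
  proof (unfold_locales; (rule FF_closed)?)
    fix f h assume fh: "f \<in> FF" "h \<in> FF" "f \<noteq> 0" "h \<noteq> 0"
    then have nz: "\<phi> f \<noteq> 0" "\<phi> h \<noteq> 0"
      using \<phi>_zero by auto
    then show "fls_subdegree (\<phi> (f * h)) = fls_subdegree (\<phi> f) + fls_subdegree (\<phi> h)"
      using fh by (simp add: \<phi>_ops)
    assume "f + h \<noteq> 0"
    then have "\<phi> f + \<phi> h \<noteq> 0"
      using fh \<phi>_zero[of "f + h"] FF_closed(2)[of f h] \<phi>_ops(1)[of f h] by simp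
    then show "min (fls_subdegree (\<phi> f)) (fls_subdegree (\<phi> h)) \<le> fls_subdegree (\<phi> (f + h))"
      using fh fls_plus_subdegree by (simp add: \<phi>_ops)
  qed
  moreover have "\<phi> (E A) = ev c \<xi> \<eta> A" for A
    using \<phi>[of 1 A] by simp
  ultimately show ?thesis
    by (intro exI[of _ "\<lambda>f. fls_subdegree (\<phi> f)"]) simp
qed

text \<open>
  Dividing by the least positive value makes a valuation surjective and preserves the signs of its
  values, which is all that matters for regularity.
\<close>

lemma ex_place:
  assumes vf: "valued_field FF v" and const: "\<And>c. c \<noteq> 0 \<Longrightarrow> v (const_fun c) = 0"
    and nontriv: "\<exists>f\<in>FF. f \<noteq> 0 \<and> v f \<noteq> 0"
  shows "\<exists>d>0. \<exists>w. place y w \<and> (\<forall>f\<in>FF. f \<noteq> 0 \<longrightarrow> v f = d * w f)"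
proof -
  interpret valued_field FF v by fact
  obtain d w where dw: "d > 0" "\<And>f. f \<in> FF \<Longrightarrow> f \<noteq> 0 \<Longrightarrow> v f = d * w f" "\<exists>f\<in>FF. f \<noteq> 0 \<and> w f = 1"
    using ex_normalised[OF nontriv] by blast
  have "w (f * h) = w f + w h" if "f \<in> FF" "h \<in> FF" "f \<noteq> 0" "h \<noteq> 0" for f h
  proof -
    have "d * w (f * h) = d * (w f + w h)"
      using v_mult[OF that] dw(2)[of "f * h"] dw(2)[of f] dw(2)[of h] mult_closed that
      by (simp add: distrib_left)
    then show ?thesis
      using dw(1) by simp
  qed
  moreover have "min (w f) (w h) \<le> w (f + h)"
    if "f \<in> FF" "h \<in> FF" "f \<noteq> 0" "h \<noteq> 0" "f + h \<noteq> 0" for f h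
  proof -
    have "min (d * w f) (d * w h) \<le> d * w (f + h)"
      using v_add[OF that] dw(2)[of "f + h"] dw(2)[of f] dw(2)[of h] add_closed that by simp
    then show ?thesis
      using dw(1) by (simp add: min_le_iff_disj)
  qed
  moreover have "w (const_fun c) = 0" if "c \<noteq> 0" for c
    using const[OF that] dw(1,2) const_fun_in_FF[of c] that by (simp add: const_fun_eq_0_iff)
  ultimately have "place y w"
    using dw(3) unfolding place_def by auto
  then show ?thesis
    using dw by blast
qed

text \<open>
  The values of \<open>x\<close> and \<open>y\<close> at the point at infinity are the coprime numbers \<open>-u\<close> and \<open>-l\<close>, so the
  pulled back valuation is already normalised.
\<close>

lemma ex_place_at_infinity:
  "\<exists>w. at_infinity_place y w \<and> (\<forall>A. A \<noteq> 0 \<longrightarrow> degree A < u \<longrightarrow> w (E A) = - int (weight A))"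
proof -
  obtain \<xi> \<eta> :: "'a fls" where pt: "\<And>A. A \<noteq> 0 \<Longrightarrow> degree A < u \<Longrightarrow> ev fls_const \<xi> \<eta> A \<noteq> 0 \<and>
      fls_subdegree (ev fls_const \<xi> \<eta> A) = - int (weight A)" "on_curve n q l \<xi> \<eta>"
      "fls_subdegree \<xi> = - int u" "fls_subdegree \<eta> = - int l"
    using ex_infinity by blast
  have "poly (map_poly fls_const r) \<xi> \<noteq> 0" if "r \<noteq> 0" for r :: "'a poly"
    using pt(1)[of "[:r:]"] that u_pos by (simp add: ev_const[OF comm_ring_hom_fls_const])
  then obtain v where v: "valued_field FF v"
      "\<And>A. E A \<noteq> 0 \<Longrightarrow> v (E A) = fls_subdegree (ev fls_const \<xi> \<eta> A)"
    using ex_valuation_at_point[OF comm_ring_hom_fls_const pt(2)] by blast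
  interpret e: comm_ring_hom "ev fls_const \<xi> \<eta>"
    by (rule comm_ring_hom_ev) (rule comm_ring_hom_fls_const)
  interpret ec: comm_ring_hom "fls_const :: 'a \<Rightarrow> 'a fls"
    by (rule comm_ring_hom_fls_const)
  interpret e1: comm_ring_hom "\<lambda>r. poly (map_poly fls_const r) \<xi>"
    by (rule comm_ring_hom_ev1) (rule comm_ring_hom_fls_const)
  have const: "v (const_fun c) = 0" if "c \<noteq> 0" for c
    using v(2)[of "[:[:c:]:]"] that unfolding E_const
    by (simp add: const_fun_eq_0_iff ev_const[OF comm_ring_hom_fls_const] ec.map_poly_pCons_hom)
  have vx: "v x_fun = - int u"
    using v(2)[of "[:[:0, 1:]:]"] x_fun_nonzero pt(3) unfolding E_x
    by (simp add: ev_const[OF comm_ring_hom_fls_const] ec.map_poly_pCons_hom del: ec.hom_one) 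
  have vy: "v y = - int l"
    using v(2)[of "[:0, 1:]"] y_nonzero pt(4) unfolding E_y
    by (simp add: ev_def e1.map_poly_pCons_hom del: e1.hom_one) 
  obtain d w where dw: "d > 0" "place y w" "\<And>f. f \<in> FF \<Longrightarrow> f \<noteq> 0 \<Longrightarrow> v f = d * w f"
    using ex_place[OF v(1) const] x_in_FF x_fun_nonzero vx u_pos by force
  have "d dvd int u" "d dvd int l"
    using dw(3)[OF x_in_FF x_fun_nonzero] dw(3)[OF y_in_FF y_nonzero] vx vy
    by (metis dvd_minus_iff dvd_triv_left)+
  then have "d dvd 1"
    using coprime_u_l by (metis coprime_common_divisor coprime_int_iff)
  then have "d = 1"
    using dw(1) by simp
  then have eq: "v f = w f" if "f \<in> FF" "f \<noteq> 0" for f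
    using dw(3)[OF that] by simp
  have "at_infinity_place y w"
    using dw(2) eq[OF x_in_FF x_fun_nonzero] vx u_pos by (simp add: at_infinity_place_def)
  moreover have "w (E A) = - int (weight A)" if "A \<noteq> 0" "degree A < u" for A
    using that eq[OF E_in_FF] v(2) pt(1) by (metis E_reduced_eq_0_iff)
  ultimately show ?thesis
    by blast
qed

text \<open>
  At every place at infinity the pole orders of \<open>x\<close> and \<open>y\<close> are \<open>ut\<close> and \<open>lt\<close> for some \<open>t\<close>.  By
  dominance \<open>t\<close> then divides all values, and normalisation gives \<open>t = 1\<close>.
\<close>

lemma at_infinity_place_eq_weight:
  assumes v: "at_infinity_place y v" and A: "A \<noteq> 0" "degree A < u"
  shows "v (E A) = - int (weight A)"
proof -
  have pl: "place y v" and pole: "v x_fun < 0 \<or> v y < 0"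
    using v by (auto simp: at_infinity_place_def)
  note vf = valued_field_place[OF pl]
  interpret valued_field FF v by (rule vf)
  obtain t where t: "t > 0" "v x_fun = - (int u * t)" "v y = - (int l * t)"
    using pole_orders[OF vf x_in_FF y_in_FF x_fun_nonzero y_nonzero y pole] by blast
  have val: "v (E A) = - (int (weight A) * t)" if "A \<noteq> 0" "degree A < u" for A
    using valuation_eq_weight(2)[OF vf comm_ring_hom_const_fun _ _ _ x_in_FF y_in_FF
        x_fun_nonzero y_nonzero t(2,3,1) that] pl const_fun_in_FF
    by (auto simp: place_def const_fun_eq_0_iff)
  obtain f where f: "f \<in> FF" "f \<noteq> 0" "v f = 1"
    using pl by (auto simp: place_def)
  obtain B b where B: "b \<noteq> 0" "degree B < u" "f = E B / E [:b:]"
    using FF_normal_form[OF f(1)] by blast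
  have "B \<noteq> 0" "E [:b:] \<noteq> 0" "E B \<noteq> 0"
    using f(2) B by (auto simp: E_x_eq_0_iff)
  moreover have "v f + v (E [:b:]) = v (E B)"
    using v_mult[OF f(1) E_in_FF f(2), of "[:b:]"] B(3) \<open>E [:b:] \<noteq> 0\<close> by simp
  ultimately have "1 = (int (weight [:b:]) - int (weight B)) * t"
    using val[of B] val[of "[:b:]"] B f(3) u_pos by (simp add: algebra_simps)
  then have "t dvd 1"
    by (metis dvd_triv_right)
  then have "t = 1"
    using t(1) by simp
  then show ?thesis
    using val[OF A] by simp
qed

end


subsection \<open>Places at affine points\<close>

lemma CHAR_hom_image:
  assumes "comm_ring_hom (c :: 'b::comm_ring_1 \<Rightarrow> 'm::idom)" "prime CHAR('b)"
  shows "CHAR('m) = CHAR('b)"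
proof -
  interpret c: comm_ring_hom c by fact
  have hom_nat: "c (of_nat k) = of_nat k" for k
    by (induction k) (auto simp: c.hom_add)
  have "of_nat CHAR('b) = (0 :: 'm)"
    using hom_nat[of "CHAR('b)"] by simp
  then have "CHAR('m) dvd CHAR('b)"
    by (simp add: of_nat_eq_0_iff_char_dvd)
  moreover have "CHAR('m) \<noteq> 1"
    using of_nat_CHAR[where 'a = 'm] by auto
  ultimately show ?thesis
    using assms(2) unfolding prime_nat_iff by blast
qed

lemma (in trace_curve) sum_q_powers_add:
  fixes a b :: "'m::idom"
  assumes "CHAR('m) = p"
  shows "(\<Sum>i<n. (a + b) ^ (q ^ i)) = (\<Sum>i<n. a ^ (q ^ i)) + (\<Sum>i<n. b ^ (q ^ i))"
proof -
  have "(a + b) ^ (q ^ i) = a ^ (q ^ i) + b ^ (q ^ i)" for i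
    using p by (intro freshmans_dream'[where n = "s * i"]) (auto simp: assms q power_mult)
  then show ?thesis
    by (simp add: sum.distrib)
qed

text \<open>
  These polynomials represent the Riemann-Roch space of \<open>m\<close> times the place at infinity, see
  \<open>RR_space_eq\<close> below.
\<close>

definition (in trace_curve) polys_of_weight_le :: "nat \<Rightarrow> 'a poly poly set" where
  "polys_of_weight_le m = {A. degree A < u \<and> (\<forall>(i, j)\<in>monomials A. u * i + l * j \<le> m)}"

lemma poly_fps_shift:
  fixes c :: "'a::field \<Rightarrow> 'b::field"
  assumes "comm_ring_hom c"
  shows "poly (map_poly (\<lambda>x. fps_const (c x)) r) (fps_const a + fps_X) =
    fps_of_poly (pcompose (map_poly c r) [:a, 1:])"
proof (induction r)
  case (pCons x r)
  interpret c: comm_ring_hom c by fact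
  interpret k: comm_ring_hom "\<lambda>x. fps_const (c x)"
    by unfold_locales (auto simp: hom_distribs fps_const_add[symmetric] fps_const_mult[symmetric]
        simp del: fps_const_add fps_const_mult)
  have "fps_of_poly [:a, 1:] = fps_const a + fps_X"
    by (simp add: fps_of_poly_pCons)
  then show ?case
    by (simp only: k.map_poly_pCons_hom c.map_poly_pCons_hom pcompose_pCons poly_pCons pCons.IH
        fps_of_poly_add fps_of_poly_mult fps_of_poly_const)
qed simp

context trace_function_field
begin

text \<open>
  Since the curve polynomial has derivative \<open>1\<close> in \<open>y\<close>, the function \<open>x - a\<close> is a local parameter
  at every point \<open>(a, b)\<close>, and \<open>y\<close> can be expanded in it.
\<close>

lemma ex_valuation_at_affine_point:
  fixes a b :: "'a ratfun_closure"
  assumes ab: "on_curve n q l a b"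
  shows "\<exists>v. valued_field FF v \<and>
    (\<forall>A. E A \<noteq> 0 \<longrightarrow> 0 \<le> v (E A) \<and> (0 < v (E A) \<longleftrightarrow> ev const_fun a b A = 0))"
proof -
  have char_K: "CHAR('a ratfun_closure) = p"
    using CHAR_hom_image[OF comm_ring_hom_const_fun prime_CHAR] CHAR_eq by simp
  interpret C: comm_ring_hom "const_fun :: 'a \<Rightarrow> 'a ratfun_closure"
    by (rule comm_ring_hom_const_fun)
  have fps_char: "CHAR('a ratfun_closure fps) = p"
    unfolding semiring_char_fps by (rule char_K)
  define c :: "'a \<Rightarrow> 'a ratfun_closure fps" where "c = (\<lambda>x. fps_const (const_fun x))"
  have c: "comm_ring_hom c"
    unfolding c_def
    by unfold_locales (auto simp: C.hom_add C.hom_mult fps_const_add[symmetric] fps_const_mult[symmetric]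
        simp del: fps_const_add fps_const_mult)
  define \<xi> :: "'a ratfun_closure fps" where "\<xi> = fps_const a + fps_X"
  define L :: "'a ratfun_closure fps" where "L = (\<Sum>i<n. fps_X ^ (q ^ i))"
  have "fps_nth L 0 = 0"
    using q_gt_1 by (simp add: L_def fps_sum_nth)
  moreover have "fps_nth L 1 = (\<Sum>i<n. if i = 0 then 1 else 0)"
    unfolding L_def fps_sum_nth
  proof (rule sum.cong[OF refl])
    fix i assume "i \<in> {..<n}"
    have iff: "1 = q ^ i \<longleftrightarrow> i = 0"
      using q_gt_1 by (cases i) auto
    show "fps_nth (fps_X ^ (q ^ i) :: 'a ratfun_closure fps) 1 = (if i = 0 then 1 else 0)"
      by (simp only: fps_X_power_nth iff)
  qed
  then have "fps_nth L 1 \<noteq> 0"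
    using n by simp
  moreover have "fps_nth (\<xi> ^ l - fps_const (a ^ l)) 0 = 0"
    by (simp add: \<xi>_def fps_power_zeroth)
  ultimately obtain z where z: "fps_nth z 0 = 0" "L oo z = \<xi> ^ l - fps_const (a ^ l)"
    using fps_ex_solution by blast
  have Lz: "L oo z = (\<Sum>i<n. z ^ (q ^ i))"
    using z(1) by (simp add: L_def fps_compose_sum_distrib flip: fps_compose_power)
  interpret k: comm_ring_hom "fps_const :: 'a ratfun_closure \<Rightarrow> _"
    by unfold_locales auto
  define \<eta> :: "'a ratfun_closure fps" where "\<eta> = fps_const b + z"
  have "(\<Sum>i<n. \<eta> ^ (q ^ i)) = (\<Sum>i<n. fps_const b ^ (q ^ i)) + (L oo z)"
    unfolding \<eta>_def Lz by (rule sum_q_powers_add) (rule fps_char)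
  also have "(\<Sum>i<n. fps_const b ^ (q ^ i)) = fps_const (\<Sum>i<n. b ^ (q ^ i))"
    by (simp only: k.hom_sum k.hom_power)
  also have "\<dots> = fps_const (a ^ l)"
    using ab by (simp add: on_curve_def)
  finally have curve: "(\<Sum>i<n. \<eta> ^ (q ^ i)) = \<xi> ^ l"
    using z(2) by simp
  interpret h: comm_ring_hom "fps_to_fls :: 'a ratfun_closure fps \<Rightarrow> 'a ratfun_closure fls"
    by (rule comm_ring_hom_fps_to_fls)
  define c' :: "'a \<Rightarrow> 'a ratfun_closure fls" where "c' = (\<lambda>x. fps_to_fls (c x))"
  have c': "comm_ring_hom c'"
  proof -
    interpret c: comm_ring_hom c by (rule c)
    show ?thesis
      unfolding c'_def by unfold_locales (auto simp: c.hom_add c.hom_mult h.hom_mult)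
  qed
  have curve': "on_curve n q l (fps_to_fls \<xi>) (fps_to_fls \<eta>)"
    unfolding on_curve_def using arg_cong[OF curve, of fps_to_fls]
    by (simp only: h.hom_sum fps_to_fls_power)
  have nat: "ev c' (fps_to_fls \<xi>) (fps_to_fls \<eta>) A = fps_to_fls (ev c \<xi> \<eta> A)" for A
    unfolding c'_def by (rule ev_natural[OF c comm_ring_hom_fps_to_fls, symmetric])
  have transc: "poly (map_poly c' r) (fps_to_fls \<xi>) \<noteq> 0" if "r \<noteq> 0" for r
  proof -
    have "map_poly const_fun r \<noteq> 0"
      using that by (simp add: map_poly_eq_0_iff const_fun_eq_0_iff)
    then have "pcompose (map_poly const_fun r) [:a, 1:] \<noteq> 0"
      using pcompose_eq_0[of "map_poly const_fun r" "[:a, 1:]"] by auto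
    then have "poly (map_poly c r) \<xi> \<noteq> 0"
      unfolding c_def \<xi>_def poly_fps_shift[OF comm_ring_hom_const_fun]
      by (metis fps_of_poly_0 fps_of_poly_eq_iff)
    then show ?thesis
      using nat[of "[:r:]"] by (simp add: ev_const[OF c] ev_const[OF c'])
  qed
  obtain v where v: "valued_field FF v"
      "\<And>A. E A \<noteq> 0 \<Longrightarrow> v (E A) = fls_subdegree (ev c' (fps_to_fls \<xi>) (fps_to_fls \<eta>) A)"
    using ex_valuation_at_point[OF c' curve' transc] by blast
  have h0: "comm_ring_hom (\<lambda>f :: 'a ratfun_closure fps. fps_nth f 0)"
    by unfold_locales (auto simp: fps_mult_nth)
  have at0: "fps_nth (ev c \<xi> \<eta> A) 0 = ev const_fun a b A" for A
    unfolding ev_natural[OF c h0] by (simp add: c_def \<xi>_def \<eta>_def z(1))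
  have "0 \<le> v (E A) \<and> (0 < v (E A) \<longleftrightarrow> ev const_fun a b A = 0)" if "E A \<noteq> 0" for A
  proof -
    have val: "v (E A) = int (subdegree (ev c \<xi> \<eta> A))"
      using v(2)[OF that] by (simp add: nat fls_subdegree_fls_to_fps)
    have "ev c' (fps_to_fls \<xi>) (fps_to_fls \<eta>) A \<noteq> 0"
      using ev_eq_0_iff[OF c' curve' transc] that E_eq_0_iff by blast
    then have "ev c \<xi> \<eta> A \<noteq> 0"
      by (auto simp: nat)
    then show ?thesis
      unfolding val using subdegree_eq_0_iff[of "ev c \<xi> \<eta> A"] at0[of A] by auto
  qed
  then show ?thesis
    using v(1) by blast
qed


subsection \<open>The functions that are regular on the affine curve\<close>

text \<open>
  The denominator vanishes at \<open>(a, a')\<close>, so the numerator must vanish as well to avoid a pole there.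
\<close>

lemma numerator_vanishes:
  fixes a a' :: "'a ratfun_closure"
  assumes h: "E A / E [:b:] \<in> RR_space y m" and b: "b \<noteq> 0" "poly (map_poly const_fun b) a = 0"
    and pt: "on_curve n q l a a'"
  shows "ev const_fun a a' A = 0"
proof (cases "E A = 0")
  case True
  then show ?thesis
    using ev_curve_poly_multiple[OF comm_ring_hom_const_fun pt] E_eq_0_iff by blast
next
  case False
  obtain v where v: "valued_field FF v"
      "\<And>A. E A \<noteq> 0 \<Longrightarrow> 0 \<le> v (E A) \<and> (0 < v (E A) \<longleftrightarrow> ev const_fun a a' A = 0)"
    using ex_valuation_at_affine_point[OF pt] by blast
  interpret valued_field FF v by fact
  interpret C: comm_ring_hom "const_fun :: 'a \<Rightarrow> 'a ratfun_closure"
    by (rule comm_ring_hom_const_fun)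
  have Eb: "E [:b:] \<noteq> 0"
    using b by (simp add: E_x_eq_0_iff)
  have vb: "v (E [:b:]) > 0"
    using v(2)[OF Eb] b(2) by (simp add: ev_const[OF comm_ring_hom_const_fun])
  have const: "v (const_fun c) = 0" if "c \<noteq> 0" for c
    using v(2)[of "[:[:c:]:]"] that unfolding E_const
    by (simp add: const_fun_eq_0_iff ev_const[OF comm_ring_hom_const_fun] C.map_poly_pCons_hom)
  obtain d w where dw: "d > 0" "place y w" "\<And>f. f \<in> FF \<Longrightarrow> f \<noteq> 0 \<Longrightarrow> v f = d * w f"
    using ex_place[OF v(1) const] E_in_FF Eb vb by (metis less_irrefl)
  have "0 \<le> d * w x_fun" "0 \<le> d * w y"
    using v(2)[of "[:[:0, 1:]:]"] v(2)[of "[:0, 1:]"] dw(3) x_in_FF y_in_FF x_fun_nonzero y_nonzero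
    unfolding E_x E_y by auto
  then have "\<not> at_infinity_place y w"
    using dw(1) by (auto simp: at_infinity_place_def zero_le_mult_iff)
  then have "0 \<le> w (E A / E [:b:])"
    using h dw(2) False Eb by (auto simp: RR_space_def)
  then have "0 \<le> v (E A / E [:b:])"
    using dw(1,3) FF_I[OF Eb] False Eb by simp
  moreover have "v (E A) = v (E A / E [:b:]) + v (E [:b:])"
    using v_mult[of "E A / E [:b:]" "E [:b:]"] FF_I[OF Eb] E_in_FF Eb False by simp
  ultimately show ?thesis
    using vb v(2)[OF False] by simp
qed

text \<open>
  There are \<open>u\<close> points over \<open>a\<close>, because the \<open>u\<close> elements of the kernel of the trace act on them by
  translation, and \<open>A\<close> has degree less than \<open>u\<close> in \<open>y\<close>.
\<close>

lemma numerator_coeffs_vanish: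
  fixes a :: "'a ratfun_closure"
  assumes h: "E A / E [:b:] \<in> RR_space y m" and A: "degree A < u"
    and b: "b \<noteq> 0" "poly (map_poly const_fun b) a = 0"
  shows "poly (map_poly const_fun (coeff A j)) a = 0"
proof -
  have char_K: "CHAR('a ratfun_closure) = p"
    using CHAR_hom_image[OF comm_ring_hom_const_fun prime_CHAR] CHAR_eq by simp
  interpret C: comm_ring_hom "const_fun :: 'a \<Rightarrow> 'a ratfun_closure"
    by (rule comm_ring_hom_const_fun)
  define P :: "'a ratfun_closure poly" where "P = (\<Sum>i<n. monom 1 (q ^ i)) - [:a ^ l:]"
  have "coeff P u = (\<Sum>i<n. if i = n - 1 then 1 else 0)"
    using q_gt_1 u_pos by (auto simp: P_def coeff_sum u_def coeff_pCons intro!: sum.cong split: nat.splits)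
  then have "coeff P u = 1"
    using n by simp
  then have "degree P > 0"
    using le_degree[of P u] u_pos by simp
  then obtain a0 where "poly P a0 = 0"
    using alg_closed_imp_poly_has_root by blast
  then have a0: "on_curve n q l a a0"
    by (simp add: P_def on_curve_def poly_sum poly_monom)
  define Z where "Z = (\<lambda>b. a0 + const_fun b) ` {b. tr b = 0}"
  have "inj_on (\<lambda>b. a0 + const_fun b) {b. tr b = 0}"
    using inj_const_fun by (auto simp: inj_on_def)
  then have card_Z: "card Z = u"
    unfolding Z_def by (simp add: card_image card_kernel)
  have on_Z: "on_curve n q l a z" if z: "z \<in> Z" for z
  proof -
    obtain b where "tr b = 0" "z = a0 + const_fun b"
      using z by (auto simp: Z_def)
    moreover have "(\<Sum>i<n. const_fun b ^ (q ^ i)) = const_fun (tr b)"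
      by (simp add: tr_def C.hom_sum C.hom_power)
    ultimately show ?thesis
      using a0 by (simp add: on_curve_def sum_q_powers_add[OF char_K])
  qed
  define B where "B = map_poly (\<lambda>r. poly (map_poly const_fun r) a) A"
  have "B = 0"
  proof (rule ccontr)
    assume "B \<noteq> 0"
    have "Z \<subseteq> {z. poly B z = 0}"
      using numerator_vanishes[OF h b on_Z] by (auto simp: B_def ev_def)
    then have "u \<le> card {z. poly B z = 0}"
      using card_mono[OF poly_roots_finite[OF \<open>B \<noteq> 0\<close>]] card_Z by metis
    also have "\<dots> \<le> degree B"
      by (rule card_poly_roots_bound[OF \<open>B \<noteq> 0\<close>])
    also have "\<dots> \<le> degree A"
      unfolding B_def by (rule degree_map_poly_le)
    finally show False
      using A by simp
  qed
  then have "coeff B j = 0"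
    by simp
  then show ?thesis
    by (simp add: B_def coeff_map_poly)
qed

text \<open>
  The coordinate ring is integrally closed.  By induction on the degree of the denominator: the
  polynomial \<open>\<pi>\<close> of least degree that vanishes at a root \<open>a\<close> of \<open>b\<close> divides every polynomial vanishing
  at \<open>a\<close>, in particular \<open>b\<close> and the coefficients of \<open>A\<close>, so it can be cancelled.
\<close>

lemma regular_imp_polynomial:
  assumes "E A / E [:b:] \<in> RR_space y m" "b \<noteq> 0" "degree A < u"
  shows "\<exists>A'. degree A' < u \<and> E A / E [:b:] = E A'"
  using assms
proof (induction "degree b" arbitrary: A b rule: less_induct)
  case less
  interpret C: comm_ring_hom "const_fun :: 'a \<Rightarrow> 'a ratfun_closure"
    by (rule comm_ring_hom_const_fun)
  have deg_map: "degree (map_poly const_fun r) = degree r" for r :: "'a poly"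
    by (rule degree_map_poly) (simp add: const_fun_eq_0_iff)
  show ?case
  proof (cases "degree b = 0")
    case True
    then obtain c where c: "b = [:c:]"
      by (metis degree_eq_zeroE)
    with less.prems have "c \<noteq> 0"
      by simp
    then have "[:[:inverse c:]:] * [:b:] = 1"
      by (simp add: c one_pCons)
    then have inv: "E [:[:inverse c:]:] * E [:b:] = 1"
      by (metis E.hom_mult E.hom_one)
    then have "E [:b:] \<noteq> 0"
      by auto
    then have "E A / E [:b:] = (E [:[:inverse c:]:] * E [:b:]) * E A / E [:b:]"
      by (simp only: inv mult_1_left)
    also have "\<dots> = E ([:[:inverse c:]:] * A)"
      unfolding E.hom_mult using \<open>E [:b:] \<noteq> 0\<close> by simp
    finally have "E A / E [:b:] = E ([:[:inverse c:]:] * A)" .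
    moreover have "degree ([:[:inverse c:]:] * A) < u"
      using less.prems(3) degree_smult_le[of "[:inverse c:]" A] by simp
    ultimately show ?thesis
      by blast
  next
    case False
    then obtain a where a: "poly (map_poly const_fun b) a = 0"
      using alg_closed_imp_poly_has_root[of "map_poly const_fun b"] deg_map by auto
    let ?P = "\<lambda>r. r \<noteq> 0 \<and> poly (map_poly const_fun r) a = 0"
    define \<pi> where "\<pi> = arg_min degree ?P"
    have \<pi>: "?P \<pi>" and least: "?P r \<Longrightarrow> degree \<pi> \<le> degree r" for r
      unfolding \<pi>_def using a less.prems(2) arg_min_nat_lemma[of ?P b degree] by auto
    interpret e: comm_ring_hom "\<lambda>r. poly (map_poly const_fun r) a"
      by (rule comm_ring_hom_ev1) (rule comm_ring_hom_const_fun)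
    have dvd: "\<pi> dvd r" if "poly (map_poly const_fun r) a = 0" for r
    proof -
      have "r mod \<pi> = r - \<pi> * (r div \<pi>)"
        by (simp add: minus_mult_div_eq_mod)
      then have "poly (map_poly const_fun (r mod \<pi>)) a = 0"
        using that \<pi> by (simp only: e.hom_minus e.hom_mult) simp
      then have "r mod \<pi> = 0"
        using least[of "r mod \<pi>"] degree_mod_less[of \<pi> r] \<pi> by force
      then show ?thesis
        by blast
    qed
    have "degree \<pi> \<noteq> 0"
    proof
      assume "degree \<pi> = 0"
      then obtain c where "\<pi> = [:c:]"
        by (metis degree_eq_zeroE)
      then show False
        using \<pi> by (simp add: const_fun_eq_0_iff C.map_poly_pCons_hom)
    qed
    obtain b' where b': "b = \<pi> * b'"
      using dvd[OF a] by blast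
    define A' where "A' = map_poly (\<lambda>r. r div \<pi>) A"
    have "coeff A j = \<pi> * coeff A' j" for j
      using dvd[OF numerator_coeffs_vanish[OF less.prems(1,3,2) a]] by (simp add: A'_def coeff_map_poly)
    then have A': "A = smult \<pi> A'"
      by (intro poly_eqI) simp
    have E\<pi>: "E [:\<pi>:] \<noteq> 0"
      using \<pi> by (simp add: E_x_eq_0_iff)
    have "A = [:\<pi>:] * A'" "[:b:] = [:\<pi>:] * [:b':]"
      using A' b' by auto
    then have "E A = E [:\<pi>:] * E A'" "E [:b:] = E [:\<pi>:] * E [:b':]"
      by (simp_all only: E.hom_mult)
    then have eq: "E A / E [:b:] = E A' / E [:b':]"
      using E\<pi> by simp
    have "b' \<noteq> 0"
      using b' less.prems(2) by auto
    moreover have "degree b' < degree b"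
      using b' less.prems(2) \<open>degree \<pi> \<noteq> 0\<close> by (simp add: degree_mult_eq)
    moreover have "degree A' < u"
      using less.prems(3) degree_map_poly_le[of "\<lambda>r. r div \<pi>" A] by (simp add: A'_def)
    ultimately show ?thesis
      using less.hyps[of b' A'] less.prems(1) eq by simp
  qed
qed

text \<open>
  A function without affine poles is a polynomial, whose pole order at infinity is its weight.
  Conversely, a polynomial in \<open>x\<close> and \<open>y\<close> is regular where these are.
\<close>

theorem RR_space_eq: "RR_space y m = (\<lambda>A. E A) ` polys_of_weight_le m"
proof
  show "RR_space y m \<subseteq> (\<lambda>A. E A) ` polys_of_weight_le m"
  proof
    fix f assume f: "f \<in> RR_space y m"
    then have "f \<in> FF"
      by (simp add: RR_space_def)
    then obtain A b where Ab: "b \<noteq> 0" "degree A < u" "f = E A / E [:b:]"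
      using FF_normal_form by blast
    then obtain A' where A': "degree A' < u" "f = E A'"
      using regular_imp_polynomial f by metis
    have "\<forall>(i, j)\<in>monomials A'. u * i + l * j \<le> m"
    proof (cases "A' = 0")
      case False
      obtain w where w: "at_infinity_place y w" "w (E A') = - int (weight A')"
        using ex_place_at_infinity False A'(1) by blast
      then have "- int m \<le> w (E A')"
        using f A' False E_reduced_eq_0_iff[OF A'(1)]
        by (auto simp: RR_space_def at_infinity_place_def)
      then show ?thesis
        using w(2) weight_le_iff[OF False, of m] by simp
    qed (simp add: monomials_def)
    then show "f \<in> (\<lambda>A. E A) ` polys_of_weight_le m"
      using A' by (auto simp: polys_of_weight_le_def)
  qed
next
  show "(\<lambda>A. E A) ` polys_of_weight_le m \<subseteq> RR_space y m"
  proof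
    fix f assume "f \<in> (\<lambda>A. E A) ` polys_of_weight_le m"
    then obtain A where A: "f = E A" "degree A < u" "\<forall>(i, j)\<in>monomials A. u * i + l * j \<le> m"
      by (auto simp: polys_of_weight_le_def)
    have "(if at_infinity_place y v then - int m else 0) \<le> v f" if f: "f \<noteq> 0" and v: "place y v" for v
    proof -
      have A0: "A \<noteq> 0"
        using f A(1) by auto
      show ?thesis
      proof (cases "at_infinity_place y v")
        case True
        then show ?thesis
          using at_infinity_place_eq_weight[OF True A0 A(2)] weight_le_iff[OF A0, of m] A(1,3) by simp
      next
        case False
        interpret valued_field FF v
          by (rule valued_field_place[OF v])
        have vx: "0 \<le> v x_fun" "0 \<le> v y"
          using False v by (auto simp: at_infinity_place_def)
        let ?f = "\<lambda>(i, j). const_fun (coeff (coeff A j) i) * x_fun ^ i * y ^ j"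
        have "- 1 < v (sum ?f (monomials A))"
        proof (rule v_sum_gt)
          fix a assume "a \<in> monomials A"
          then obtain i j where a: "a = (i, j)" "coeff (coeff A j) i \<noteq> 0"
            by (auto simp: monomials_def)
          note cl = const_fun_in_FF x_in_FF y_in_FF mult_closed power_closed
          show "?f a \<in> FF"
            unfolding a(1) by (auto intro: cl)
          have "v (const_fun (coeff (coeff A j) i)) = 0"
            using v a(2) by (simp add: place_def)
          then have "v (?f a) = int i * v x_fun + int j * v y"
            unfolding a(1) using a(2) x_fun_nonzero[where 'a = 'a] y_nonzero
            by (simp add: v_mult v_power cl const_fun_eq_0_iff)
          then show "- 1 < v (?f a)"
            using vx by (simp add: less_le_trans[of "- 1" 0])
        next
          show "sum ?f (monomials A) \<noteq> 0"
            using f A(1) by (simp add: ev_eq_sum_monomials[OF comm_ring_hom_const_fun])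
        qed
        then show ?thesis
          using False A(1) by (simp add: ev_eq_sum_monomials[OF comm_ring_hom_const_fun])
      qed
    qed
    then show "f \<in> RR_space y m"
      using A(1) E_in_FF by (simp add: RR_space_def)
  qed
qed

end


section \<open>Monomials and rational points\<close>

context trace_curve
begin

definition monomials_le :: "nat \<Rightarrow> (nat \<times> nat) set" where
  "monomials_le m = {(i, j). j < u \<and> u * i + l * j \<le> m}"

lemma finite_monomials_le: "finite (monomials_le m)"
proof (rule finite_subset)
  show "monomials_le m \<subseteq> {..m} \<times> {..<u}"
  proof
    fix a assume "a \<in> monomials_le m"
    then obtain i j where a: "a = (i, j)" "j < u" "u * i + l * j \<le> m"
      by (auto simp: monomials_le_def)
    have "i \<le> u * i"
      using u_pos by simp
    then have "i \<le> m"
      using a(3) by linarith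
    then show "a \<in> {..m} \<times> {..<u}"
      using a by auto
  qed
qed auto

text \<open>
  The hypothesis is \<open>m \<ge> 2g - 1\<close> with \<open>2g = (u - 1)(l - 1)\<close>.  Then each \<open>j < u\<close> contributes
  \<open>\<lfloor>(m - lj) / u\<rfloor> + 1\<close> monomials, and the remainders of the divisions by \<open>u\<close> are all the residues.
\<close>

lemma card_monomials_le:
  assumes "(int u - 1) * (int l - 1) \<le> int m + 1"
  shows "2 * int (card (monomials_le m)) = 2 * (int m + 1) - (int u - 1) * (int l - 1)"
proof -
  let ?X = "\<lambda>j. int m - int l * int j"
  have card_j: "int (card {i. u * i + l * j \<le> m}) = ?X j div int u + 1" if j: "j < u" for j
  proof -
    have iff: "u * i + l * j \<le> m \<longleftrightarrow> int i \<le> ?X j div int u" for i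
    proof
      assume "u * i + l * j \<le> m"
      then have "int (u * i + l * j) \<le> int m"
        by (rule of_nat_mono)
      then have "int i * int u \<le> ?X j"
        by (simp add: algebra_simps)
      then have "int i * int u div int u \<le> ?X j div int u"
        using u_pos by (intro zdiv_mono1) auto
      then show "int i \<le> ?X j div int u"
        using u_pos by simp
    next
      assume "int i \<le> ?X j div int u"
      then have "int u * int i \<le> int u * (?X j div int u)"
        by (intro mult_left_mono) auto
      also have "\<dots> \<le> ?X j"
        using u_pos mult_div_mod_eq[of "int u" "?X j"] pos_mod_sign[of "int u" "?X j"] by linarith
      finally have "int (u * i + l * j) \<le> int m"
        by simp
      then show "u * i + l * j \<le> m"
        by (simp only: of_nat_le_iff)
    qed
    have "int l * int j \<le> int l * (int u - 1)"
      using j by (intro mult_left_mono) auto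
    then have "- int u \<le> ?X j"
      using assms by (simp add: algebra_simps)
    then have "(- 1) * int u div int u \<le> ?X j div int u"
      using u_pos by (intro zdiv_mono1) auto
    moreover have "(- 1) * int u div int u = - 1"
      using u_pos by (intro nonzero_mult_div_cancel_right) auto
    ultimately have ge: "- 1 \<le> ?X j div int u"
      by linarith
    have "{i. u * i + l * j \<le> m} = {..<nat (?X j div int u + 1)}"
      unfolding iff using ge by auto
    then show ?thesis
      using ge by simp
  qed
  have "monomials_le m = (\<lambda>(j, i). (i, j)) ` (SIGMA j:{..<u}. {i. u * i + l * j \<le> m})"
    by (auto simp: monomials_le_def image_iff)
  moreover have "inj_on (\<lambda>(j, i). (i, j)) (SIGMA j:{..<u}. {i. u * i + l * j \<le> m})"
    by (auto simp: inj_on_def)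
  moreover have "finite {i. u * i + l * j \<le> m}" for j
  proof (rule finite_subset[of _ "{..m}"])
    show "{i. u * i + l * j \<le> m} \<subseteq> {..m}"
    proof
      fix i assume "i \<in> {i. u * i + l * j \<le> m}"
      then have "u * i + l * j \<le> m"
        by simp
      moreover have "1 * i \<le> u * i"
        using u_pos by (intro mult_le_mono1) simp
      ultimately have "i \<le> m"
        by linarith
      then show "i \<in> {..m}"
        by simp
    qed
  qed simp
  ultimately have "int (card (monomials_le m)) = (\<Sum>j<u. int (card {i. u * i + l * j \<le> m}))"
    by (simp add: card_image)
  also have "\<dots> = (\<Sum>j<u. ?X j div int u + 1)"
    by (intro sum.cong refl card_j) auto
  finally have card: "int (card (monomials_le m)) = (\<Sum>j<u. ?X j div int u + 1)" .
  let ?r = "\<lambda>j. nat (?X j mod int u)"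
  have inj: "inj_on ?r {..<u}"
  proof (rule inj_onI)
    fix j j' assume jj: "j \<in> {..<u}" "j' \<in> {..<u}" and "?r j = ?r j'"
    then have "?X j mod int u = ?X j' mod int u"
      using u_pos by (simp add: nat_eq_iff2)
    then have "int u dvd ?X j' - ?X j"
      by (metis mod_eq_dvd_iff)
    then have "int u dvd int l * (int j - int j')"
      by (simp add: algebra_simps)
    then have "int u dvd int j - int j'"
      using coprime_u_l by (simp add: coprime_dvd_mult_right_iff)
    then have "int j mod int u = int j' mod int u"
      by (simp add: mod_eq_dvd_iff)
    then show "j = j'"
      using jj by simp
  qed
  have "?r ` {..<u} = {..<u}"
    using inj u_pos by (intro endo_inj_surj) (auto simp: nat_less_iff)
  then have sum_mod: "(\<Sum>j<u. ?X j mod int u) = (\<Sum>k<u. int k)"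
    using sum.reindex[OF inj, of int] u_pos by simp
  have "2 * (\<Sum>k<b. int k) = int b * (int b - 1)" for b
    by (induction b) (auto simp: algebra_simps)
  then have two_sum: "2 * (\<Sum>k<u. int k) = int u * (int u - 1)" .
  then have mods: "2 * (\<Sum>j<u. ?X j mod int u) = int u * (int u - 1)"
    by (simp only: sum_mod)
  have "int u * (\<Sum>j<u. ?X j div int u) = (\<Sum>j<u. ?X j - ?X j mod int u)"
    unfolding sum_distrib_left by (intro sum.cong refl) (simp add: minus_mod_eq_mult_div)
  also have "\<dots> = int u * int m - int l * (\<Sum>k<u. int k) - (\<Sum>j<u. ?X j mod int u)"
    by (simp add: sum_subtractf sum_distrib_left)
  finally have div_sum: "int u * (\<Sum>j<u. ?X j div int u) =
      int u * int m - int l * (\<Sum>k<u. int k) - (\<Sum>j<u. ?X j mod int u)" .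
  have "int u * (2 * (\<Sum>j<u. ?X j div int u)) = 2 * (int u * (\<Sum>j<u. ?X j div int u))"
    by (rule mult.left_commute)
  also have "\<dots> = 2 * (int u * int m) - int l * (2 * (\<Sum>k<u. int k)) - 2 * (\<Sum>j<u. ?X j mod int u)"
    unfolding div_sum by (simp only: right_diff_distrib mult.left_commute)
  also have "\<dots> = int u * (2 * int m - int l * (int u - 1) - (int u - 1))"
    unfolding mods two_sum by (simp add: algebra_simps)
  finally have "int u * (2 * (\<Sum>j<u. ?X j div int u)) =
      int u * (2 * int m - int l * (int u - 1) - (int u - 1))" .
  then have "2 * (\<Sum>j<u. ?X j div int u) = 2 * int m - int l * (int u - 1) - (int u - 1)"
    using u_pos by simp
  then show ?thesis
    unfolding card by (simp add: sum.distrib algebra_simps)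
qed

lemma card_polys_monomials_subset:
  assumes "finite S"
  shows "card {A :: 'a poly poly. monomials A \<subseteq> S} = CARD('a) ^ card S"
    "finite {A :: 'a poly poly. monomials A \<subseteq> S}"
proof -
  let ?P = "{A :: 'a poly poly. monomials A \<subseteq> S}"
  define G where "G f = (\<Sum>(i, j)\<in>S. monom (monom (f (i, j)) i) j)" for f :: "nat \<times> nat \<Rightarrow> 'a"
  have coeff_G: "coeff (coeff (G f) j) i = (if (i, j) \<in> S then f (i, j) else 0)" for f i j
  proof -
    have "coeff (coeff (G f) j) i = (\<Sum>a\<in>S. if a = (i, j) then f a else 0)"
      unfolding G_def by (auto simp: coeff_sum intro!: sum.cong)
    then show ?thesis
      using assms by simp
  qed
  have "bij_betw (\<lambda>A. restrict (\<lambda>(i, j). coeff (coeff A j) i) S) ?P (S \<rightarrow>\<^sub>E (UNIV :: 'a set))"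
  proof (rule bij_betwI[where g = G])
    show "G \<in> (S \<rightarrow>\<^sub>E UNIV) \<rightarrow> ?P"
      by (auto simp: monomials_def coeff_G split: if_splits)
    show "G (restrict (\<lambda>(i, j). coeff (coeff A j) i) S) = A" if "A \<in> ?P" for A
      using that by (intro poly_eqI) (auto simp: coeff_G monomials_def)
    show "restrict (\<lambda>(i, j). coeff (coeff (G f) j) i) S = f" if "f \<in> S \<rightarrow>\<^sub>E UNIV" for f
      using that by (auto simp: coeff_G fun_eq_iff PiE_def extensional_def restrict_def)
  qed auto
  then show "card ?P = CARD('a) ^ card S" "finite ?P"
    using assms by (simp_all add: bij_betw_same_card bij_betw_finite card_PiE finite_PiE)
qed

lemma polys_of_weight_le_iff: "A \<in> polys_of_weight_le m \<longleftrightarrow> monomials A \<subseteq> monomials_le m"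
proof
  assume "A \<in> polys_of_weight_le m"
  then show "monomials A \<subseteq> monomials_le m"
    using monomials_degree[of _ _ A] by (fastforce simp: polys_of_weight_le_def monomials_le_def)
next
  assume sub: "monomials A \<subseteq> monomials_le m"
  have "degree A < u"
  proof (cases "A = 0")
    case False
    then have "coeff A (degree A) \<noteq> 0"
      by simp
    then have "(degree (coeff A (degree A)), degree A) \<in> monomials A"
      by (simp add: monomials_def)
    then show ?thesis
      using sub by (auto simp: monomials_le_def)
  qed (use u_pos in simp)
  then show "A \<in> polys_of_weight_le m"
    using sub by (auto simp: polys_of_weight_le_def monomials_le_def)
qed

lemma card_polys_of_weight_le: "card (polys_of_weight_le m) = CARD('a) ^ card (monomials_le m)"
proof -
  have "polys_of_weight_le m = {A. monomials A \<subseteq> monomials_le m}"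
    using polys_of_weight_le_iff by blast
  then show ?thesis
    by (simp add: card_polys_monomials_subset finite_monomials_le)
qed

text \<open>
  The reduced form of a product, whose weight is additive because it is a pole order.
\<close>

lemma ex_reduced_product:
  assumes A: "A \<noteq> 0" "degree A < u" and B: "B \<noteq> 0" "degree B < u"
  shows "\<exists>R. R \<noteq> 0 \<and> degree R < u \<and> weight R = weight A + weight B \<and> curve_poly dvd A * B - R"
proof -
  obtain \<xi> \<eta> :: "'a fls" where pt: "\<And>A. A \<noteq> 0 \<Longrightarrow> degree A < u \<Longrightarrow> ev fls_const \<xi> \<eta> A \<noteq> 0 \<and>
      fls_subdegree (ev fls_const \<xi> \<eta> A) = - int (weight A)" "on_curve n q l \<xi> \<eta>"
    using ex_infinity by blast
  interpret e: comm_ring_hom "ev fls_const \<xi> \<eta>"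
    by (rule comm_ring_hom_ev) (rule comm_ring_hom_fls_const)
  obtain Q R where QR: "A * B = curve_poly * Q + R" "degree R < u"
    using ex_reduced by blast
  have dvd: "curve_poly dvd A * B - R"
    using QR by simp
  then have "ev fls_const \<xi> \<eta> (A * B - R) = 0"
    by (rule ev_curve_poly_multiple[OF comm_ring_hom_fls_const pt(2)])
  then have R: "ev fls_const \<xi> \<eta> R = ev fls_const \<xi> \<eta> A * ev fls_const \<xi> \<eta> B"
    by (simp add: e.hom_minus e.hom_mult)
  then have "R \<noteq> 0"
    using pt(1)[OF A] pt(1)[OF B] by auto
  then have "- int (weight R) = - int (weight A) + - int (weight B)"
    using pt(1)[OF A] pt(1)[OF B] pt(1)[of R] QR(2) R by simp
  then show ?thesis
    using \<open>R \<noteq> 0\<close> QR(2) dvd by (intro exI[of _ R]) simp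
qed


subsection \<open>The rational points\<close>

text \<open>
  The \<open>x\<close>-coordinates of the rational points: the trace takes exactly the values \<open>c\<close> with \<open>c^q = c\<close>.
\<close>

definition x_coords :: "'a set" where
  "x_coords = {a. (a ^ l) ^ q = a ^ l}"

definition e :: nat where
  "e = gcd (l * (q - 1)) (q ^ n - 1)"

abbreviation "pts \<equiv> rational_points n q l :: ('a \<times> 'a) set"

lemma pts_iff: "(a, b) \<in> pts \<longleftrightarrow> tr b = a ^ l"
  by (simp add: rational_points_def on_curve_def tr_def)

lemma pts_eq: "pts = (SIGMA a:x_coords. {b. tr b = a ^ l})"
proof -
  have "a \<in> x_coords" if "tr b = a ^ l" for a b
    using tr_power_q[of b] that by (simp add: x_coords_def)
  then show ?thesis
    by (auto simp: pts_iff)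
qed

lemma card_x_coords_fiber: "a \<in> x_coords \<Longrightarrow> card {b. tr b = a ^ l} = u"
  by (rule card_fiber) (simp add: x_coords_def)

lemma q_n_gt_1: "q ^ n > 1"
  using q_gt_1 n by (intro one_less_power) auto

lemma e_pos: "e > 0"
  using q_n_gt_1 by (simp add: e_def)

lemma power_q_n_minus_1: "a \<noteq> 0 \<Longrightarrow> a ^ (q ^ n - 1) = (1 :: 'a)"
proof -
  assume a: "a \<noteq> 0"
  have "a * a ^ (q ^ n - 1) = a * 1"
    using power_q_n[of a] q_n_gt_1 by (metis Suc_diff_1 gr_implies_not0 mult_1_right not_gr_zero power_Suc)
  then show ?thesis
    using a by (simp only: mult_cancel_left) simp
qed

text \<open>
  For \<open>a \<noteq> 0\<close> the condition is \<open>a^(l(q-1)) = 1\<close>.  As also \<open>a^(q^n - 1) = 1\<close>, the exponent can be replaced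
  by the greatest common divisor.
\<close>

lemma x_coords_eq: "x_coords = insert 0 {a. a ^ e = 1}"
proof -
  have "(a ^ l) ^ q = a ^ l \<longleftrightarrow> a ^ e = 1" if a: "a \<noteq> 0" for a :: 'a
  proof -
    have "(a ^ l) ^ q = a ^ l * a ^ (l * (q - 1))"
      using q_gt_1 by (simp add: power_mult flip: power_Suc)
    then have "(a ^ l) ^ q = a ^ l \<longleftrightarrow> a ^ (l * (q - 1)) = 1"
      using a by simp
    also have "\<dots> \<longleftrightarrow> a ^ e = 1"
    proof
      assume one: "a ^ (l * (q - 1)) = 1"
      have "l * (q - 1) \<noteq> 0"
        using l q_gt_1 by simp
      then obtain x z where "l * (q - 1) * x = (q ^ n - 1) * z + e"
        unfolding e_def using bezout_nat by blast
      then have "(a ^ (l * (q - 1))) ^ x = (a ^ (q ^ n - 1)) ^ z * a ^ e"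
        by (simp only: flip: power_mult power_add)
      then show "a ^ e = 1"
        unfolding one power_q_n_minus_1[OF a] by simp
    next
      assume "a ^ e = 1"
      moreover have "e dvd l * (q - 1)"
        by (simp add: e_def)
      ultimately show "a ^ (l * (q - 1)) = 1"
        by (metis dvdE power_mult power_one)
    qed
    finally show ?thesis .
  qed
  moreover have "0 \<in> x_coords"
    using l q_gt_1 by (simp add: x_coords_def power_0_left)
  ultimately have "a \<in> x_coords \<longleftrightarrow> a \<in> insert 0 {a. a ^ e = 1}" for a
    by (cases "a = 0") (simp_all add: x_coords_def)
  then show ?thesis
    by blast
qed

lemma card_roots_of_unity_le: "k > 0 \<Longrightarrow> card {a :: 'a. a ^ k = 1} \<le> k"
proof -
  assume k: "k > 0"
  define P :: "'a poly" where "P = monom 1 k - 1"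
  have "coeff P k = 1"
    using k by (simp add: P_def)
  then have "P \<noteq> 0"
    by auto
  moreover have "degree P \<le> k"
    unfolding P_def by (intro degree_diff_le) (auto simp: degree_monom_le)
  ultimately show ?thesis
    using card_poly_roots_bound[of P] by (simp add: P_def poly_monom)
qed

text \<open>
  As \<open>e\<close> divides \<open>q^n - 1\<close>, the polynomial \<open>X^e - 1\<close> divides \<open>X^(q^n - 1) - 1\<close>, which has as many
  roots as its degree.  So the same holds for \<open>X^e - 1\<close>.
\<close>

lemma card_roots_of_unity: "card {a :: 'a. a ^ e = 1} = e"
proof -
  have "e dvd q ^ n - 1"
    by (simp add: e_def)
  then obtain k where k: "q ^ n - 1 = e * k" ..
  have k_pos: "k > 0"
    using k q_n_gt_1 by (cases k) auto
  define P :: "'a poly" where "P = (\<Sum>i<k. monom 1 (e * i))"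
  have "coeff P 0 = (\<Sum>i<k. if i = 0 then 1 else 0)"
    using e_pos by (auto simp: P_def coeff_sum intro!: sum.cong)
  then have "P \<noteq> 0"
    using k_pos by auto
  have "degree P \<le> e * (k - 1)"
    unfolding P_def by (intro degree_sum_le) (auto intro!: order.trans[OF degree_monom_le])
  then have roots_P: "card {a. poly P a = 0} \<le> e * (k - 1)"
    using card_poly_roots_bound[OF \<open>P \<noteq> 0\<close>] by linarith
  have "a ^ e = 1 \<or> poly P a = 0" if "a \<noteq> 0" for a
  proof -
    have "poly P a = (\<Sum>i<k. (a ^ e) ^ i)"
      by (simp add: P_def poly_sum poly_monom power_mult)
    then have "(a ^ e - 1) * poly P a = (a ^ e) ^ k - 1"
      by (simp add: power_diff_1_eq)
    also have "\<dots> = 0"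
      using power_q_n_minus_1[OF that] unfolding k power_mult by simp
    finally show ?thesis
      by simp
  qed
  then have "UNIV - {0} \<subseteq> {a. a ^ e = 1} \<union> {a. poly P a = 0}"
    by auto
  then have "card (UNIV - {0 :: 'a}) \<le> card ({a. a ^ e = 1} \<union> {a. poly P a = 0})"
    by (intro card_mono) auto
  also have "\<dots> \<le> card {a :: 'a. a ^ e = 1} + card {a. poly P a = 0}"
    by (rule card_Un_le)
  also have "card (UNIV - {0 :: 'a}) = e * k"
    by (simp add: card_Diff_singleton CARD_eq flip: k)
  finally have "e * k \<le> card {a :: 'a. a ^ e = 1} + e * (k - 1)"
    using roots_P by linarith
  then have "e \<le> card {a :: 'a. a ^ e = 1}"
    using k_pos by (cases k) auto
  then show ?thesis
    using card_roots_of_unity_le[OF e_pos] by simp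
qed

lemma card_x_coords: "card x_coords = e + 1"
  unfolding x_coords_eq using e_pos by (simp add: card_roots_of_unity power_0_left)

lemma card_pts: "card pts = u * (e + 1)"
  unfolding pts_eq using card_x_coords card_x_coords_fiber by (subst card_SigmaI) auto

text \<open>
  For \<open>i = 0\<close> the sum is \<open>e + 1\<close>, which is \<open>0\<close> in characteristic \<open>p\<close>.  For \<open>0 < i < e\<close> there is an
  \<open>e\<close>-th root of unity \<open>\<zeta>\<close> with \<open>\<zeta>^i \<noteq> 1\<close>, and multiplication by it permutes the roots of unity.
\<close>

lemma sum_x_coords_power:
  assumes "p dvd e + 1" "i < e"
  shows "(\<Sum>a\<in>x_coords. a ^ i) = 0"
proof (cases "i = 0")
  case True
  then have "(\<Sum>a\<in>x_coords. a ^ i) = of_nat (e + 1)"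
    using card_x_coords by simp
  also have "\<dots> = 0"
    using assms(1) by (simp only: of_nat_eq_0_iff_char_dvd CHAR_eq)
  finally show ?thesis .
next
  case False
  let ?R = "{a :: 'a. a ^ e = 1}"
  have "card {a :: 'a. a ^ i = 1} < card ?R"
    using card_roots_of_unity_le[of i] False assms(2) card_roots_of_unity by linarith
  then obtain \<zeta> :: 'a where \<zeta>: "\<zeta> ^ e = 1" "\<zeta> ^ i \<noteq> 1"
    by (metis (mono_tags, lifting) card_mono finite leD mem_Collect_eq subsetI)
  then have "\<zeta> \<noteq> 0"
    using e_pos by (auto simp: power_0_left)
  have "(\<Sum>a\<in>?R. a ^ i) = (\<Sum>a\<in>?R. (\<zeta> * a) ^ i)"
    by (rule sum.reindex_bij_witness[of _ "\<lambda>a. \<zeta> * a" "\<lambda>a. a / \<zeta>"])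
       (use \<zeta> \<open>\<zeta> \<noteq> 0\<close> in \<open>auto simp: power_mult_distrib power_divide\<close>)
  also have "\<dots> = \<zeta> ^ i * (\<Sum>a\<in>?R. a ^ i)"
    by (simp add: power_mult_distrib sum_distrib_left)
  finally have "(\<Sum>a\<in>?R. a ^ i) = 0"
    using \<zeta>(2) by simp
  moreover have "0 \<notin> ?R"
    using e_pos by (simp add: power_0_left)
  ultimately show ?thesis
    unfolding x_coords_eq using False by simp
qed


subsection \<open>Sums over the rational points\<close>

text \<open>
  Lagrange interpolation at the roots of \<open>tr - c\<close>.  Since the derivative of this polynomial is
  \<open>1\<close>, so are the denominators, and comparing leading coefficients evaluates the sum.
\<close>

lemma sum_fiber:
  assumes c: "c ^ q = c" and G: "degree G < u"
  shows "(\<Sum>b | tr b = c. poly G b) = coeff G (u - 1)"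
proof -
  define B where "B = {b. tr b = c}"
  have card_B: "card B = u"
    unfolding B_def by (rule card_fiber[OF c])
  define P where "P = tr_poly - [:c:]"
  define Q where "Q b = (\<Prod>b'\<in>B - {b}. [:- b', 1:])" for b
  have zero_if: "H = 0" if "degree H < u" "\<And>b. b \<in> B \<Longrightarrow> poly H b = 0" for H
  proof (rule ccontr)
    assume H: "H \<noteq> 0"
    have "u \<le> card {b. poly H b = 0}"
      unfolding card_B[symmetric] by (rule card_mono) (use that(2) in auto)
    also have "\<dots> \<le> degree H"
      by (rule card_poly_roots_bound[OF H])
    finally show False
      using that(1) by simp
  qed
  have monic: "lead_coeff (\<Prod>b\<in>S. [:- b, 1:]) = 1" "degree (\<Prod>b\<in>S. [:- b, 1:]) = card S"
    for S :: "'a set"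
    by (simp_all only: lead_coeff_prod) (simp_all add: degree_prod_eq_sum_degree)
  have P_eq: "P = (\<Prod>b\<in>B. [:- b, 1:])"
  proof -
    let ?D = "P - (\<Prod>b\<in>B. [:- b, 1:])"
    have deg: "degree P = u" "coeff P u = 1"
      using degree_tr_poly_diff lead_coeff_tr_poly_diff by (auto simp: P_def)
    have "degree ?D \<le> u"
      using deg monic(2)[of B] card_B by (intro degree_diff_le) auto
    moreover have "coeff ?D u = 0"
      using deg monic[of B] card_B by simp
    ultimately have "degree ?D < u"
      using u_pos by (metis degree_0 le_neq_implies_less leading_coeff_0_iff)
    moreover have "poly ?D b = 0" if "b \<in> B" for b
    proof -
      have "poly (\<Prod>b\<in>B. [:- b, 1:]) b = 0"
        using that by (auto simp: poly_prod)
      then show ?thesis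
        using that by (simp add: P_def poly_tr_poly B_def)
    qed
    ultimately have "?D = 0"
      by (rule zero_if)
    then show ?thesis
      by simp
  qed
  have "pderiv P = (\<Sum>i<n. pderiv (monom 1 (q ^ i)))"
    by (simp add: P_def tr_poly_def pderiv_diff pderiv_sum)
  also have "\<dots> = (\<Sum>i<n. if i = 0 then 1 else 0)"
  proof (rule sum.cong[OF refl])
    fix i
    have "of_nat (q ^ i) = (0 :: 'a)" if "i \<noteq> 0"
    proof -
      have "CHAR('a) dvd q ^ i"
        using that s by (simp add: CHAR_eq q dvd_power flip: power_mult)
      then show ?thesis
        by (simp only: of_nat_eq_0_iff_char_dvd)
    qed
    then show "pderiv (monom 1 (q ^ i)) = (if i = 0 then 1 else 0 :: 'a poly)"
      by (auto simp: pderiv_monom)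
  qed
  finally have pderiv_P: "pderiv P = 1"
    using n by simp
  have Q_at: "poly (Q b) b' = (if b = b' then 1 else 0)" if "b \<in> B" "b' \<in> B" for b b'
  proof (cases "b = b'")
    case True
    have "P = [:- b, 1:] * Q b"
      unfolding P_eq Q_def using that(1) by (intro prod.remove) auto
    then have "pderiv P = [:- b, 1:] * pderiv (Q b) + Q b * pderiv [:- b, 1:]"
      by (simp only: pderiv_mult)
    then have "poly (pderiv P) b = poly (Q b) b"
      by (simp add: pderiv_pCons)
    then show ?thesis
      using True pderiv_P by simp
  next
    case False
    then show ?thesis
      using that by (auto simp: Q_def poly_prod)
  qed
  have deg_Q: "degree (Q b) = u - 1" "coeff (Q b) (u - 1) = 1" if "b \<in> B" for b
    using monic[of "B - {b}"] that card_B by (simp_all add: Q_def)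
  define H where "H = (\<Sum>b\<in>B. smult (poly G b) (Q b))"
  have "degree H \<le> u - 1"
    unfolding H_def using deg_Q by (intro degree_sum_le) (auto intro: order.trans[OF degree_smult_le])
  then have "degree (G - H) < u"
    using G u_pos by (intro degree_diff_less) auto
  moreover have "poly (G - H) b = 0" if "b \<in> B" for b
    using that by (simp add: H_def poly_sum Q_at mult_delta_right)
  ultimately have "G - H = 0"
    by (rule zero_if)
  then have "coeff G (u - 1) = coeff H (u - 1)"
    by simp
  also have "\<dots> = (\<Sum>b\<in>B. poly G b)"
    unfolding H_def coeff_sum coeff_smult by (intro sum.cong refl) (simp only: deg_Q mult_1_right)
  finally show ?thesis
    by (simp add: B_def)
qed

lemma sum_pts:
  assumes "degree A < u"
  shows "(\<Sum>P\<in>pts. eval_point A P) = (\<Sum>a\<in>x_coords. poly (coeff A (u - 1)) a)"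
proof -
  have "(\<Sum>P\<in>pts. eval_point A P) = (\<Sum>a\<in>x_coords. \<Sum>b | tr b = a ^ l. eval_point A (a, b))"
    unfolding pts_eq by (subst sum.Sigma) auto
  also have "\<dots> = (\<Sum>a\<in>x_coords. coeff (map_poly (\<lambda>r. poly r a) A) (u - 1))"
  proof (rule sum.cong[OF refl])
    fix a assume "a \<in> x_coords"
    then have "(a ^ l) ^ q = a ^ l"
      by (simp add: x_coords_def)
    moreover have "degree (map_poly (\<lambda>r. poly r a) A) < u"
      using degree_map_poly_le[of "\<lambda>r. poly r a" A] assms by simp
    ultimately show "(\<Sum>b | tr b = a ^ l. eval_point A (a, b)) = coeff (map_poly (\<lambda>r. poly r a) A) (u - 1)"
      unfolding eval_point_def by (simp add: sum_fiber)
  qed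
  finally show ?thesis
    by (simp add: coeff_map_poly)
qed

text \<open>
  A reduced polynomial that vanishes at all rational points vanishes at \<open>u\<close> points with given
  \<open>x\<close>-coordinate \<open>a \<in> x_coords\<close>, so its coefficients have \<open>e + 1\<close> zeros.
\<close>

lemma vanishing_imp_0:
  assumes A: "A \<in> polys_of_weight_le m" "m < u * (e + 1)" and zero: "\<And>P. P \<in> pts \<Longrightarrow> eval_point A P = 0"
  shows "A = 0"
proof -
  have deg: "degree A < u"
    using A(1) by (simp add: polys_of_weight_le_def)
  have vanish: "poly (coeff A j) a = 0" if a: "a \<in> x_coords" for j a
  proof -
    define B where "B = map_poly (\<lambda>r. poly r a) A"
    have "B = 0"
    proof (rule ccontr)
      assume "B \<noteq> 0"
      have "{b. tr b = a ^ l} \<subseteq> {b. poly B b = 0}"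
        using zero[of "(a, b)" for b] by (auto simp: pts_iff B_def eval_point_def)
      then have "u \<le> card {b. poly B b = 0}"
        using card_mono[OF poly_roots_finite[OF \<open>B \<noteq> 0\<close>]] card_x_coords_fiber[OF a] by metis
      also have "\<dots> \<le> degree B"
        by (rule card_poly_roots_bound[OF \<open>B \<noteq> 0\<close>])
      also have "\<dots> \<le> degree A"
        unfolding B_def by (rule degree_map_poly_le)
      finally show False
        using deg by simp
    qed
    then have "coeff B j = 0"
      by simp
    then show ?thesis
      by (simp add: B_def coeff_map_poly)
  qed
  have "coeff A j = 0" for j
  proof (rule ccontr)
    assume nz: "coeff A j \<noteq> 0"
    have "x_coords \<subseteq> {a. poly (coeff A j) a = 0}"
      using vanish by auto
    then have "e + 1 \<le> card {a. poly (coeff A j) a = 0}"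
      using card_mono[OF poly_roots_finite[OF nz]] card_x_coords by metis
    also have "\<dots> \<le> degree (coeff A j)"
      by (rule card_poly_roots_bound[OF nz])
    finally have "u * (e + 1) \<le> u * degree (coeff A j)"
      by (rule mult_le_mono2)
    moreover have "(degree (coeff A j), j) \<in> monomials A"
      using nz by (simp add: monomials_def)
    then have "u * degree (coeff A j) + l * j \<le> m"
      using A(1) by (auto simp: polys_of_weight_le_def)
    ultimately show False
      using A(2) by linarith
  qed
  then show ?thesis
    by (simp add: poly_eq_iff)
qed

end


section \<open>The code and its dual\<close>

context trace_curve
begin

lemma comm_ring_hom_eval_point: "comm_ring_hom (\<lambda>A :: 'a poly poly. eval_point A P)"
  unfolding eval_point_eq_ev by (rule comm_ring_hom_ev) (unfold_locales; simp)

lemma eval_point_cong: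
  assumes "curve_poly dvd A - B" "P \<in> pts"
  shows "eval_point A P = eval_point B P"
proof -
  interpret ep: comm_ring_hom "\<lambda>A :: 'a poly poly. eval_point A P"
    by (rule comm_ring_hom_eval_point)
  have id: "comm_ring_hom (\<lambda>a :: 'a. a)"
    by unfold_locales simp_all
  have "on_curve n q l (fst P) (snd P)"
    using assms(2) by (auto simp: rational_points_def)
  then have "eval_point (A - B) P = 0"
    unfolding eval_point_eq_ev by (rule ev_curve_poly_multiple[OF id _ assms(1)])
  then show ?thesis
    by (simp add: ep.hom_minus)
qed

lemma eval_point_pCons:
  "eval_point (pCons r A) P = poly r (fst P) + snd P * eval_point (A :: 'a poly poly) P"
proof -
  have "map_poly (\<lambda>r. poly r (fst P)) (pCons r A) = pCons (poly r (fst P)) (map_poly (\<lambda>r. poly r (fst P)) A)"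
    by (intro poly_eqI) (simp add: coeff_map_poly coeff_pCons split: nat.splits)
  then show ?thesis
    by (simp add: eval_point_def)
qed

lemma eval_point_0 [simp]: "eval_point (0 :: 'a poly poly) P = 0"
  by (simp add: eval_point_def)

lemma eval_point_const: "eval_point [:[:c:]:] P = (c :: 'a)"
  by (simp add: eval_point_pCons)

text \<open>
  Every other point is separated from \<open>P\<close> by a linear polynomial in one coordinate; multiply these.
\<close>

lemma ex_point_indicator:
  assumes "finite Z" "P \<notin> Z"
  shows "\<exists>A :: 'a poly poly. eval_point A P \<noteq> 0 \<and> (\<forall>R\<in>Z. eval_point A R = 0)"
proof -
  have "\<exists>A :: 'a poly poly. eval_point A P \<noteq> 0 \<and> eval_point A R = 0" if "R \<noteq> P" for R
  proof (cases "fst R = fst P")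
    case False
    have "eval_point [:[:- fst R, 1:]:] T = fst T - fst R" for T :: "'a \<times> 'a"
      by (simp add: eval_point_pCons)
    then show ?thesis
      using False by (intro exI[of _ "[:[:- fst R, 1:]:]"]) simp
  next
    case True
    then have "snd R \<noteq> snd P"
      using that by (simp add: prod_eq_iff)
    moreover have "eval_point [:[:- snd R:], 1:] T = snd T - snd R" for T :: "'a \<times> 'a"
      by (simp add: eval_point_pCons one_pCons)
    ultimately show ?thesis
      by (intro exI[of _ "[:[:- snd R:], 1:]"]) simp
  qed
  then obtain F where F: "eval_point (F R) P \<noteq> 0" "eval_point (F R) R = 0" if "R \<noteq> P" for R
    by metis
  interpret ep: comm_ring_hom "\<lambda>A :: 'a poly poly. eval_point A T" for T
    by (rule comm_ring_hom_eval_point)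
  show ?thesis
  proof (intro exI[of _ "\<Prod>R\<in>Z. F R"] conjI ballI)
    show "eval_point (\<Prod>R\<in>Z. F R) P \<noteq> 0"
      unfolding ep.hom_prod prod_zero_iff[OF assms(1)]
    proof
      assume "\<exists>R\<in>Z. eval_point (F R) P = 0"
      then obtain R where R: "R \<in> Z" "eval_point (F R) P = 0" ..
      then have "R \<noteq> P"
        using assms(2) by auto
      then show False
        using F(1) R(2) by simp
    qed
    show "eval_point (\<Prod>R\<in>Z. F R) R = 0" if "R \<in> Z" for R
      unfolding ep.hom_prod by (rule prod_zero[OF assms(1)]) (use F(2)[of R] that assms(2) in blast)
  qed
qed

lemma polys_of_weight_le_closed:
  assumes "A \<in> polys_of_weight_le m" "B \<in> polys_of_weight_le m"
  shows "A + B \<in> polys_of_weight_le m" "A - B \<in> polys_of_weight_le m"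
    "[:[:c:]:] * A \<in> polys_of_weight_le m"
proof -
  have "monomials (A + B) \<subseteq> monomials A \<union> monomials B" "monomials (A - B) \<subseteq> monomials A \<union> monomials B"
    "monomials ([:[:c:]:] * A) \<subseteq> monomials A"
    by (auto simp: monomials_def)
  then show "A + B \<in> polys_of_weight_le m" "A - B \<in> polys_of_weight_le m"
    "[:[:c:]:] * A \<in> polys_of_weight_le m"
    using assms unfolding polys_of_weight_le_iff by blast+
qed

lemma zero_in_polys_of_weight_le: "0 \<in> polys_of_weight_le m"
  by (simp add: polys_of_weight_le_iff monomials_def)

lemma polys_of_weight_le_weight: 
  assumes "A \<noteq> 0"
  shows "A \<in> polys_of_weight_le m \<longleftrightarrow> degree A < u \<and> weight A \<le> m"
  using weight_le_iff[OF assms] by (simp add: polys_of_weight_le_def)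

text \<open>
  Only the monomials \<open>x^i y^(u-1)\<close> contribute to a sum over the rational points.  The weights
  allowed in a product of two elements leave \<open>i < \<mu>e\<close>, and there the sum over \<open>x_coords\<close> vanishes.
\<close>

lemma sum_product_eq_0:
  assumes m: "2 * (m + 1) \<le> (u - 1) * (l - 1) + u * (mu * e + 1)"
    and mu: "mu = (if p dvd e + 1 then 1 else 0)"
    and AB: "A \<in> polys_of_weight_le m" "B \<in> polys_of_weight_le m"
  shows "(\<Sum>P\<in>pts. eval_point A P * eval_point B P) = 0"
proof (cases "A = 0 \<or> B = 0")
  case True
  then show ?thesis
    by (auto simp: eval_point_def)
next
  case False
  interpret ep: comm_ring_hom "\<lambda>A :: 'a poly poly. eval_point A P" for P
    by (rule comm_ring_hom_eval_point)
  obtain R where R: "R \<noteq> 0" "degree R < u" "weight R = weight A + weight B" "curve_poly dvd A * B - R"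
    using ex_reduced_product[of A B] False AB by (auto simp: polys_of_weight_le_def)
  have weight_R: "weight R \<le> 2 * m"
    using R(3) AB False by (simp add: polys_of_weight_le_weight)
  have bound: "mu = 1 \<and> i < e" if nz: "coeff (coeff R (u - 1)) i \<noteq> 0" for i
  proof -
    have "(i, u - 1) \<in> monomials R"
      using nz by (simp add: monomials_def)
    then have "u * i + l * (u - 1) \<le> 2 * m"
      using weight_le_iff[OF R(1), of "2 * m"] weight_R by auto
    then have "u * i + l * (u - 1) + 2 \<le> (u - 1) * (l - 1) + u * (mu * e + 1)"
      using m by simp
    moreover have "l * (u - 1) = (u - 1) * (l - 1) + (u - 1)"
      using l by (cases l) auto
    moreover have "u * (mu * e + 1) = u * (mu * e) + (u - 1) + 1"
      using u_pos by simp
    ultimately have "u * i < u * (mu * e)"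
      by linarith
    then have "i < mu * e"
      by simp
    then show ?thesis
      using mu by (auto split: if_splits)
  qed
  have "(\<Sum>P\<in>pts. eval_point A P * eval_point B P) = (\<Sum>P\<in>pts. eval_point R P)"
    using eval_point_cong[OF R(4)] by (intro sum.cong refl) (simp add: ep.hom_mult)
  also have "\<dots> = (\<Sum>a\<in>x_coords. poly (coeff R (u - 1)) a)"
    by (rule sum_pts[OF R(2)])
  also have "\<dots> = (\<Sum>i\<le>degree (coeff R (u - 1)). coeff (coeff R (u - 1)) i * (\<Sum>a\<in>x_coords. a ^ i))"
    unfolding poly_altdef sum_distrib_left by (rule sum.swap)
  also have "\<dots> = 0"
  proof (rule sum.neutral, rule ballI)
    fix i
    show "coeff (coeff R (u - 1)) i * (\<Sum>a\<in>x_coords. a ^ i) = 0"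
      using bound[of i] mu sum_x_coords_power[of i] by (auto split: if_splits)
  qed
  finally show ?thesis .
qed

text \<open>
  Since points can be separated by polynomials, the functional \<open>A \<mapsto> \<Sum>P\<in>J. w P * A P\<close> is not zero.
  Let \<open>M > m\<close> be the least weight at which it does not vanish, and \<open>2g = (u - 1)(l - 1)\<close>.  At least
  \<open>M + 1 - 2g\<close> weights \<open>\<gamma>\<close> have a complementary weight \<open>M - \<gamma>\<close>.  A combination \<open>A\<close> of monomials
  with such weights that vanishes on \<open>J\<close> is \<open>0\<close>, since otherwise multiplying it by a monomial
  gives a polynomial of weight \<open>M\<close> that vanishes on \<open>J\<close>.  So \<open>J\<close> has at least \<open>M + 1 - 2g\<close>
  elements.
\<close>

lemma dual_support_bound:
  assumes m: "(int u - 1) * (int l - 1) \<le> int m + 1"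
    and J: "J \<subseteq> pts" "J \<noteq> {}" "\<And>P. P \<in> J \<Longrightarrow> w P \<noteq> 0"
    and zero: "\<And>A. A \<in> polys_of_weight_le m \<Longrightarrow> (\<Sum>P\<in>J. w P * eval_point A P) = 0"
  shows "int m + 2 - (int u - 1) * (int l - 1) \<le> int (card J)"
proof -
  interpret ep: comm_ring_hom "\<lambda>A :: 'a poly poly. eval_point A P" for P
    by (rule comm_ring_hom_eval_point)
  have finJ: "finite J"
    using finite_subset[OF J(1)] by simp
  define \<psi> where "\<psi> A = (\<Sum>P\<in>J. w P * eval_point A P)" for A
  have \<psi>_diff: "\<psi> (A - B) = \<psi> A - \<psi> B" for A B
    by (simp add: \<psi>_def ep.hom_minus right_diff_distrib sum_subtractf)
  have \<psi>_smult: "\<psi> ([:[:c:]:] * A) = c * \<psi> A" for c A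
    unfolding \<psi>_def ep.hom_mult eval_point_const by (simp add: sum_distrib_left mult_ac)
  have \<psi>_cong: "\<psi> A = \<psi> B" if "curve_poly dvd A - B" for A B
    unfolding \<psi>_def using eval_point_cong[OF that] J(1) by (intro sum.cong refl) auto
  define nonzero_at where "nonzero_at k \<longleftrightarrow> (\<exists>A\<in>polys_of_weight_le k. \<psi> A \<noteq> 0)" for k
  have "\<exists>k. nonzero_at k"
  proof -
    obtain P where P: "P \<in> J"
      using J(2) by blast
    obtain A :: "'a poly poly" where A: "eval_point A P \<noteq> 0" "\<And>R. R \<in> J - {P} \<Longrightarrow> eval_point A R = 0"
      using ex_point_indicator[of "J - {P}" P] finJ by auto
    have "\<psi> A = w P * eval_point A P"
      unfolding \<psi>_def using P finJ A(2) by (simp add: sum.remove[OF finJ P])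
    then have \<psi>A: "\<psi> A \<noteq> 0"
      using A(1) J(3)[OF P] by simp
    obtain B R where BR: "A = curve_poly * B + R" "degree R < u"
      using ex_reduced by blast
    then have "\<psi> R \<noteq> 0"
      using \<psi>_cong[of A R] \<psi>A by simp
    moreover have "R \<noteq> 0"
      using calculation by (auto simp: \<psi>_def)
    ultimately show ?thesis
      unfolding nonzero_at_def using BR(2) polys_of_weight_le_weight by blast
  qed
  define M where "M = (LEAST k. nonzero_at k)"
  have "nonzero_at M"
    unfolding M_def using \<open>\<exists>k. nonzero_at k\<close> by (rule LeastI_ex)
  then obtain A0 where A0: "A0 \<in> polys_of_weight_le M" "\<psi> A0 \<noteq> 0"
    by (auto simp: nonzero_at_def)
  have below: "\<psi> A = 0" if "degree A < u" "A \<noteq> 0 \<Longrightarrow> weight A < M" for A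
  proof (cases "A = 0")
    case False
    then have "A \<in> polys_of_weight_le (weight A)"
      using that(1) by (simp add: polys_of_weight_le_weight)
    moreover have "\<not> nonzero_at (weight A)"
      using not_less_Least that(2)[OF False] unfolding M_def by blast
    ultimately show ?thesis
      by (auto simp: nonzero_at_def)
  qed (simp add: \<psi>_def)
  have "A0 \<noteq> 0"
    using A0(2) by (auto simp: \<psi>_def)
  have degA0: "degree A0 < u"
    using A0(1) by (simp add: polys_of_weight_le_def)
  have weight_A0: "weight A0 = M"
  proof -
    have "weight A0 \<le> M"
      using A0(1) \<open>A0 \<noteq> 0\<close> by (simp add: polys_of_weight_le_weight)
    moreover have "\<not> weight A0 < M"
      using below[OF degA0] A0(2) by blast
    ultimately show ?thesis
      by simp
  qed
  have m_less: "m < M"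
  proof (rule ccontr)
    assume "\<not> m < M"
    then have "A0 \<in> polys_of_weight_le m"
      using degA0 \<open>A0 \<noteq> 0\<close> weight_A0 by (simp add: polys_of_weight_le_weight)
    then show False
      using zero A0(2) by (simp add: \<psi>_def)
  qed
  \<comment> \<open>Two polynomials of weight \<open>M\<close> agree up to a scalar factor and lower terms.\<close>
  have at_M: "\<psi> A \<noteq> 0" if A: "degree A < u" "A \<noteq> 0" "weight A = M" for A
  proof
    assume zeroA: "\<psi> A = 0"
    obtain i j where ij: "(i, j) \<in> monomials A" "M = u * i + l * j"
      using ex_weight[OF A(2)] A(3) by auto
    obtain i' j' where ij': "(i', j') \<in> monomials A0" "M = u * i' + l * j'"
      using ex_weight[OF \<open>A0 \<noteq> 0\<close>] weight_A0 by auto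
    have jl: "j < u" "j' < u"
      using monomials_degree[OF ij(1)] monomials_degree[OF ij'(1)] A(1) degA0 by simp_all
    have "i = i'" "j = j'"
      using weight_inj[of i j i' j', OF _ jl] ij(2) ij'(2) by metis+
    note ij'' = ij'(1)[folded this]
    define c where "c = coeff (coeff A j) i / coeff (coeff A0 j) i"
    have c: "c \<noteq> 0"
      using ij(1) ij'' by (simp add: c_def monomials_def)
    define D where "D = A - [:[:c:]:] * A0"
    have degD: "degree D < u"
      unfolding D_def using A(1) degA0
      by (intro degree_diff_less) (auto intro: le_less_trans[OF degree_smult_le])
    have "weight D < M" if D: "D \<noteq> 0"
    proof -
      obtain i1 j1 where ij1: "(i1, j1) \<in> monomials D" "weight D = u * i1 + l * j1"
        using ex_weight[OF D] by auto
      have "(i1, j1) \<in> monomials A \<or> (i1, j1) \<in> monomials A0"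
        using ij1(1) by (auto simp: D_def monomials_def)
      then have "u * i1 + l * j1 \<le> M"
        using weight_le_iff[OF A(2), of M] weight_le_iff[OF \<open>A0 \<noteq> 0\<close>, of M] A(3) weight_A0 by auto
      moreover have "u * i1 + l * j1 \<noteq> M"
      proof
        assume eq: "u * i1 + l * j1 = M"
        have "j1 < u"
          using monomials_degree[OF ij1(1)] degD by simp
        then have "i1 = i" "j1 = j"
          using weight_inj[of i1 j1 i j] eq ij(2) jl(1) by metis+
        moreover have "coeff (coeff D j) i = 0"
          using ij'' by (simp add: D_def c_def monomials_def)
        ultimately show False
          using ij1(1) by (simp add: monomials_def)
      qed
      ultimately show ?thesis
        using ij1(2) by simp
    qed
    then have "\<psi> D = 0"
      using below[OF degD] by blast
    then have "c * \<psi> A0 = 0"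
      using zeroA by (simp only: D_def \<psi>_diff \<psi>_smult) simp
    then show False
      using c A0(2) by simp
  qed
  define wt where "wt = (\<lambda>(i, j). u * i + l * j)"
  define S where "S = {a \<in> monomials_le M. \<exists>a'\<in>monomials_le M. wt a + wt a' = M}"
  have finS: "finite S"
    unfolding S_def using finite_monomials_le by simp
  have inj_wt: "inj_on wt (monomials_le M)"
    by (auto intro!: inj_onI simp: wt_def monomials_le_def dest: weight_inj)
  have card_S: "int M + 1 - (int u - 1) * (int l - 1) \<le> int (card S)"
  proof -
    let ?W = "wt ` monomials_le M"
    let ?W' = "(\<lambda>k. M - k) ` ?W"
    have sub: "?W \<subseteq> {..M}" "?W' \<subseteq> {..M}"
      by (auto simp: wt_def monomials_le_def)
    have "inj_on (\<lambda>k. M - k) ?W"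
    proof (rule inj_onI)
      fix x x' assume "x \<in> ?W" "x' \<in> ?W" and eq: "M - x = M - x'"
      then have "x \<le> M" "x' \<le> M"
        using sub(1) by (blast dest: subsetD)+
      then show "x = x'"
        using eq by linarith
    qed
    then have card_W: "card ?W = card (monomials_le M)" "card ?W' = card (monomials_le M)"
      using inj_wt by (simp_all add: card_image)
    have "card ?W + card ?W' = card (?W \<union> ?W') + card (?W \<inter> ?W')"
      by (rule card_Un_Int) (auto simp: finite_monomials_le)
    moreover have "card (?W \<union> ?W') \<le> M + 1"
      using card_mono[of "{..M}" "?W \<union> ?W'"] sub by simp
    moreover have "?W \<inter> ?W' \<subseteq> wt ` S"
    proof
      fix k assume "k \<in> ?W \<inter> ?W'"
      then obtain a a' where a: "a \<in> monomials_le M" "k = wt a" "a' \<in> monomials_le M" "k = M - wt a'"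
        by auto
      have "wt a' \<le> M"
        using sub(1) a(3) by auto
      then have "wt a + wt a' = M"
        using a(2,4) by linarith
      then have "a \<in> S"
        using a(1,3) unfolding S_def by blast
      then show "k \<in> wt ` S"
        using a(2) by blast
    qed
    then have "card (?W \<inter> ?W') \<le> card S"
      using surj_card_le[OF finS] by blast
    ultimately have "2 * card (monomials_le M) \<le> M + 1 + card S"
      using card_W by linarith
    then have "int (2 * card (monomials_le M)) \<le> int (M + 1 + card S)"
      by (simp only: of_nat_le_iff)
    then have "2 * int (card (monomials_le M)) \<le> int M + 1 + int (card S)"
      by simp
    moreover have "(int u - 1) * (int l - 1) \<le> int M + 1"
      using m m_less by linarith
    then have "2 * int (card (monomials_le M)) = 2 * (int M + 1) - (int u - 1) * (int l - 1)"
      by (rule card_monomials_le)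
    moreover have "x + 1 - z \<le> c" if "2 * b \<le> x + 1 + c" "2 * b = 2 * (x + 1) - z" for b c x z :: int
      using that by presburger
    ultimately show ?thesis
      by blast
  qed
  let ?U = "{A :: 'a poly poly. monomials A \<subseteq> S}"
  have "inj_on (\<lambda>A. restrict (eval_point A) J) ?U"
  proof (rule inj_onI, rule ccontr)
    fix A B assume AB: "A \<in> ?U" "B \<in> ?U" "restrict (eval_point A) J = restrict (eval_point B) J" "A \<noteq> B"
    define D where "D = A - B"
    have "monomials D \<subseteq> monomials A \<union> monomials B"
      by (auto simp: D_def monomials_def)
    then have D: "D \<noteq> 0" "monomials D \<subseteq> S"
      using AB by (auto simp: D_def)
    have "eval_point A P = eval_point B P" if "P \<in> J" for P
      using fun_cong[OF AB(3), of P] that by simp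
    then have D_zero: "eval_point D P = 0" if "P \<in> J" for P
      using that by (simp add: D_def ep.hom_minus)
    have "D \<in> polys_of_weight_le M"
      using D(2) by (auto simp: polys_of_weight_le_iff S_def)
    then have degD: "degree D < u"
      by (simp add: polys_of_weight_le_def)
    obtain a where a: "a \<in> monomials D" "weight D = wt a"
      using ex_weight[OF D(1)] by (auto simp: wt_def)
    obtain i j where ij: "(i, j) \<in> monomials_le M" "wt a + wt (i, j) = M"
      using a(1) D(2) by (auto simp: S_def)
    define B' :: "'a poly poly" where "B' = monom (monom 1 i) j"
    have mon_B': "monomials B' = {(i, j)}"
      by (auto simp: B'_def monomials_def split: if_splits)
    have B': "B' \<noteq> 0" "degree B' < u" "weight B' = wt (i, j)"
      using mon_B' monomials_eq_empty_iff[of B'] ij(1) degree_monom_le[of "monom 1 i :: 'a poly" j]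
      by (auto simp: weight_def wt_def B'_def monomials_le_def)
    obtain R where R: "R \<noteq> 0" "degree R < u" "weight R = weight D + weight B'" "curve_poly dvd D * B' - R"
      using ex_reduced_product[OF D(1) degD B'(1,2)] by blast
    have "\<psi> (D * B') = 0"
      unfolding \<psi>_def using D_zero by (intro sum.neutral) (simp add: ep.hom_mult)
    then have "\<psi> R = 0"
      using \<psi>_cong[OF R(4)] by simp
    moreover have "weight R = M"
      using R(3) a(2) B'(3) ij(2) by simp
    ultimately show False
      using at_M[OF R(2,1)] by blast
  qed
  then have "card ?U \<le> card (J \<rightarrow>\<^sub>E (UNIV :: 'a set))"
    by (rule card_inj_on_le) (auto simp: finJ intro!: finite_PiE)
  also have "\<dots> = CARD('a) ^ card J"
    by (simp add: card_PiE finJ)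
  finally have "CARD('a) ^ card S \<le> CARD('a) ^ card J"
    by (simp add: card_polys_monomials_subset finS)
  then have "card S \<le> card J"
    using q_n_gt_1 by (simp add: CARD_eq)
  then show ?thesis
    using card_S m_less by linarith
qed

definition evaluate :: "('a \<times> 'a) list \<Rightarrow> 'a poly poly \<Rightarrow> 'a vec" where
  "evaluate Ps A = vec_of_list (map (eval_point A) Ps)"

definition code :: "('a \<times> 'a) list \<Rightarrow> nat \<Rightarrow> 'a vec set" where
  "code Ps m = evaluate Ps ` polys_of_weight_le m"

lemma evaluate_dim: "dim_vec (evaluate Ps A) = length Ps"
  by (simp add: evaluate_def)

lemma evaluate_carrier: "evaluate Ps A \<in> carrier_vec (length Ps)"
  by (rule carrier_vecI) (rule evaluate_dim)

lemma evaluate_index: "i < length Ps \<Longrightarrow> vec_index (evaluate Ps A) i = eval_point A (Ps ! i)"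
  by (simp add: evaluate_def vec_of_list_index)

lemma linear_code_code: "linear_code (length Ps) (code Ps m)"
proof -
  interpret ep: comm_ring_hom "\<lambda>A :: 'a poly poly. eval_point A P" for P
    by (rule comm_ring_hom_eval_point)
  have hom: "evaluate Ps A + evaluate Ps B = evaluate Ps (A + B)"
    "c \<cdot>\<^sub>v evaluate Ps A = evaluate Ps ([:[:c:]:] * A)" "evaluate Ps 0 = 0\<^sub>v (length Ps)" for A B c
    by (rule eq_vecI; simp add: evaluate_dim evaluate_index ep.hom_add ep.hom_mult eval_point_const
        del: mult_pCons_left)+
  show ?thesis
    unfolding linear_code_def
  proof (intro conjI ballI allI)
    show "code Ps m \<subseteq> carrier_vec (length Ps)"
      unfolding code_def using evaluate_carrier by blast
    show "0\<^sub>v (length Ps) \<in> code Ps m"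
      unfolding code_def hom(3)[symmetric] by (rule imageI) (rule zero_in_polys_of_weight_le)
    fix v w assume "v \<in> code Ps m"
    then obtain A where A: "v = evaluate Ps A" "A \<in> polys_of_weight_le m"
      unfolding code_def by blast
    show "c \<cdot>\<^sub>v v \<in> code Ps m" for c
      unfolding A(1) hom(2) code_def by (rule imageI) (rule polys_of_weight_le_closed(3)[OF A(2,2)])
    assume "w \<in> code Ps m"
    then obtain B where B: "w = evaluate Ps B" "B \<in> polys_of_weight_le m"
      unfolding code_def by blast
    show "v + w \<in> code Ps m"
      unfolding A(1) B(1) hom(1) code_def by (rule imageI) (rule polys_of_weight_le_closed(1)[OF A(2) B(2)])
  qed
qed

lemma sum_nth_eq_sum_set:
  assumes "distinct Ps"
  shows "(\<Sum>i<length Ps. f (Ps ! i)) = (\<Sum>P\<in>set Ps. f P)"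
  using assms by (simp add: sum.distinct_set_conv_list sum_list_sum_nth lessThan_atLeast0)

lemma card_code:
  assumes Ps: "set Ps = pts" and m: "m < u * (e + 1)"
  shows "card (code Ps m) = CARD('a) ^ card (monomials_le m)"
proof -
  interpret ep: comm_ring_hom "\<lambda>A :: 'a poly poly. eval_point A P" for P
    by (rule comm_ring_hom_eval_point)
  have "inj_on (evaluate Ps) (polys_of_weight_le m)"
  proof (rule inj_onI)
    fix A B assume AB: "A \<in> polys_of_weight_le m" "B \<in> polys_of_weight_le m" "evaluate Ps A = evaluate Ps B"
    have "eval_point (A - B) P = 0" if "P \<in> pts" for P
    proof -
      obtain i where "i < length Ps" "P = Ps ! i"
        using \<open>P \<in> pts\<close> by (metis Ps in_set_conv_nth)
      then show ?thesis
        using evaluate_index[of i Ps A] evaluate_index[of i Ps B] AB(3) by (simp add: ep.hom_minus)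
    qed
    then have "A - B = 0"
      by (rule vanishing_imp_0[OF polys_of_weight_le_closed(2)[OF AB(1,2)] m])
    then show "A = B"
      by simp
  qed
  then show ?thesis
    unfolding code_def by (simp add: card_image card_polys_of_weight_le)
qed

lemma code_self_orthogonal:
  assumes Ps: "distinct Ps" "set Ps = pts"
    and m: "2 * (m + 1) \<le> (u - 1) * (l - 1) + u * (mu * e + 1)"
    and mu: "mu = (if p dvd e + 1 then 1 else 0)"
  shows "code Ps m \<subseteq> dual_code (length Ps) (code Ps m)"
proof -
  have "evaluate Ps A \<bullet> evaluate Ps B = 0" if "A \<in> polys_of_weight_le m" "B \<in> polys_of_weight_le m" for A B
  proof -
    have "evaluate Ps A \<bullet> evaluate Ps B = (\<Sum>i<length Ps. eval_point A (Ps ! i) * eval_point B (Ps ! i))"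
      unfolding scalar_prod_def evaluate_dim lessThan_atLeast0
      by (rule sum.cong) (auto simp: evaluate_index)
    also have "\<dots> = (\<Sum>P\<in>pts. eval_point A P * eval_point B P)"
      using sum_nth_eq_sum_set[OF Ps(1), of "\<lambda>P. eval_point A P * eval_point B P"] Ps(2) by simp
    finally show ?thesis
      using sum_product_eq_0[OF m mu that] by simp
  qed
  then show ?thesis
    unfolding code_def dual_code_def using evaluate_carrier by blast
qed

lemma dual_code_distance:
  assumes Ps: "distinct Ps" "set Ps = pts"
    and m: "(int u - 1) * (int l - 1) \<le> int m + 1"
    and w: "w \<in> dual_code (length Ps) (code Ps m)" "w \<noteq> 0\<^sub>v (length Ps)"
  shows "int m + 2 - (int u - 1) * (int l - 1) \<le> int (card {i. i < length Ps \<and> vec_index w i \<noteq> 0})"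
proof -
  let ?I = "{i. i < length Ps \<and> vec_index w i \<noteq> 0}"
  define J where "J = (\<lambda>i. Ps ! i) ` ?I"
  have inj: "inj_on (\<lambda>i. Ps ! i) ?I"
    using Ps(1) by (auto simp: inj_on_def nth_eq_iff_index_eq)
  \<comment> \<open>The entry of \<open>w\<close> at the position of the point \<open>P\<close>.\<close>
  define w' where "w' P = vec_index w (THE i. i < length Ps \<and> Ps ! i = P)" for P
  have w': "w' (Ps ! i) = vec_index w i" if "i < length Ps" for i
  proof -
    have "(THE j. j < length Ps \<and> Ps ! j = Ps ! i) = i"
      using that Ps(1) by (intro the_equality) (auto simp: nth_eq_iff_index_eq)
    then show ?thesis
      by (simp add: w'_def)
  qed
  have dim: "dim_vec w = length Ps"
    using w(1) by (simp add: dual_code_def)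
  have "?I \<noteq> {}"
  proof
    assume "?I = {}"
    then have "w = 0\<^sub>v (length Ps)"
      using dim by (intro eq_vecI) auto
    then show False
      using w(2) by simp
  qed
  have "int m + 2 - (int u - 1) * (int l - 1) \<le> int (card J)"
  proof (rule dual_support_bound[where w = w', OF m])
    show "J \<subseteq> pts"
      unfolding J_def Ps(2)[symmetric] by (rule image_subsetI) simp
    show "J \<noteq> {}"
      using \<open>?I \<noteq> {}\<close> unfolding J_def by blast
    show "w' P \<noteq> 0" if P: "P \<in> J" for P
    proof -
      obtain i where i: "P = Ps ! i" "i < length Ps" "vec_index w i \<noteq> 0"
        using P unfolding J_def by blast
      then show ?thesis
        by (simp only: i(1) w')  simp
    qed
    show "(\<Sum>P\<in>J. w' P * eval_point A P) = 0" if A: "A \<in> polys_of_weight_le m" for A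
    proof -
      have "evaluate Ps A \<bullet> w = 0"
        using w(1) A by (auto simp: dual_code_def code_def)
      then have "(\<Sum>i<length Ps. eval_point A (Ps ! i) * vec_index w i) = 0"
        unfolding scalar_prod_def dim lessThan_atLeast0 by (simp add: evaluate_index)
      also have "(\<Sum>i<length Ps. eval_point A (Ps ! i) * vec_index w i) =
          (\<Sum>i\<in>?I. w' (Ps ! i) * eval_point A (Ps ! i))"
        by (rule sum.mono_neutral_cong_right) (auto simp: w' mult.commute)
      also have "\<dots> = (\<Sum>P\<in>J. w' P * eval_point A P)"
        unfolding J_def by (simp add: sum.reindex[OF inj])
      finally show ?thesis .
    qed
  qed
  then show ?thesis
    unfolding J_def card_image[OF inj] .
qed

end

context trace_function_field
begin

text \<open>
  Two representations of a function as a fraction agree on the curve, so its value at a point does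
  not depend on the representation.
\<close>

lemma value_at_E:
  assumes "P \<in> pts"
  shows "value_at y (E A) P = eval_point A P"
  unfolding value_at_def
proof (rule the_equality)
  show "\<exists>A' B. eval_point B P \<noteq> 0 \<and> E A = eval_fun A' y / eval_fun B y \<and>
      eval_point A P = eval_point A' P / eval_point B P"
    by (intro exI[of _ A] exI[of _ 1]) (simp add: eval_fun_eq_ev eval_point_def)
  fix c assume "\<exists>A' B. eval_point B P \<noteq> 0 \<and> E A = eval_fun A' y / eval_fun B y \<and>
      c = eval_point A' P / eval_point B P"
  then obtain A' B where AB: "eval_point B P \<noteq> 0" "E A = E A' / E B" "c = eval_point A' P / eval_point B P"
    by (auto simp: eval_fun_eq_ev)
  interpret ep: comm_ring_hom "\<lambda>A :: 'a poly poly. eval_point A P"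
    by (rule comm_ring_hom_eval_point)
  have "E B \<noteq> 0"
  proof
    assume "E B = 0"
    then have "curve_poly dvd B - 0"
      by (simp add: E_eq_0_iff)
    then show False
      using eval_point_cong[OF _ assms] AB(1) by (metis ep.hom_zero)
  qed
  then have "E A * E B = E A'"
    using AB(2) by simp
  then have "E (A * B - A') = 0"
    by (simp add: E.hom_minus E.hom_mult)
  then have "eval_point (A * B) P = eval_point A' P"
    using eval_point_cong[OF _ assms] E_eq_0_iff by blast
  then have "eval_point A' P = eval_point A P * eval_point B P"
    by (simp add: ep.hom_mult)
  then show "c = eval_point A P"
    using AB(1,3) by simp
qed

lemma AG_code_eq:
  assumes "set Ps = pts"
  shows "AG_code y Ps m = code Ps m"
proof -
  have "vec_of_list (map (value_at y (E A)) Ps) = evaluate Ps A" for A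
    unfolding evaluate_def using assms by (intro arg_cong[of _ _ vec_of_list] map_cong refl value_at_E) auto
  then show ?thesis
    unfolding AG_code_def RR_space_eq code_def image_image by simp
qed

end

theorem theorem7p3:
  fixes p q l n s e N g m mu :: nat
    and y :: "'a::{finite,field} ratfun_closure"
    and Ps :: "('a \<times> 'a) list"
  assumes "prime p" and "s \<ge> 1" and "q = p ^ s"
    and "l \<ge> 1" and "n \<ge> 1" and "\<not> (l = 1 \<and> n = 1)"
    and "gcd p l = 1"
    and "CARD('a) = q ^ n"
    and "e = gcd (l * (q - 1)) (q ^ n - 1)"
    and "N = q ^ (n - 1) * (e + 1)"
    and "real g = (real q ^ (n - 1) - 1) * (real l - 1) / 2"
    and "on_curve n q l x_fun y"
    and "distinct Ps" and "set Ps = rational_points n q l"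
    and "2 * int g - 2 < int m" and "m < N"
    and "mu = (if p dvd e + 1 then 1 else 0)"
    and "2 * (m + 1) \<le> (q ^ (n - 1) - 1) * (l - 1) + q ^ (n - 1) * (mu * e + 1)"
  shows "\<exists>V :: ('a vec \<Rightarrow> complex) set.
           obtained_from N (AG_code y Ps m) V \<and>
           stabilizer_code N (int N - 2 * int m + 2 * int g - 2) (int m - 2 * int g + 2) V"
proof -
  interpret X: trace_function_field p s q l n "TYPE('a)" y
    by unfold_locales (fact assms)+
  interpret char_power_card "s * n" "TYPE('a)"
    by unfold_locales (simp only: assms(3,8) X.CHAR_eq power_mult)
  have u: "q ^ (n - 1) = X.u" and e: "e = X.e"
    by (rule X.u_def[symmetric]) (unfold assms(9), rule X.e_def[symmetric])
  have "real (2 * g) = (real X.u - 1) * (real l - 1)"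
    using assms(11) by (simp flip: u)
  then have "real_of_int (2 * int g) = real_of_int ((int X.u - 1) * (int l - 1))"
    by simp
  then have g: "2 * int g = (int X.u - 1) * (int l - 1)"
    by (simp only: of_int_eq_iff)
  have N: "N = X.u * (X.e + 1)"
    by (simp only: assms(10) u e)
  have len: "length Ps = N"
    using distinct_card[OF assms(13)] by (simp only: assms(14) X.card_pts N)
  let ?C = "X.code Ps m"
  have C: "AG_code y Ps m = ?C"
    using X.AG_code_eq assms(14) by blast
  interpret self_orthogonal_code "s * n" "TYPE('a)" N ?C
  proof unfold_locales
    show "linear_code N ?C"
      using X.linear_code_code[of Ps m] by (simp only: len)
    show "?C \<subseteq> dual_code N ?C"
      using X.code_self_orthogonal[OF assms(13,14) assms(18)[unfolded u e] assms(17)[unfolded e]]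
      by (simp only: len)
  qed
  have mg: "(int X.u - 1) * (int l - 1) \<le> int m + 1"
    using assms(15) unfolding g by simp
  have k: "int (card (X.monomials_le m)) = int m + 1 - int g"
    using X.card_monomials_le[OF mg] unfolding g[symmetric] by simp
  have "stabilizer_code N (int N - 2 * int (card (X.monomials_le m))) (int m - 2 * int g + 2) V"
  proof (rule stabilizer_code_V)
    show "card ?C = CARD('a) ^ card (X.monomials_le m)"
      using assms(16) unfolding N by (rule X.card_code[OF assms(14)])
    fix w assume "w \<in> dual_code N ?C" "w \<noteq> 0\<^sub>v N"
    then show "int m - 2 * int g + 2 \<le> int (card {i. i < N \<and> vec_index w i \<noteq> 0})"
      using X.dual_code_distance[OF assms(13,14) mg, of w] unfolding g[symmetric] len by simp
  qed
  moreover have "int N - 2 * int (card (X.monomials_le m)) = int N - 2 * int m + 2 * int g - 2"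
    using k by simp
  moreover have "obtained_from N (AG_code y Ps m) V"
    unfolding obtained_from_def C using linear self_orthogonal by blast
  ultimately show ?thesis
    by auto
qed

end
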